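(* Let $\pi=1/2$ and write $\bar r=\bar r_{\mathrm{sym}}$. (a) (Maximum likelihood estimation) There is a constant $C>0$ not depending on $n$ such that for all $n\ge 2$, $$\sup_{\boldsymbol\eta\in H}\ \mathbb E_{\boldsymbol\eta}\big[\varphi_{\bar r}(\hat{\boldsymbol\eta}_n,\boldsymbol\eta)\big]\ \le\ C\left(\frac{\log n}{n}\right)^{\frac{1}{2\bar r}},$$ where the expectation is taken with respect to the product distribution of an i.i.d. sample $Y_1,\dots,Y_n$ from the density $g(\cdot,\boldsymbol\eta)$, and $\hat{\boldsymbol\eta}_n$ is the maximum likelihood estimator over $H$. (b) (Minimax lower bound) Let $v_0\in\operatorname{int}(\Omega)$, $\boldsymbol\eta_0=(0,v_0,v_0)$, and for $\kappa>0$ let $$H(\kappa)=\big\{\boldsymbol\eta\in H:\ \varphi_{\bar r}^{\bar r}(\boldsymbol\eta,\boldsymbol\eta_0)\le\kappa\big\},$$ where $\varphi_{\bar r}^{\bar r}$ denotes the $\bar r$-th power of $\varphi_{\bar r}$. Then there exist constants $c_2>0$ and $C'>0$, not depending on $n$, such that for all $n\ge1$, $$\inf_{\tilde{\boldsymbol\eta}_n}\ \sup_{\boldsymbol\eta\in H(c_2n^{-1/2})}\ \mathbb E_{\boldsymbol\eta}\big[\varphi_{\bar r}(\tilde{\boldsymbol\eta}_n,\boldsymbol\eta)\big]\ \ge\ C'\left(\frac1n\right)^{\frac{1}{2\bar r}},$$ where the infimum is over all ($H$-valued) estimators $\tilde{\boldsymbol\eta}_n$ based on an i.i.d. sample $Y_1,\dots,Y_n$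 from $g(\cdot,\boldsymbol\eta)$.
   Context: Fix compact sets $\Theta\subset\mathbb R$ and $\Omega\subset(0,\infty)$ with $0\in\operatorname{int}(\Theta)$. For $\theta\in\mathbb R$, $v>0$ let $f(x,\theta,v)=\frac{1}{\sqrt{2\pi_0 v}}\exp\big(-\frac{(x-\theta)^2}{2v}\big)$, $x\in\mathbb R$, be the Gaussian density with mean $\theta$ and variance $v$ (here $\pi_0=3.14159\ldots$). The symbol $\pi$ denotes the known mixing proportion, here $\pi=1/2$. Let $H=\Theta\times\Omega^2$. For $\boldsymbol\eta=(\theta,v_1,v_2)\in H$ define the mixture density $$g(x,\boldsymbol\eta)=\tfrac12 f(x,-\theta,v_1)+\tfrac12 f(x,\theta,v_2),\qquad x\in\mathbb R.$$ Given an i.i.d. sample $Y_1,\dots,Y_n$ from $g(\cdot,\boldsymbol\eta)$, the maximum likelihood estimator $\hat{\boldsymbol\eta}_n$ is a maximizer over $\boldsymbol\eta'\in H$ of $\ell_n(\boldsymbol\eta')=\sum_{i=1}^n\log g(Y_i,\boldsymbol\eta')$ (which exists by compactness of $H$). Loss function: for $r\ge1$ and $\boldsymbol\eta^{(i)}=(\theta^{(i)},v_1^{(i)},v_2^{(i)})\in H$, $i=1,2$, $$\varphi_r(\boldsymbol\eta^{(1)},\boldsymbol\eta^{(2)})=\min\Big\{|\theta^{(1)}-\theta^{(2)}|^r+|v_1^{(1)}-v_1^{(2)}|^{r/2}+|v_2^{(1)}-v_2^{(2)}|^{r/2},\ |\theta^{(1)}+\theta^{(2)}|^r+|v_1^{(1)}-v_2^{(2)}|^{r/2}+|v_2^{(1)}-v_1^{(2)}|^{r/2}\Big\}^{1/r}.$$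 Symmetric order: $\bar r_{\mathrm{sym}}$ is the smallest positive integer $r$ such that the system consisting of the polynomial equations $$\sum_{\alpha_1,\alpha_2,\beta_1,\beta_2}\frac{1}{2^{\alpha_2+\beta_2}}\frac{2^{\beta_1}(-x_1)^{\alpha_1}x_2^{\beta_1}y_2^{\alpha_2}y_3^{\beta_2}}{\alpha_1!\alpha_2!\beta_1!\beta_2!}+\sum_{\alpha_1,\alpha_2}\frac{1}{2^{\alpha_2}}\frac{x_1^{\alpha_1}y_1^{\alpha_2}}{\alpha_1!\alpha_2!}=0,\qquad \ell=1,\dots,r,$$ together with the inequality $$|x_1|^r+|y_1|^{r/2}+|y_2|^{r/2}\le|2x_2-x_1|^r+|y_3-y_1|^{r/2}+|y_2+y_3|^{r/2},$$ has no non-trivial solution $(x_1,x_2,y_1,y_2,y_3)\in\mathbb R^5$. For each $\ell$, the first sum is over nonnegative integers $\alpha_1,\alpha_2,\beta_1,\beta_2$ with $\alpha_1+\beta_1+2\alpha_2+2\beta_2=\ell$, $1\le\alpha_1+\alpha_2\le r$ and $0\le\beta_1+\beta_2\le r-(\alpha_1+\alpha_2)$; the second sum is over nonnegative integers $\alpha_1,\alpha_2$ with $\alpha_1+2\alpha_2=\ell$ and $1\le\alpha_1+\alpha_2\le r$. A solution is non-trivial if at least one of $x_1,y_1,y_2$ is nonzero. (Convention $0^0=1$.) *)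

theory Defs
  imports "HOL-Probability.Probability"
begin

text \<open>
  A parameter is a triple \<open>(\<theta>, v1, v2)\<close>. The library's \<^const>\<open>normal_density\<close> is parametrised by
  the standard deviation, whereas the mixture is parametrised by variances.
\<close>

type_synonym param = "real \<times> real \<times> real"

definition param_space :: "real set \<Rightarrow> real set \<Rightarrow> param set" where
  "param_space \<Theta> \<Omega> = \<Theta> \<times> \<Omega> \<times> \<Omega>"

definition mix_density :: "real \<Rightarrow> param \<Rightarrow> real" where
  "mix_density x = (\<lambda>(\<theta>, v1, v2).
     1/2 * normal_density (- \<theta>) (sqrt v1) x + 1/2 * normal_density \<theta> (sqrt v2) x)"

text \<open>Samples of size \<open>n\<close> are functions on \<open>{..<n}\<close> (extensional outside).\<close>

definition sample_space :: "nat \<Rightarrow> (nat \<Rightarrow> real) measure" where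
  "sample_space n = PiM {..<n} (\<lambda>_. borel)"

definition sample_dist :: "nat \<Rightarrow> param \<Rightarrow> (nat \<Rightarrow> real) measure" where
  "sample_dist n \<eta> = PiM {..<n} (\<lambda>_. density lborel (\<lambda>x. ennreal (mix_density x \<eta>)))"

definition log_lik :: "nat \<Rightarrow> (nat \<Rightarrow> real) \<Rightarrow> param \<Rightarrow> real" where
  "log_lik n y \<eta> = (\<Sum>i<n. ln (mix_density (y i) \<eta>))"

definition estimators :: "nat \<Rightarrow> param set \<Rightarrow> ((nat \<Rightarrow> real) \<Rightarrow> param) set" where
  "estimators n H = measurable (sample_space n) (restrict_space borel H)"

text \<open>
  The likelihood may have several maximisers, so there may be several maximum likelihood estimators:
  every measurable selection of a maximiser counts as one.
\<close>

definition mles :: "nat \<Rightarrow> param set \<Rightarrow> ((nat \<Rightarrow> real) \<Rightarrow> param) set" where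
  "mles n H = {T \<in> estimators n H.
     \<forall>y \<in> space (sample_space n). is_arg_max (log_lik n y) (\<lambda>\<eta>. \<eta> \<in> H) (T y)}"

definition loss :: "real \<Rightarrow> param \<Rightarrow> param \<Rightarrow> real" where
  "loss r = (\<lambda>(\<theta>, v1, v2) (\<theta>', v1', v2').
     min (\<bar>\<theta> - \<theta>'\<bar> powr r + \<bar>v1 - v1'\<bar> powr (r/2) + \<bar>v2 - v2'\<bar> powr (r/2))
         (\<bar>\<theta> + \<theta>'\<bar> powr r + \<bar>v1 - v2'\<bar> powr (r/2) + \<bar>v2 - v1'\<bar> powr (r/2))
       powr (1/r))"

text \<open>
  The risk \<open>E\<^sub>\<eta>[loss r (T Y) \<eta>]\<close>. It takes values in \<^typ>\<open>ennreal\<close> so that suprema over parameters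
  and infima over estimators exist unconditionally.
\<close>

definition risk :: "real \<Rightarrow> nat \<Rightarrow> ((nat \<Rightarrow> real) \<Rightarrow> param) \<Rightarrow> param \<Rightarrow> ennreal" where
  "risk r n T \<eta> = (\<integral>\<^sup>+ y. ennreal (loss r (T y) \<eta>) \<partial>sample_dist n \<eta>)"

definition local_params :: "real set \<Rightarrow> real set \<Rightarrow> nat \<Rightarrow> param \<Rightarrow> real \<Rightarrow> param set" where
  "local_params \<Theta> \<Omega> r \<eta>0 \<kappa> = {\<eta> \<in> param_space \<Theta> \<Omega>. loss r \<eta> \<eta>0 ^ r \<le> \<kappa>}"

text \<open>Index sets of the two sums in the \<open>l\<close>-th polynomial equation; both are finite.\<close>

definition sym_idx1 :: "nat \<Rightarrow> nat \<Rightarrow> (nat \<times> nat \<times> nat \<times> nat) set" where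
  "sym_idx1 r l = {(a1, a2, b1, b2). a1 + b1 + 2 * a2 + 2 * b2 = l \<and>
     1 \<le> a1 + a2 \<and> a1 + a2 \<le> r \<and> b1 + b2 \<le> r - (a1 + a2)}"

definition sym_idx2 :: "nat \<Rightarrow> nat \<Rightarrow> (nat \<times> nat) set" where
  "sym_idx2 r l = {(a1, a2). a1 + 2 * a2 = l \<and> 1 \<le> a1 + a2 \<and> a1 + a2 \<le> r}"

lemma finite_sym_idx1: "finite (sym_idx1 r l)"
  by (rule finite_subset[of _ "{..l} \<times> {..l} \<times> {..l} \<times> {..l}"]) (auto simp: sym_idx1_def)

lemma finite_sym_idx2: "finite (sym_idx2 r l)"
  by (rule finite_subset[of _ "{..l} \<times> {..l}"]) (auto simp: sym_idx2_def)

definition sym_poly :: "nat \<Rightarrow> nat \<Rightarrow> real \<Rightarrow> real \<Rightarrow> real \<Rightarrow> real \<Rightarrow> real \<Rightarrow> real" where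
  "sym_poly r l x1 x2 y1 y2 y3 =
     (\<Sum>(a1, a2, b1, b2) \<in> sym_idx1 r l.
        1 / 2 ^ (a2 + b2) *
        (2 ^ b1 * (- x1) ^ a1 * x2 ^ b1 * y2 ^ a2 * y3 ^ b2) /
        (fact a1 * fact a2 * fact b1 * fact b2)) +
     (\<Sum>(a1, a2) \<in> sym_idx2 r l.
        1 / 2 ^ a2 * (x1 ^ a1 * y1 ^ a2) / (fact a1 * fact a2))"

definition sym_solution :: "nat \<Rightarrow> real \<Rightarrow> real \<Rightarrow> real \<Rightarrow> real \<Rightarrow> real \<Rightarrow> bool" where
  "sym_solution r x1 x2 y1 y2 y3 \<longleftrightarrow>
     (\<forall>l\<in>{1..r}. sym_poly r l x1 x2 y1 y2 y3 = 0) \<and>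
     \<bar>x1\<bar> powr r + \<bar>y1\<bar> powr (r/2) + \<bar>y2\<bar> powr (r/2)
       \<le> \<bar>2 * x2 - x1\<bar> powr r + \<bar>y3 - y1\<bar> powr (r/2) + \<bar>y2 + y3\<bar> powr (r/2)"

text \<open>
  The minimum is attained. Without the truncations, which are vacuous for \<open>l \<le> r\<close>, the \<open>l\<close>-th
  polynomial is the coefficient of \<open>t ^ l\<close> in
  \<open>exp ((2*x2 - x1)*t + (y2 + y3)*t\<^sup>2/2) + exp (x1*t + y1*t\<^sup>2/2) - exp (2*x2*t + y3*t\<^sup>2/2) - 1\<close>.
  If all coefficients vanish then linear independence of the exponentials and the inequality force
  \<open>x1 = y1 = y2 = 0\<close>, and by the Hilbert basis theorem finitely many coefficients suffice.
\<close>

definition sym_order :: nat where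
  "sym_order = (LEAST r. 1 \<le> r \<and>
     \<not> (\<exists>x1 x2 y1 y2 y3. sym_solution r x1 x2 y1 y2 y3 \<and> (x1 \<noteq> 0 \<or> y1 \<noteq> 0 \<or> y2 \<noteq> 0)))"

end

theory Submission
  imports Defs
begin

text \<open>
The moment generating function of the mixture with means \<open>-\<theta>, \<theta>\<close> and variances \<open>v1, v2\<close> is
\<open>exp (a*t\<^sup>2/2) * cosh (\<theta>*t + d*t\<^sup>2/2)\<close> with \<open>a = (v1 + v2)/2\<close> and \<open>d = (v2 - v1)/2\<close>. Hence its cumulants of
order 2, 3, 4 are \<open>a + \<theta>\<^sup>2\<close>, \<open>3*\<theta>*d\<close> and \<open>3*d\<^sup>2 - 2*\<theta>^4\<close>. The first one determines \<open>a\<close> once \<open>\<theta>\<close> is known,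
and the other two determine the pair \<open>(\<theta>, d)\<close> up to a common sign: if \<open>\<theta>*d\<close> is fixed and nonzero, then enlarging
\<open>\<bar>\<theta>\<bar>\<close> shrinks \<open>\<bar>d\<bar>\<close> and makes \<open>3*d\<^sup>2 - 2*\<theta>^4\<close> smaller; if it vanishes, then the sign of \<open>3*d\<^sup>2 - 2*\<theta>^4\<close>
tells which factor is zero. The sign change is exactly the exchange of the two
components. This has two consequences.

First, the polynomial system expresses that two such mixtures agree in their cumulants up to
order \<open>r\<close>, so it has only trivial solutions for \<open>r = 4\<close>, whereas for \<open>r \<le> 3\<close> the mixture of the normal laws with means
\<open>-1, 1\<close> imitates a single normal law. So \<^const>\<open>sym_order\<close> is 4 (\<open>sym_order_eq_4\<close>).

Second, the identification is quantitative: the fourth power of the loss is at most a constant times the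
sum of the differences of the moments of order 2, 3, 4, uniformly over a compact parameter set
(\<open>quartic_loss_le_moments\<close>). A moment difference is at most a constant times the Hellinger distance, so the Hellinger
distance dominates the fourth power of the loss (\<open>affinity_le_quartic_loss\<close>).

For the upper bound, the parameter set is covered by \<open>O(n^3)\<close> points at distance \<open>O(1/n)\<close>. If the
maximum likelihood estimator lies near a net point \<open>\<zeta>\<close>, then the likelihood ratio of \<open>\<zeta>\<close> against the true parameter \<open>\<eta>\<close>
is, up to a harmless tilt, at least 1; the expectation of its square root is the \<open>n\<close>-th power of the Hellinger affinity, hence at most
a constant times \<open>exp (- c*n*L\<^sup>2)\<close>, where \<open>L\<close> is the fourth power of the loss. With \<open>L\<^sup>2\<close> of the order \<open>log n / n\<close> a union bound over the net
succeeds, and the loss itself is of the order \<open>(log n / n) powr (1/8)\<close> (\<open>mle_upper_bound\<close>).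

For the lower bound, the single normal law with variance \<open>v0\<close> is compared with the
mixture with means \<open>-e, e\<close> and common variance \<open>v0 - e\<^sup>2\<close>. Their moments agree up to order 3, so their chi-square
divergence is of order \<open>e^8\<close> (\<open>chi_square_near_gaussian\<close>). For \<open>e\<close> of order \<open>n powr (-1/8)\<close> the two laws
cannot be told apart from \<open>n\<close> observations, although their loss is at least \<open>e\<close> (\<open>minimax_lower_bound\<close>).
\<close>

section \<open>Recovering a location and a variance gap from two cumulants\<close>

text \<open>
If \<open>d \<le> e\<close>, then \<open>3*d\<^sup>2 \<le> 3*e\<^sup>2\<close> and \<open>- 2*s^4 \<le> - 2*t^4\<close>, so the difference of the fourth cumulants has no
cancellation. If \<open>d > e\<close>, then \<open>s*d - t*e\<close> is at least \<open>s*(d - e)\<close> and at least \<open>(s - t)*d\<close>; the first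
estimate controls \<open>d\<^sup>2 - e\<^sup>2\<close> when \<open>d \<le> s\<^sup>2\<close>, the second one controls \<open>s^4 - t^4\<close> when \<open>s\<^sup>2 \<le> d\<close>, and the difference of
the fourth cumulants passes from one to the other.
\<close>

lemma sorted_quartic_bound:
  fixes s t d e R :: real
  assumes "0 \<le> t" "t \<le> s" "s \<le> R" "0 \<le> d" "0 \<le> e"
  defines "E \<equiv> \<bar>s * d - t * e\<bar> + \<bar>(3 * d\<^sup>2 - 2 * s^4) - (3 * e\<^sup>2 - 2 * t^4)\<bar>"
  shows "\<bar>d\<^sup>2 - e\<^sup>2\<bar> \<le> (1 + 4 * R) * E" "\<bar>s^4 - t^4\<bar> \<le> (1 + 4 * R) * E"
proof -
  have R: "0 \<le> R" using assms by simp
  have st: "t^4 \<le> s^4" using assms by (intro power_mono) auto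
  have E0: "0 \<le> E" by (simp add: E_def)
  have RE: "0 \<le> R * E" using R E0 by simp
  have *: "\<bar>d\<^sup>2 - e\<^sup>2\<bar> \<le> (1 + 4 * R) * E \<and> \<bar>s^4 - t^4\<bar> \<le> (1 + 4 * R) * E"
  proof (cases "d \<le> e")
    case True
    then have "d\<^sup>2 \<le> e\<^sup>2" using assms by (intro power_mono) auto
    then have "3 * (e\<^sup>2 - d\<^sup>2) + 2 * (s^4 - t^4) \<le> E"
      unfolding E_def by simp
    then show ?thesis using st RE \<open>d\<^sup>2 \<le> e\<^sup>2\<close> by (simp add: algebra_simps)
  next
    case False
    then have de: "e\<^sup>2 \<le> d\<^sup>2" using assms by (intro power_mono) auto
    define p where "p = s * d - t * e"
    have p1: "s * (d - e) \<le> p" using assms False mult_right_mono[of t s e] by (simp add: p_def algebra_simps)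
    have p2: "(s - t) * d \<le> p" using assms False mult_left_mono[of e d t] by (simp add: p_def algebra_simps)
    have "0 \<le> s * (d - e)" using assms False by simp
    with p1 have p0: "0 \<le> p" by linarith
    have pE: "p + \<bar>3 * (d\<^sup>2 - e\<^sup>2) - 2 * (s^4 - t^4)\<bar> = E"
      using p0 by (simp add: E_def p_def algebra_simps)
    have q: "3 * (d\<^sup>2 - e\<^sup>2) - 2 * (s^4 - t^4) \<le> E - p" "2 * (s^4 - t^4) - 3 * (d\<^sup>2 - e\<^sup>2) \<le> E - p"
      using pE by linarith+
    have "p \<le> E" using pE by linarith
    then have "R * p \<le> R * E" "0 \<le> R * p" using R p0 by (auto intro: mult_left_mono)
    then obtain u v where uv: "u = R * p" "v = R * E" "u \<le> v" "0 \<le> u" by blast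
    have dist: "(1 + 4 * R) * E = E + 4 * v" by (simp add: algebra_simps uv)
    have lin: "D \<le> E + 4 * v \<and> S \<le> E + 4 * v"
      if "D \<le> 2 * u \<or> S \<le> 4 * u" "3 * D - 2 * S \<le> E - p" "2 * S - 3 * D \<le> E - p" for D S :: real
      using that uv(3,4) p0 E0 by linarith
    have goal: ?thesis if "d\<^sup>2 - e\<^sup>2 \<le> 2 * u \<or> s^4 - t^4 \<le> 4 * u"
      unfolding dist using lin[OF that q] de st by auto
    show ?thesis
    proof (cases "s\<^sup>2 \<le> d")
      case True
      have "s^4 - t^4 = (s - t) * ((s + t) * (s\<^sup>2 + t\<^sup>2))"
        by (simp add: algebra_simps power2_eq_square power4_eq_xxxx)
      also have "\<dots> \<le> (s - t) * ((2 * R) * (2 * d))"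
      proof (intro mult_left_mono mult_mono add_nonneg_nonneg)
        show "s\<^sup>2 + t\<^sup>2 \<le> 2 * d" using assms True power_mono[of t s 2] by linarith
      qed (use assms in auto)
      also have "\<dots> = 4 * R * ((s - t) * d)" by simp
      also have "\<dots> \<le> 4 * R * p" using R p2 by (intro mult_left_mono) auto
      finally have "s^4 - t^4 \<le> 4 * u" by (simp add: uv)
      then show ?thesis by (intro goal) simp
    next
      case F2: False
      have "d\<^sup>2 - e\<^sup>2 = (d - e) * (d + e)" by (simp add: algebra_simps power2_eq_square)
      also have "\<dots> \<le> (d - e) * (2 * s\<^sup>2)"
        using False F2 assms by (intro mult_left_mono) auto
      also have "\<dots> = 2 * s * (s * (d - e))" by (simp add: power2_eq_square)
      also have "\<dots> \<le> 2 * R * p"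
        using False assms R p1 by (intro mult_mono) auto
      finally have "d\<^sup>2 - e\<^sup>2 \<le> 2 * u" by (simp add: uv)
      then show ?thesis by (intro goal) simp
    qed
  qed
  show "\<bar>d\<^sup>2 - e\<^sup>2\<bar> \<le> (1 + 4 * R) * E" "\<bar>s^4 - t^4\<bar> \<le> (1 + 4 * R) * E" using * by auto
qed

text \<open>
Passing to absolute values does not increase the right-hand side, and the claim is symmetric under
exchanging the two pairs, so the sorted nonnegative case suffices.
\<close>

lemma quartic_bound:
  fixes s t d e R :: real
  assumes "\<bar>s\<bar> \<le> R" "\<bar>t\<bar> \<le> R"
  defines "E \<equiv> \<bar>s * d - t * e\<bar> + \<bar>(3 * d\<^sup>2 - 2 * s^4) - (3 * e\<^sup>2 - 2 * t^4)\<bar>"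
  shows "\<bar>d\<^sup>2 - e\<^sup>2\<bar> \<le> (1 + 4 * R) * E" "\<bar>s^4 - t^4\<bar> \<le> (1 + 4 * R) * E"
proof -
  define E' where "E' = \<bar>\<bar>s\<bar> * \<bar>d\<bar> - \<bar>t\<bar> * \<bar>e\<bar>\<bar> + \<bar>(3 * \<bar>d\<bar>\<^sup>2 - 2 * \<bar>s\<bar>^4) - (3 * \<bar>e\<bar>\<^sup>2 - 2 * \<bar>t\<bar>^4)\<bar>"
  have "E' \<le> E" unfolding E'_def E_def abs_mult[symmetric] 
    by (simp add: abs_triangle_ineq3 power_even_abs)
  then have E': "(1 + 4 * R) * E' \<le> (1 + 4 * R) * E"
    using assms by (intro mult_left_mono) auto
  have E'2: "E' = \<bar>\<bar>t\<bar> * \<bar>e\<bar> - \<bar>s\<bar> * \<bar>d\<bar>\<bar> + \<bar>(3 * \<bar>e\<bar>\<^sup>2 - 2 * \<bar>t\<bar>^4) - (3 * \<bar>d\<bar>\<^sup>2 - 2 * \<bar>s\<bar>^4)\<bar>"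
    unfolding E'_def by (simp add: abs_minus_commute)
  have "\<bar>\<bar>d\<bar>\<^sup>2 - \<bar>e\<bar>\<^sup>2\<bar> \<le> (1 + 4 * R) * E' \<and> \<bar>\<bar>s\<bar>^4 - \<bar>t\<bar>^4\<bar> \<le> (1 + 4 * R) * E'"
  proof (cases "\<bar>t\<bar> \<le> \<bar>s\<bar>")
    case True
    then show ?thesis
      using sorted_quartic_bound[of "\<bar>t\<bar>" "\<bar>s\<bar>" R "\<bar>d\<bar>" "\<bar>e\<bar>", folded E'_def] assms(1) by simp
  next
    case False
    then show ?thesis
      using sorted_quartic_bound[of "\<bar>s\<bar>" "\<bar>t\<bar>" R "\<bar>e\<bar>" "\<bar>d\<bar>", folded E'2] assms(2)
      by (simp only: abs_minus_commute[of "\<bar>d\<bar>\<^sup>2"] abs_minus_commute[of "\<bar>s\<bar>^4"])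
  qed
  moreover have abs4: "\<bar>x\<bar>^4 = x^4" for x :: real by (rule power_even_abs) simp
  ultimately have "\<bar>d\<^sup>2 - e\<^sup>2\<bar> \<le> (1 + 4 * R) * E'" "\<bar>s^4 - t^4\<bar> \<le> (1 + 4 * R) * E'"
    by (simp_all only: power2_abs abs4)
  then show "\<bar>d\<^sup>2 - e\<^sup>2\<bar> \<le> (1 + 4 * R) * E" "\<bar>s^4 - t^4\<bar> \<le> (1 + 4 * R) * E"
    using E' by (blast intro: order.trans)+
qed

text \<open>
The absolute values of locations and gaps are close by the previous lemma; what remains is to match the
signs with one common factor \<open>\<sigma>\<close>. If the products \<open>s*d\<close> and \<open>t*e\<close> have the same sign this is possible
exactly. If they have opposite signs, then both products are small, hence so is one of the two smaller
absolute values \<open>m\<close> and \<open>k\<close>, and matching only the sign of the other quantity costs little.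
\<close>

lemma quartic_identifiability:
  fixes s t d e R :: real
  assumes "\<bar>s\<bar> \<le> R" "\<bar>t\<bar> \<le> R"
  defines "E \<equiv> \<bar>s * d - t * e\<bar> + \<bar>(3 * d\<^sup>2 - 2 * s^4) - (3 * e\<^sup>2 - 2 * t^4)\<bar>"
  shows "min ((s - t)^4 + (d - e)\<^sup>2) ((s + t)^4 + (d + e)\<^sup>2) \<le> 13 * (1 + 4 * R) * E"
proof -
  note bd = quartic_bound[OF assms(1,2), of d e, folded E_def]
  have R: "0 \<le> R" using assms by simp
  have E0: "0 \<le> E" by (simp add: E_def)
  have RE: "0 \<le> R * E" using R E0 by simp
  have KE: "0 \<le> (1 + 4 * R) * E" using R E0 by simp
  have sq: "(\<bar>x\<bar> - \<bar>y\<bar>)\<^sup>2 \<le> \<bar>x\<^sup>2 - y\<^sup>2\<bar>" for x y :: real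
  proof -
    have "(\<bar>x\<bar> - \<bar>y\<bar>)\<^sup>2 = \<bar>\<bar>x\<bar> - \<bar>y\<bar>\<bar> * \<bar>\<bar>x\<bar> - \<bar>y\<bar>\<bar>" by (simp add: power2_eq_square abs_mult[symmetric])
    also have "\<dots> \<le> \<bar>\<bar>x\<bar> - \<bar>y\<bar>\<bar> * (\<bar>x\<bar> + \<bar>y\<bar>)" by (intro mult_left_mono) auto
    also have "\<dots> = \<bar>(\<bar>x\<bar> - \<bar>y\<bar>) * (\<bar>x\<bar> + \<bar>y\<bar>)\<bar>" by (simp add: abs_mult)
    also have "(\<bar>x\<bar> - \<bar>y\<bar>) * (\<bar>x\<bar> + \<bar>y\<bar>) = x\<^sup>2 - y\<^sup>2" by (simp add: algebra_simps power2_eq_square)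
    finally show ?thesis .
  qed
  have p4: "x^4 = (x\<^sup>2)\<^sup>2" for x :: real by simp
  have qu: "(\<bar>x\<bar> - \<bar>y\<bar>)^4 \<le> \<bar>x^4 - y^4\<bar>" for x y :: real
  proof -
    have "(\<bar>x\<bar> - \<bar>y\<bar>)^4 \<le> (\<bar>x\<^sup>2 - y\<^sup>2\<bar>)\<^sup>2" unfolding p4 using sq[of x y] by (intro power_mono) auto
    also have "\<dots> \<le> \<bar>x^4 - y^4\<bar>" unfolding p4 using sq[of "x\<^sup>2" "y\<^sup>2"] by (simp add: power_even_abs)
    finally show ?thesis .
  qed
  have key: "\<exists>\<sigma>\<in>{1,-1}. (s - \<sigma> * t)^4 + (d - \<sigma> * e)\<^sup>2 \<le> 13 * (1 + 4 * R) * E"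
  proof (cases "0 \<le> (s * d) * (t * e)")
    case True
    then have "(0 \<le> s * t \<and> 0 \<le> d * e) \<or> (s * t \<le> 0 \<and> d * e \<le> 0)"
      by (metis mult.assoc mult.left_commute zero_le_mult_iff)
    then have "\<exists>\<sigma>\<in>{1,-1::real}. \<bar>s - \<sigma> * t\<bar> = \<bar>\<bar>s\<bar> - \<bar>t\<bar>\<bar> \<and> \<bar>d - \<sigma> * e\<bar> = \<bar>\<bar>d\<bar> - \<bar>e\<bar>\<bar>"
    proof
      assume *: "0 \<le> s * t \<and> 0 \<le> d * e"
      show ?thesis by (rule bexI[of _ 1]) (use * in \<open>auto simp: zero_le_mult_iff abs_if split: if_splits\<close>)
    next
      assume *: "s * t \<le> 0 \<and> d * e \<le> 0"
      show ?thesis by (rule bexI[of _ "-1"]) (use * in \<open>auto simp: mult_le_0_iff abs_if split: if_splits\<close>)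
    qed
    then obtain \<sigma> where \<sigma>: "\<sigma> \<in> {1,-1}" "\<bar>s - \<sigma> * t\<bar> = \<bar>\<bar>s\<bar> - \<bar>t\<bar>\<bar>" "\<bar>d - \<sigma> * e\<bar> = \<bar>\<bar>d\<bar> - \<bar>e\<bar>\<bar>" by blast
    have "(s - \<sigma> * t)^4 = \<bar>s - \<sigma> * t\<bar>^4" "(d - \<sigma> * e)^2 = \<bar>d - \<sigma> * e\<bar>^2" by (simp_all add: power_even_abs)
    then have "(s - \<sigma> * t)^4 + (d - \<sigma> * e)\<^sup>2 = (\<bar>s\<bar> - \<bar>t\<bar>)^4 + (\<bar>d\<bar> - \<bar>e\<bar>)\<^sup>2"
      unfolding \<sigma>(2,3) by (simp add: power_even_abs)
    also have "\<dots> \<le> (1 + 4 * R) * E + (1 + 4 * R) * E"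
      by (rule add_mono[OF order.trans[OF qu bd(2)] order.trans[OF sq bd(1)]])
    also have "\<dots> \<le> 13 * (1 + 4 * R) * E" using KE by (simp only: mult.assoc)
    finally show ?thesis using \<sigma>(1) by blast
  next
    case False
    then have "(s * d) * (t * e) < 0" by simp
    moreover have "\<bar>x - y\<bar> = \<bar>x\<bar> + \<bar>y\<bar>" if "x * y < 0" for x y :: real
      using that by (auto simp: mult_less_0_iff)
    ultimately have "\<bar>s * d - t * e\<bar> = \<bar>s * d\<bar> + \<bar>t * e\<bar>" by blast
    then have PE: "\<bar>s\<bar> * \<bar>d\<bar> + \<bar>t\<bar> * \<bar>e\<bar> \<le> E" by (simp add: E_def abs_mult)
    \<comment> \<open>Now \<open>m * k\<close> is bounded by the difference of the products, so \<open>min (k\<^sup>2) (m^4)\<close> is small.\<close>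
    define m where "m = min \<bar>s\<bar> \<bar>t\<bar>"
    define k where "k = min \<bar>d\<bar> \<bar>e\<bar>"
    have mk: "0 \<le> m" "0 \<le> k" "m \<le> R" using assms by (auto simp: m_def k_def)
    have "m * k \<le> \<bar>s\<bar> * \<bar>d\<bar>" by (intro mult_mono) (auto simp: m_def k_def)
    moreover have "0 \<le> \<bar>t\<bar> * \<bar>e\<bar>" by simp
    ultimately have mkE: "m * k \<le> E" using PE by linarith
    have sgn: "\<exists>\<sigma>\<in>{1,-1::real}. \<bar>x - \<sigma> * y\<bar> = \<bar>\<bar>x\<bar> - \<bar>y\<bar>\<bar>" for x y :: real
    proof (cases "0 \<le> x * y")
      case True
      show ?thesis by (rule bexI[of _ 1]) (use True in \<open>auto simp: zero_le_mult_iff abs_if split: if_splits\<close>)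
    next
      case False
      show ?thesis by (rule bexI[of _ "-1"]) (use False in \<open>auto simp: zero_le_mult_iff abs_if split: if_splits\<close>)
    qed
    have le: "\<bar>x - \<sigma> * y\<bar> \<le> \<bar>x\<bar> + \<bar>y\<bar>" if "\<sigma> \<in> {1,-1}" for x y \<sigma> :: real using that by auto
    have sq2: "(x + y)\<^sup>2 \<le> 2 * \<bar>x\<^sup>2 - y\<^sup>2\<bar> + 4 * (min x y)\<^sup>2" for x y :: real
    proof -
      have "(x + y)\<^sup>2 \<le> 2 * x\<^sup>2 + 2 * y\<^sup>2" using zero_le_power2[of "x - y"] by (simp add: power2_eq_square algebra_simps)
      moreover have "x\<^sup>2 - y\<^sup>2 \<le> \<bar>x\<^sup>2 - y\<^sup>2\<bar>" "y\<^sup>2 - x\<^sup>2 \<le> \<bar>x\<^sup>2 - y\<^sup>2\<bar>" by auto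
      ultimately show ?thesis unfolding min_def by (simp only: split: if_split) argo
    qed
    show ?thesis
    proof (cases "k \<le> m\<^sup>2")
      case True
      obtain \<sigma> where \<sigma>: "\<sigma> \<in> {1,-1}" "\<bar>s - \<sigma> * t\<bar> = \<bar>\<bar>s\<bar> - \<bar>t\<bar>\<bar>" using sgn by blast
      have "k\<^sup>2 \<le> m\<^sup>2 * k" using True mk by (simp add: power2_eq_square mult_right_mono)
      also have "\<dots> = m * (m * k)" by (simp add: power2_eq_square)
      also have "\<dots> \<le> R * E" using mk mkE R by (intro mult_mono) auto
      finally have k2: "k\<^sup>2 \<le> R * E" .
      have "(s - \<sigma> * t)^4 = \<bar>s - \<sigma> * t\<bar>^4" by (simp add: power_even_abs)
      also have "\<dots> \<le> (1 + 4 * R) * E" unfolding \<sigma>(2) using order.trans[OF qu bd(2)] by (simp add: power_even_abs)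
      finally have 1: "(s - \<sigma> * t)^4 \<le> (1 + 4 * R) * E" .
      have "(d - \<sigma> * e)\<^sup>2 \<le> (\<bar>d\<bar> + \<bar>e\<bar>)\<^sup>2" using le[OF \<sigma>(1), of d e] by (simp add: abs_le_square_iff[symmetric])
      also have "\<dots> \<le> 2 * \<bar>d\<^sup>2 - e\<^sup>2\<bar> + 4 * k\<^sup>2" using sq2[of "\<bar>d\<bar>" "\<bar>e\<bar>"] by (simp add: k_def)
      also have "\<dots> \<le> 2 * ((1 + 4 * R) * E) + 4 * (R * E)"
        by (intro add_mono mult_left_mono bd k2) auto
      finally have "(s - \<sigma> * t)^4 + (d - \<sigma> * e)\<^sup>2 \<le> 13 * (1 + 4 * R) * E"
        using 1 E0 RE by (simp add: algebra_simps)
      then show ?thesis using \<sigma>(1) by blast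
    next
      case False
      obtain \<sigma> where \<sigma>: "\<sigma> \<in> {1,-1}" "\<bar>d - \<sigma> * e\<bar> = \<bar>\<bar>d\<bar> - \<bar>e\<bar>\<bar>" using sgn by blast
      have "m^4 = m\<^sup>2 * m\<^sup>2" by (simp add: power2_eq_square power4_eq_xxxx)
      also have "\<dots> \<le> m\<^sup>2 * k" using False by (intro mult_left_mono) auto
      also have "\<dots> = m * (m * k)" by (simp add: power2_eq_square)
      also have "\<dots> \<le> R * E" using mk mkE R by (intro mult_mono) auto
      finally have m4: "m^4 \<le> R * E" .
      have "(d - \<sigma> * e)^2 = \<bar>d - \<sigma> * e\<bar>^2" by (simp add: power_even_abs)
      also have "\<dots> \<le> (1 + 4 * R) * E" unfolding \<sigma>(2) using order.trans[OF sq bd(1)] by (simp add: power_even_abs)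
      finally have 1: "(d - \<sigma> * e)^2 \<le> (1 + 4 * R) * E" .
      have "(s - \<sigma> * t)^4 = \<bar>s - \<sigma> * t\<bar>^4" by (simp add: power_even_abs)
      also have "\<dots> \<le> (\<bar>s\<bar> + \<bar>t\<bar>)^4" using le[OF \<sigma>(1), of s t] by (intro power_mono) auto
      also have "\<dots> \<le> (2 * (s\<^sup>2 + t\<^sup>2))\<^sup>2"
      proof -
        have "(\<bar>s\<bar> + \<bar>t\<bar>)\<^sup>2 \<le> 2 * (s\<^sup>2 + t\<^sup>2)"
          using zero_le_power2[of "\<bar>s\<bar> - \<bar>t\<bar>"] by (simp add: power2_eq_square algebra_simps)
        then show ?thesis unfolding p4 by (intro power_mono) auto
      qed
      also have "\<dots> = 4 * (s\<^sup>2 + t\<^sup>2)\<^sup>2" by (simp only: power_mult_distrib) simp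
      also have "\<dots> \<le> 4 * (2 * \<bar>s^4 - t^4\<bar> + 4 * m^4)"
      proof -
        have "min (s\<^sup>2) (t\<^sup>2) = m\<^sup>2"
          by (auto simp: m_def min_def abs_le_square_iff)
        then show ?thesis using sq2[of "s\<^sup>2" "t\<^sup>2"] by simp
      qed
      also have "\<dots> \<le> 4 * (2 * ((1 + 4 * R) * E) + 4 * (R * E))"
        by (intro add_mono mult_left_mono bd m4) auto
      finally have "(s - \<sigma> * t)^4 + (d - \<sigma> * e)\<^sup>2 \<le> 13 * (1 + 4 * R) * E"
        using 1 E0 RE by (simp add: algebra_simps)
      then show ?thesis using \<sigma>(1) by blast
    qed
  qed
  then show ?thesis by auto
qed

section \<open>The symmetric order equals four\<close>

text \<open>
For \<open>l \<le> r\<close> the bounds by \<open>r\<close> in the index sets follow from the weight equation, so all orders share the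
same equations.
\<close>

lemma sym_poly_order_irrelevant:
  assumes "l \<le> r" "l \<le> r'"
  shows "sym_poly r l = sym_poly r' l"
proof -
  have "sym_idx1 r l = sym_idx1 r' l" "sym_idx2 r l = sym_idx2 r' l"
    using assms by (auto simp: sym_idx1_def sym_idx2_def)
  then show ?thesis by (intro ext) (simp add: sym_poly_def)
qed

lemma sym_idx_explicit:
  "sym_idx1 4 1 = {(1,0,0,0)}"
  "sym_idx1 4 2 = {(2,0,0,0),(1,0,1,0),(0,1,0,0)}"
  "sym_idx1 4 3 = {(3,0,0,0),(2,0,1,0),(1,0,2,0),(1,1,0,0),(0,1,1,0),(1,0,0,1)}"
  "sym_idx1 4 4 = {(4,0,0,0),(3,0,1,0),(2,0,2,0),(1,0,3,0),(2,1,0,0),(1,1,1,0),(0,1,2,0),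
     (2,0,0,1),(1,0,1,1),(0,2,0,0),(0,1,0,1)}"
  "sym_idx2 4 1 = {(1,0)}"
  "sym_idx2 4 2 = {(2,0),(0,1)}"
  "sym_idx2 4 3 = {(3,0),(1,1)}"
  "sym_idx2 4 4 = {(4,0),(2,1),(0,2)}"
proof -
  have box: "k = 0 \<or> k = 1 \<or> k = 2" if "k \<le> 2" for k :: nat using that by linarith
  have box4: "k = 0 \<or> k = 1 \<or> k = 2 \<or> k = 3 \<or> k = 4" if "k \<le> 4" for k :: nat
    using that by linarith
  have I1: "sym_idx1 4 l = (\<Union>a1\<in>{0,1,2,3,4}. \<Union>a2\<in>{0,1,2}. \<Union>b2\<in>{0,1,2}.
     if 1 \<le> a1 + a2 \<and> a1 + 2 * a2 + 2 * b2 \<le> l then {(a1, a2, l - (a1 + 2 * a2 + 2 * b2), b2)} else {})"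
    if "l \<le> 4" for l
  proof (intro set_eqI, clarify)
    fix a1 a2 b1 b2
    show "(a1, a2, b1, b2) \<in> sym_idx1 4 l \<longleftrightarrow> (a1, a2, b1, b2) \<in> (\<Union>a1\<in>{0,1,2,3,4}. \<Union>a2\<in>{0,1,2}. \<Union>b2\<in>{0,1,2}.
     if 1 \<le> a1 + a2 \<and> a1 + 2 * a2 + 2 * b2 \<le> l then {(a1, a2, l - (a1 + 2 * a2 + 2 * b2), b2)} else {})" (is "_ \<longleftrightarrow> ?R")
    proof -
      have "?R \<longleftrightarrow> a1 \<in> {0,1,2,3,4} \<and> a2 \<in> {0,1,2} \<and> b2 \<in> {0,1,2} \<and> 1 \<le> a1 + a2 \<and> a1 + 2 * a2 + 2 * b2 \<le> l
         \<and> b1 = l - (a1 + 2 * a2 + 2 * b2)"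
        by (simp only: UN_iff if_distrib[of "\<lambda>A. _ \<in> A"] empty_iff singleton_iff prod.inject if_bool_eq_conj) blast
      also have "\<dots> \<longleftrightarrow> (a1, a2, b1, b2) \<in> sym_idx1 4 l"
        using that box4[of a1] box[of a2] box[of b2] unfolding sym_idx1_def by auto
      finally show ?thesis by simp
    qed
  qed
  show "sym_idx1 4 1 = {(1,0,0,0)}"
  "sym_idx1 4 2 = {(2,0,0,0),(1,0,1,0),(0,1,0,0)}"
  "sym_idx1 4 3 = {(3,0,0,0),(2,0,1,0),(1,0,2,0),(1,1,0,0),(0,1,1,0),(1,0,0,1)}"
  "sym_idx1 4 4 = {(4,0,0,0),(3,0,1,0),(2,0,2,0),(1,0,3,0),(2,1,0,0),(1,1,1,0),(0,1,2,0),
     (2,0,0,1),(1,0,1,1),(0,2,0,0),(0,1,0,1)}"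
    by (subst I1; simp add: insert_commute)+
  have I2: "sym_idx2 4 l = (\<Union>a2\<in>{0,1,2}. if 2 * a2 \<le> l then {(l - 2 * a2, a2)} else {})"
    if "1 \<le> l" "l \<le> 4" for l
  proof (intro set_eqI, clarify)
    fix a1 a2
    show "(a1, a2) \<in> sym_idx2 4 l \<longleftrightarrow> (a1, a2) \<in> (\<Union>a2\<in>{0,1,2}. if 2 * a2 \<le> l then {(l - 2 * a2, a2)} else {})"
      using that box[of a2] unfolding sym_idx2_def by (auto split: if_splits)
  qed
  show "sym_idx2 4 1 = {(1,0)}"
    "sym_idx2 4 2 = {(2,0),(0,1)}"
    "sym_idx2 4 3 = {(3,0),(1,1)}"
    "sym_idx2 4 4 = {(4,0),(2,1),(0,2)}"
    by (subst I2; simp add: insert_commute)+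
qed

lemma sym_poly_1: "sym_poly 4 1 x1 x2 y1 y2 y3 = 0"
  by (simp add: sym_poly_def sym_idx_explicit[simplified])

lemma sym_poly_2: "sym_poly 4 2 x1 x2 y1 y2 y3 = (x2 - x1)^2 - x2^2 + (y1 + y2) / 2"
  by (simp add: sym_poly_def sym_idx_explicit fact_numeral) (simp add: field_simps power2_eq_square)

text \<open>
The polynomials are the coefficients of the difference of two mixtures that were shifted by \<open>x2\<close>. Undoing the shift leaves
the differences of the centred moments plus multiples of the lower equations; this isolates the product of
location and variance gap here, and the fourth cumulant in the next lemma. The components of one mixture are
\<open>(x2 - x1, y2 + y3)\<close> and \<open>(x1 - x2, y1)\<close>, those of the other are \<open>(x2, y3)\<close> and \<open>(-x2, 0)\<close>.
\<close>

lemma sym_poly_3: "sym_poly 4 3 x1 x2 y1 y2 y3 =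
   ((x2 - x1) * (y2 + y3 - y1) - x2 * y3) / 2 + x2 * sym_poly 4 2 x1 x2 y1 y2 y3"
  unfolding sym_poly_2 
  by (simp add: sym_poly_def sym_idx_explicit fact_numeral)
     (simp add: field_simps power2_eq_square power3_eq_cube)

lemma sym_poly_4: "24 * sym_poly 4 4 x1 x2 y1 y2 y3 =
   (3 * (y2 + y3 - y1)\<^sup>2 / 2 - 4 * (x2 - x1)^4 - (3 * y3\<^sup>2 / 2 - 4 * x2^4)) 
   + (6 * y3 + 12 * x2\<^sup>2 + 6 * (x2 - x1)\<^sup>2 + 6 * x2\<^sup>2  + 3 * (y1+y2)) * sym_poly 4 2 x1 x2 y1 y2 y3
   + 24 * x2 * (sym_poly 4 3 x1 x2 y1 y2 y3 - x2 * sym_poly 4 2 x1 x2 y1 y2 y3)"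
  unfolding sym_poly_2 sym_poly_3
  by (simp add: sym_poly_def sym_idx_explicit fact_numeral)
     (simp add: field_simps power2_eq_square power3_eq_cube power4_eq_xxxx)

text \<open>
The four equations say that the two mixtures have the same cumulants of order 2, 3, 4, hence agree up to
an exchange of components. Agreement without exchange is the trivial solution; agreement after the exchange makes the
right-hand side of the inequality zero, which again forces the trivial solution.
\<close>

lemma sym_solution_4_trivial:
  assumes "sym_solution 4 x1 x2 y1 y2 y3"
  shows "x1 = 0 \<and> y1 = 0 \<and> y2 = 0"
proof -
  have poly: "sym_poly 4 l x1 x2 y1 y2 y3 = 0" if "l \<in> {1..4}" for l
    using assms that unfolding sym_solution_def by blast
  have le: "\<bar>x1\<bar> powr 4 + \<bar>y1\<bar> powr 2 + \<bar>y2\<bar> powr 2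
       \<le> \<bar>2 * x2 - x1\<bar> powr 4 + \<bar>y3 - y1\<bar> powr 2 + \<bar>y2 + y3\<bar> powr 2"
    using assms unfolding sym_solution_def by simp
  define d where "d = (y2 + y3 - y1) / 2"
  define R where "R = max \<bar>x2 - x1\<bar> \<bar>x2\<bar>"
  have p2: "sym_poly 4 2 x1 x2 y1 y2 y3 = 0" and p3: "sym_poly 4 3 x1 x2 y1 y2 y3 = 0"
    and p4: "sym_poly 4 4 x1 x2 y1 y2 y3 = 0" using poly by auto
  have e2: "(x2 - x1)\<^sup>2 - x2\<^sup>2 + (y1 + y2) / 2 = 0" using p2 sym_poly_2 by simp
  have e3: "(x2 - x1) * d - x2 * (y3 / 2) = 0"
    using sym_poly_3[of x1 x2 y1 y2 y3] p2 p3 by (simp add: d_def field_simps)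
  have e4: "(3 * d\<^sup>2 - 2 * (x2 - x1)^4) - (3 * (y3 / 2)\<^sup>2 - 2 * x2^4) = 0"
  proof -
    have "3 * (y2 + y3 - y1)\<^sup>2 / 2 - 4 * (x2 - x1)^4 - (3 * y3\<^sup>2 / 2 - 4 * x2^4) = 0"
      using sym_poly_4[of x1 x2 y1 y2 y3] p2 p3 p4 by simp
    then show ?thesis unfolding d_def power_divide by (simp add: field_simps)
  qed
  have "min ((x2 - x1 - x2)^4 + (d - y3 / 2)\<^sup>2) ((x2 - x1 + x2)^4 + (d + y3 / 2)\<^sup>2) \<le> 0"
    using quartic_identifiability[of "x2 - x1" R x2 d "y3 / 2"] unfolding e3 e4 R_def by simp
  then have "(x2 - x1 - x2)^4 + (d - y3 / 2)\<^sup>2 \<le> 0 \<or> (x2 - x1 + x2)^4 + (d + y3 / 2)\<^sup>2 \<le> 0"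
    by (simp add: min_def split: if_splits)
  then show ?thesis
  proof
    assume "(x2 - x1 - x2)^4 + (d - y3 / 2)\<^sup>2 \<le> 0"
    moreover have "0 \<le> (x2 - x1 - x2)^4" "0 \<le> (d - y3 / 2)\<^sup>2" by auto
    ultimately have "(x2 - x1 - x2)^4 = 0" "(d - y3 / 2)\<^sup>2 = 0" by linarith+
    then have "x1 = 0" "d = y3 / 2" by auto
    then show ?thesis using e2 by (simp add: d_def)
  next
    assume "(x2 - x1 + x2)^4 + (d + y3 / 2)\<^sup>2 \<le> 0"
    moreover have "0 \<le> (x2 - x1 + x2)^4" "0 \<le> (d + y3 / 2)\<^sup>2" by auto
    ultimately have "(x2 - x1 + x2)^4 = 0" "(d + y3 / 2)\<^sup>2 = 0" by linarith+
    then have x: "x1 = 2 * x2" and "d = - (y3 / 2)" by auto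
    then have "y1 = y3" "y2 = - y3" using e2 by (simp_all add: d_def)
    then have "\<bar>x1\<bar> powr 4 + \<bar>y1\<bar> powr 2 + \<bar>y2\<bar> powr 2 \<le> 0"
      using le x by simp
    moreover have "0 \<le> \<bar>x1\<bar> powr 4" "0 \<le> \<bar>y1\<bar> powr 2" "0 \<le> \<bar>y2\<bar> powr 2" by auto
    ultimately have "\<bar>x1\<bar> powr 4 = 0" "\<bar>y1\<bar> powr 2 = 0" "\<bar>y2\<bar> powr 2 = 0" by linarith+
    then show ?thesis by (auto simp: powr_eq_0_iff)
  qed
qed

text \<open>
The mixture with means \<open>-1, 1\<close> and both variances lowered by 1 agrees with the single normal law in all moments of order at
most 3: the second moments agree by the choice of the variance, and odd moments vanish.
\<close>

lemma sym_solution_below_4: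
  assumes "1 \<le> r" "r \<le> 3"
  shows "sym_solution r 1 0 (-1) (-1) 0"
proof -
  have z: "sym_poly 4 2 1 0 (-1) (-1) 0 = 0" by (simp add: sym_poly_2)
  have "sym_poly r l 1 0 (-1) (-1) 0 = 0" if l: "l \<in> {1..r}" for l
  proof -
    have "sym_poly r l = sym_poly 4 l"
      using l assms by (intro sym_poly_order_irrelevant) auto
    moreover have "l = 1 \<or> l = 2 \<or> l = 3" using l assms by auto
    ultimately show ?thesis
      using z by (auto simp: sym_poly_1[simplified] sym_poly_3)
  qed
  then show ?thesis by (simp add: sym_solution_def)
qed

lemma sym_order_eq_4: "sym_order = 4"
  unfolding sym_order_def
proof (rule Least_equality)
  show "1 \<le> (4::nat) \<and> \<not> (\<exists>x1 x2 y1 y2 y3. sym_solution 4 x1 x2 y1 y2 y3 \<and> (x1 \<noteq> 0 \<or> y1 \<noteq> 0 \<or> y2 \<noteq> 0))"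
    using sym_solution_4_trivial by auto
next
  fix r :: nat
  assume r: "1 \<le> r \<and> \<not> (\<exists>x1 x2 y1 y2 y3. sym_solution r x1 x2 y1 y2 y3 \<and> (x1 \<noteq> 0 \<or> y1 \<noteq> 0 \<or> y2 \<noteq> 0))"
  show "4 \<le> r"
  proof (rule ccontr)
    assume "\<not> 4 \<le> r"
    then have "sym_solution r 1 0 (-1) (-1) 0" using r by (intro sym_solution_below_4) auto
    then show False using r by force
  qed
qed

section \<open>The fourth power of the loss\<close>

definition quartic_loss :: "param \<Rightarrow> param \<Rightarrow> real" where
  "quartic_loss = (\<lambda>(s, v1, v2) (t, w1, w2).
     min ((s - t)^4 + (v1 - w1)\<^sup>2 + (v2 - w2)\<^sup>2) ((s + t)^4 + (v1 - w2)\<^sup>2 + (v2 - w1)\<^sup>2))"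

lemma quartic_loss_nonneg: "0 \<le> quartic_loss \<eta> \<zeta>"
  by (auto simp: quartic_loss_def split: prod.splits)

lemma powr_quarter_power4:
  fixes x :: real
  assumes "0 \<le> x" shows "(x powr (1/4)) ^ 4 = x"
proof (cases "x = 0")
  case False
  then have "(x powr (1/4)) ^ 4 = (x powr (1/4)) powr (real 4)"
    using assms by (intro powr_realpow[symmetric]) auto
  then show ?thesis using assms False by (simp add: powr_powr)
qed simp

lemma power4_powr_quarter: "(x ^ 4) powr (1/4) = \<bar>x\<bar>" for x :: real
proof (cases "x = 0")
  case False
  then have "\<bar>x\<bar> powr (real 4) = \<bar>x\<bar> ^ 4" by (intro powr_realpow) auto
  also have "\<dots> = x ^ 4" by (rule power_even_abs) simp
  finally have "(x ^ 4) powr (1/4) = (\<bar>x\<bar> powr (real 4)) powr (1/4)" by simp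
  also have "\<dots> = \<bar>x\<bar>" using False by (simp only: powr_powr) simp
  finally show ?thesis .
qed simp

text \<open>
All exponents in the loss of order 4 are even integers, so the real powers become polynomials.
\<close>

lemma loss_4_eq: "loss 4 \<eta> \<zeta> = quartic_loss \<eta> \<zeta> powr (1/4)"
proof -
  have 4: "\<bar>x\<bar> powr 4 = x^4" for x :: real
    using powr_numeral[of "\<bar>x\<bar>" "num.Bit0 (num.Bit0 num.One)"] by (simp add: power_even_abs)
  have 2: "\<bar>x\<bar> powr 2 = x\<^sup>2" for x :: real
    using powr_numeral[of "\<bar>x\<bar>" "num.Bit0 num.One"] by (simp add: power_even_abs)
  show ?thesis by (simp add: loss_def quartic_loss_def 4 2 split: prod.splits)
qed

lemma quartic_loss_symmetric: "quartic_loss \<eta> \<zeta> = quartic_loss \<zeta> \<eta>"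
proof -
  obtain s v1 v2 where x: "\<eta> = (s, v1, v2)" by (cases \<eta>) auto
  obtain t w1 w2 where z: "\<zeta> = (t, w1, w2)" by (cases \<zeta>) auto
  have "(s - t)^4 = (t - s)^4" using power_minus_even[of 4 "s - t"] by simp
  then show ?thesis by (simp add: quartic_loss_def x z power2_commute add_ac)
qed

lemma power2_sum_le: "(a + b)\<^sup>2 \<le> 2 * (a\<^sup>2 + b\<^sup>2)" for a b :: real
  using zero_le_power2[of "a - b"] by (simp add: power2_eq_square algebra_simps)

lemma quartic_loss_quasi_triangle:
  "quartic_loss \<eta> \<xi> \<le> 8 * (quartic_loss \<zeta> \<xi> +
     ((fst \<eta> - fst \<zeta>)^4 + (fst (snd \<eta>) - fst (snd \<zeta>))\<^sup>2 + (snd (snd \<eta>) - snd (snd \<zeta>))\<^sup>2))"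
proof -
  obtain s v1 v2 where e: "\<eta> = (s, v1, v2)" by (cases \<eta>) auto
  obtain u z1 z2 where z: "\<zeta> = (u, z1, z2)" by (cases \<zeta>) auto
  obtain t w1 w2 where x: "\<xi> = (t, w1, w2)" by (cases \<xi>) auto
  note sq = power2_sum_le
  have qu: "(a + b)^4 \<le> 8 * (a^4 + b^4)" for a b :: real
  proof -
    have "(a + b)^4 = ((a + b)\<^sup>2)\<^sup>2" by simp
    also have "\<dots> \<le> (2 * (a\<^sup>2 + b\<^sup>2))\<^sup>2" using sq by (intro power_mono) auto
    also have "\<dots> = 4 * (a\<^sup>2 + b\<^sup>2)\<^sup>2" by (simp only: power_mult_distrib) simp
    also have "\<dots> \<le> 4 * (2 * ((a\<^sup>2)\<^sup>2 + (b\<^sup>2)\<^sup>2))" by (intro mult_left_mono sq) auto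
    finally show ?thesis by simp
  qed
  have step: "(s - u + a)^4 + (v1 - z1 + b)\<^sup>2 + (v2 - z2 + c)\<^sup>2 \<le>
       8 * ((a^4 + b\<^sup>2 + c\<^sup>2) + ((s - u)^4 + (v1 - z1)\<^sup>2 + (v2 - z2)\<^sup>2))" for a b c
  proof -
    have p: "0 \<le> b\<^sup>2" "0 \<le> c\<^sup>2" "0 \<le> (v1 - z1)\<^sup>2" "0 \<le> (v2 - z2)\<^sup>2" by auto
    show ?thesis unfolding distrib_left
      using qu[of "s - u" a, unfolded distrib_left] sq[of "v1 - z1" b, unfolded distrib_left]
        sq[of "v2 - z2" c, unfolded distrib_left] p by linarith
  qed
  have "quartic_loss \<eta> \<xi> \<le> 8 * (a + ((s - u)^4 + (v1 - z1)\<^sup>2 + (v2 - z2)\<^sup>2))"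
    if "a = (u - t)^4 + (z1 - w1)\<^sup>2 + (z2 - w2)\<^sup>2 \<or> a = (u + t)^4 + (z1 - w2)\<^sup>2 + (z2 - w1)\<^sup>2" for a
    using that
  proof
    assume "a = (u - t)^4 + (z1 - w1)\<^sup>2 + (z2 - w2)\<^sup>2"
    then show ?thesis using step[of "u - t" "z1 - w1" "z2 - w2"] by (auto simp: e x quartic_loss_def intro: min.coboundedI1)
  next
    assume "a = (u + t)^4 + (z1 - w2)\<^sup>2 + (z2 - w1)\<^sup>2"
    then show ?thesis using step[of "u + t" "z1 - w2" "z2 - w1"] by (auto simp: e x quartic_loss_def intro: min.coboundedI2)
  qed
  moreover have "quartic_loss \<zeta> \<xi> = (u - t)^4 + (z1 - w1)\<^sup>2 + (z2 - w2)\<^sup>2 \<or>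
      quartic_loss \<zeta> \<xi> = (u + t)^4 + (z1 - w2)\<^sup>2 + (z2 - w1)\<^sup>2"
    by (auto simp: z x quartic_loss_def min_def)
  ultimately show ?thesis by (auto simp: e z)
qed

definition param_near :: "real \<Rightarrow> param \<Rightarrow> param \<Rightarrow> bool" where
  "param_near \<delta> = (\<lambda>(s, v1, v2) (t, w1, w2). \<bar>s - t\<bar> \<le> \<delta> \<and> \<bar>v1 - w1\<bar> \<le> \<delta> \<and> \<bar>v2 - w2\<bar> \<le> \<delta>)"

lemma quartic_loss_le_near:
  assumes "param_near \<delta> \<xi> \<zeta>" "0 \<le> \<delta>" 
  shows "quartic_loss \<xi> \<eta> \<le> 8 * (quartic_loss \<zeta> \<eta> + (\<delta>^4 + 2 * \<delta>\<^sup>2))"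
proof -
  obtain s v1 v2 where x: "\<xi> = (s, v1, v2)" by (cases \<xi>) auto
  obtain t w1 w2 where z: "\<zeta> = (t, w1, w2)" by (cases \<zeta>) auto
  have d: "\<bar>s - t\<bar> \<le> \<delta>" "\<bar>v1 - w1\<bar> \<le> \<delta>" "\<bar>v2 - w2\<bar> \<le> \<delta>" using assms by (auto simp: param_near_def x z)
  have "(s - t)^4 = \<bar>s - t\<bar>^4" by (rule power_even_abs[symmetric]) simp
  also have "\<dots> \<le> \<delta>^4" using d by (intro power_mono) auto
  finally have 4: "(s - t)^4 \<le> \<delta>^4" .
  have 2: "(v1 - w1)\<^sup>2 \<le> \<delta>\<^sup>2" "(v2 - w2)\<^sup>2 \<le> \<delta>\<^sup>2"
    using power_mono[OF d(2), of 2] power_mono[OF d(3), of 2] by auto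
  have "(s - t)^4 + (v1 - w1)\<^sup>2 + (v2 - w2)\<^sup>2 \<le> \<delta>^4 + \<delta>\<^sup>2 + \<delta>\<^sup>2" by (intro add_mono 4 2)
  then have "8 * (quartic_loss \<zeta> \<eta> + ((s - t)^4 + (v1 - w1)\<^sup>2 + (v2 - w2)\<^sup>2)) \<le> 8 * (quartic_loss \<zeta> \<eta> + (\<delta>^4 + 2 * \<delta>\<^sup>2))"
    by (intro mult_left_mono add_left_mono) auto
  then show ?thesis using quartic_loss_quasi_triangle[of \<xi> \<eta> \<zeta>] by (simp add: x z)
qed

text \<open>
A compact parameter set sits in such a box, and the constants of the upper bound depend on \<open>R\<close>, \<open>a\<close>, \<open>b\<close> only.
\<close>

definition param_box :: "real \<Rightarrow> real \<Rightarrow> real \<Rightarrow> param set" where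
  "param_box R a b = {- R..R} \<times> {a..b} \<times> {a..b}"

lemma quartic_loss_bounded:
  assumes "\<eta> \<in> param_box R a b" "\<zeta> \<in> param_box R a b"
  shows "quartic_loss \<eta> \<zeta> \<le> (2 * R)^4 + 2 * (b - a)\<^sup>2"
proof -
  obtain s v1 v2 where x: "\<eta> = (s, v1, v2)" by (cases \<eta>) auto
  obtain t w1 w2 where z: "\<zeta> = (t, w1, w2)" by (cases \<zeta>) auto
  have d: "\<bar>s - t\<bar> \<le> 2 * R" "\<bar>v1 - w1\<bar> \<le> b - a" "\<bar>v2 - w2\<bar> \<le> b - a"
    using assms by (auto simp: param_box_def x z)
  have "(s - t)^4 = \<bar>s - t\<bar>^4" by (rule power_even_abs[symmetric]) simp
  also have "\<dots> \<le> (2 * R)^4" using d by (intro power_mono) auto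
  finally have 4: "(s - t)^4 \<le> (2 * R)^4" .
  have 2: "(v1 - w1)\<^sup>2 \<le> (b - a)\<^sup>2" "(v2 - w2)\<^sup>2 \<le> (b - a)\<^sup>2"
    using power_mono[OF d(2), of 2] power_mono[OF d(3), of 2] by auto
  have "(s - t)^4 + (v1 - w1)\<^sup>2 + (v2 - w2)\<^sup>2 \<le> (2 * R)^4 + (b - a)\<^sup>2 + (b - a)\<^sup>2" by (intro add_mono 4 2)
  then show ?thesis by (auto simp: quartic_loss_def x z intro: min.coboundedI1)
qed

section \<open>Moments of the mixture control the loss\<close>

text \<open>
Closed forms of the moments of order 2, 3, 4; that they are the moments is \<open>mix_density_moments\<close>.
\<close>

definition mix_moment2 :: "param \<Rightarrow> real" where
  "mix_moment2 = (\<lambda>(t, v, w). t\<^sup>2 + (v + w) / 2)"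

definition mix_moment3 :: "param \<Rightarrow> real" where
  "mix_moment3 = (\<lambda>(t, v, w). 3 / 2 * t * (w - v))"

definition mix_moment4 :: "param \<Rightarrow> real" where
  "mix_moment4 = (\<lambda>(t, v, w). t^4 + 3 * t\<^sup>2 * (v + w) + 3 / 2 * (v\<^sup>2 + w\<^sup>2))"

text \<open>
In the coordinates midpoint and half gap of the variances, the loss splits into the squared difference of the midpoints and the
expression bounded in \<open>quartic_identifiability\<close>. The midpoint is recovered from the second moment
and \<open>\<theta>\<^sup>2\<close>; its square is of the right order because \<open>(t\<^sup>2 - s\<^sup>2)\<^sup>2 \<le> \<bar>s^4 - t^4\<bar>\<close>. Replacing cumulants
by moments only adds a bounded multiple of the difference of the second moments.
\<close>

lemma quartic_loss_le_moments:
  assumes "0 < a" "0 \<le> R"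
  shows "\<exists>C>0. \<forall>\<eta>\<in>param_box R a b. \<forall>\<zeta>\<in>param_box R a b.
    quartic_loss \<eta> \<zeta> \<le> C * (\<bar>mix_moment2 \<eta> - mix_moment2 \<zeta>\<bar> + \<bar>mix_moment3 \<eta> - mix_moment3 \<zeta>\<bar>
       + \<bar>mix_moment4 \<eta> - mix_moment4 \<zeta>\<bar>)"
proof -
  define M where "M = R\<^sup>2 + \<bar>b\<bar>"
  define K where "K = 13 * (1 + 4 * R)"
  have M0: "0 \<le> M" by (simp add: M_def)
  have K0: "1 \<le> K" using assms by (simp add: K_def)
  show ?thesis
  proof (intro exI[of _ "8 * M + 6 * K * (1 + 6 * M)"] conjI ballI)
    show "0 < 8 * M + 6 * K * (1 + 6 * M)"
      proof -
      have "0 < 6 * K * (1 + 6 * M)" using M0 K0 by (intro mult_pos_pos) auto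
      then show ?thesis using M0 by linarith
    qed
    fix \<eta> \<zeta> assume in_box: "\<eta> \<in> param_box R a b" "\<zeta> \<in> param_box R a b"
    obtain s v1 v2 where e: "\<eta> = (s, v1, v2)" by (cases \<eta>) auto
    obtain t w1 w2 where z: "\<zeta> = (t, w1, w2)" by (cases \<zeta>) auto
    have bds: "\<bar>s\<bar> \<le> R" "\<bar>t\<bar> \<le> R" "a \<le> v1" "v1 \<le> b" "a \<le> v2" "v2 \<le> b" "a \<le> w1" "w1 \<le> b" "a \<le> w2" "w2 \<le> b"
      using in_box by (auto simp: e z param_box_def)
    define D2 where "D2 = \<bar>mix_moment2 \<eta> - mix_moment2 \<zeta>\<bar>"
    define D3 where "D3 = \<bar>mix_moment3 \<eta> - mix_moment3 \<zeta>\<bar>"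
    define D4 where "D4 = \<bar>mix_moment4 \<eta> - mix_moment4 \<zeta>\<bar>"
    define d where "d = (v2 - v1) / 2"
    define f where "f = (w2 - w1) / 2"
    have D0: "0 \<le> D2" "0 \<le> D3" "0 \<le> D4" by (auto simp: D2_def D3_def D4_def)
    define E where "E = \<bar>s * d - t * f\<bar> + \<bar>(3 * d\<^sup>2 - 2 * s^4) - (3 * f\<^sup>2 - 2 * t^4)\<bar>"
    have m2: "0 \<le> mix_moment2 \<eta>" "mix_moment2 \<eta> \<le> M" "0 \<le> mix_moment2 \<zeta>" "mix_moment2 \<zeta> \<le> M"
      using bds assms power_mono[of "\<bar>s\<bar>" R 2] power_mono[of "\<bar>t\<bar>" R 2]
      by (auto simp: e z mix_moment2_def M_def intro!: add_nonneg_nonneg add_mono)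
    have "s * d - t * f = (mix_moment3 \<eta> - mix_moment3 \<zeta>) / 3"
      by (simp add: e z mix_moment3_def d_def f_def field_simps)
    then have E1: "\<bar>s * d - t * f\<bar> \<le> D3" by (simp add: D3_def)
    have "(3 * d\<^sup>2 - 2 * s^4) - (3 * f\<^sup>2 - 2 * t^4) = (mix_moment4 \<eta> - mix_moment4 \<zeta>)
        - 3 * (mix_moment2 \<eta> + mix_moment2 \<zeta>) * (mix_moment2 \<eta> - mix_moment2 \<zeta>)"
      by (simp add: e z mix_moment4_def mix_moment2_def d_def f_def field_simps power2_eq_square power4_eq_xxxx)
    then have "\<bar>(3 * d\<^sup>2 - 2 * s^4) - (3 * f\<^sup>2 - 2 * t^4)\<bar> \<le> D4 +
        \<bar>3 * (mix_moment2 \<eta> + mix_moment2 \<zeta>) * (mix_moment2 \<eta> - mix_moment2 \<zeta>)\<bar>"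
      unfolding D4_def by (metis abs_triangle_ineq4)
    also have "\<bar>3 * (mix_moment2 \<eta> + mix_moment2 \<zeta>) * (mix_moment2 \<eta> - mix_moment2 \<zeta>)\<bar> \<le> (6 * M) * D2"
      unfolding abs_mult D2_def using m2 by (intro mult_right_mono) auto
    finally have E2: "\<bar>(3 * d\<^sup>2 - 2 * s^4) - (3 * f\<^sup>2 - 2 * t^4)\<bar> \<le> D4 + 6 * M * D2" by simp
    have E: "E \<le> D3 + D4 + 6 * M * D2" using E1 E2 by (simp add: E_def)
    have E0: "0 \<le> E" by (simp add: E_def)
    define mid where "mid = (v1 + v2) / 2 - (w1 + w2) / 2"
    \<comment> \<open>Exchanging the components of \<open>\<zeta>\<close> changes the signs of \<open>t\<close> and \<open>f\<close> simultaneously.\<close>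
    have split_loss: "quartic_loss \<eta> \<zeta> \<le> 2 * mid\<^sup>2 + 2 * min ((s - t)^4 + (d - f)\<^sup>2) ((s + t)^4 + (d + f)\<^sup>2)"
    proof -
      have v1: "(v1 - w1)\<^sup>2 + (v2 - w2)\<^sup>2 = 2 * mid\<^sup>2 + 2 * (d - f)\<^sup>2" 
        by (simp add: mid_def d_def f_def field_simps power2_eq_square)
      have v2: "(v1 - w2)\<^sup>2 + (v2 - w1)\<^sup>2 = 2 * mid\<^sup>2 + 2 * (d + f)\<^sup>2" 
        by (simp add: mid_def d_def f_def field_simps power2_eq_square)
      have bump: "p + (2 * m + 2 * q) \<le> 2 * m + 2 * (p + q)" if "0 \<le> p" for p m q :: real using that by simp
      have p: "0 \<le> (s - t)^4" "0 \<le> (s + t)^4" by auto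
      have h: "quartic_loss \<eta> \<zeta> \<le> (s - t)^4 + (2 * mid\<^sup>2 + 2 * (d - f)\<^sup>2)" "quartic_loss \<eta> \<zeta> \<le> (s + t)^4 + (2 * mid\<^sup>2 + 2 * (d + f)\<^sup>2)"
        unfolding v1[symmetric] v2[symmetric] by (auto simp: quartic_loss_def e z)
      have "quartic_loss \<eta> \<zeta> \<le> 2 * mid\<^sup>2 + 2 * ((s - t)^4 + (d - f)\<^sup>2)"
        "quartic_loss \<eta> \<zeta> \<le> 2 * mid\<^sup>2 + 2 * ((s + t)^4 + (d + f)\<^sup>2)"
        by (rule order.trans[OF h(1) bump[OF p(1)]], rule order.trans[OF h(2) bump[OF p(2)]])
      then show ?thesis by (simp add: min_def)
    qed
    have "min ((s - t)^4 + (d - f)\<^sup>2) ((s + t)^4 + (d + f)\<^sup>2) \<le> K * E"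
      using quartic_identifiability[OF bds(1,2), of d f] unfolding K_def E_def .
    moreover have "mid\<^sup>2 \<le> 4 * M * D2 + 2 * K * E"
    proof -
      have "mid = (mix_moment2 \<eta> - mix_moment2 \<zeta>) + (t\<^sup>2 - s\<^sup>2)"
        by (simp add: e z mid_def mix_moment2_def field_simps)
      then have "mid\<^sup>2 \<le> 2 * ((mix_moment2 \<eta> - mix_moment2 \<zeta>)\<^sup>2 + (t\<^sup>2 - s\<^sup>2)\<^sup>2)"
        using power2_sum_le by (simp only:)
      also have "(mix_moment2 \<eta> - mix_moment2 \<zeta>)\<^sup>2 = D2 * D2"
        by (simp add: D2_def power2_eq_square)
      also have "\<dots> \<le> (2 * M) * D2" using D0 m2 by (intro mult_right_mono) (auto simp: D2_def)
      also have "(t\<^sup>2 - s\<^sup>2)\<^sup>2 = \<bar>t\<^sup>2 - s\<^sup>2\<bar> * \<bar>t\<^sup>2 - s\<^sup>2\<bar>" by (simp add: power2_eq_square)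
      also have "\<dots> \<le> \<bar>t\<^sup>2 - s\<^sup>2\<bar> * \<bar>t\<^sup>2 + s\<^sup>2\<bar>" by (intro mult_left_mono) (auto intro!: abs_leI)
      also have "\<dots> = \<bar>s^4 - t^4\<bar>"
        unfolding abs_mult[symmetric] by (subst abs_minus_commute) (simp add: algebra_simps power2_eq_square power4_eq_xxxx)
      also have "\<dots> \<le> (1 + 4 * R) * E" using quartic_bound(2)[OF bds(1,2), of d f] by (simp add: E_def)
      also have "\<dots> \<le> K * E" using E0 assms by (intro mult_right_mono) (auto simp: K_def)
      finally show ?thesis by simp
    qed
    moreover have "q \<le> 8 * M * D2 + 6 * K * E"
      if "q \<le> 2 * x + 2 * y" "y \<le> K * E" "x \<le> 4 * M * D2 + 2 * K * E" for q x y
      using that by linarith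
    ultimately have "quartic_loss \<eta> \<zeta> \<le> 8 * M * D2 + 6 * K * E"
      using split_loss by blast
    also have "\<dots> \<le> 8 * M * D2 + 6 * K * (D3 + D4 + 6 * M * D2)" using E K0 by (intro add_left_mono mult_left_mono) auto
    also have "\<dots> \<le> (8 * M + 6 * K * (1 + 6 * M)) * (D2 + D3 + D4)"
    proof -
      have "0 \<le> 8 * M * D3 + 8 * M * D4 + 6 * K * D2 + 6 * K * (6 * M) * (D3 + D4)"
        using M0 K0 D0 by (intro add_nonneg_nonneg mult_nonneg_nonneg) auto
      then show ?thesis by (simp add: algebra_simps)
    qed
    finally show "quartic_loss \<eta> \<zeta> \<le> (8 * M + 6 * K * (1 + 6 * M)) *
      (\<bar>mix_moment2 \<eta> - mix_moment2 \<zeta>\<bar> + \<bar>mix_moment3 \<eta> - mix_moment3 \<zeta>\<bar> + \<bar>mix_moment4 \<eta> - mix_moment4 \<zeta>\<bar>)"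
      by (simp add: D2_def D3_def D4_def)
  qed
qed

text \<open>
Expand the powers of \<open>x = (x - \<mu>) + \<mu>\<close> and insert the centred moments.
\<close>

lemma normal_moment_2_3_4:
  assumes "0 < \<sigma>"
  shows "has_bochner_integral lborel (\<lambda>x. normal_density \<mu> \<sigma> x * x\<^sup>2) (\<mu>\<^sup>2 + \<sigma>\<^sup>2)"
    and "has_bochner_integral lborel (\<lambda>x. normal_density \<mu> \<sigma> x * x^3) (\<mu>^3 + 3 * \<mu> * \<sigma>\<^sup>2)"
    and "has_bochner_integral lborel (\<lambda>x. normal_density \<mu> \<sigma> x * x^4) (\<mu>^4 + 6 * \<mu>\<^sup>2 * \<sigma>\<^sup>2 + 3 * \<sigma>^4)"
proof -
  have c0: "has_bochner_integral lborel (\<lambda>x. normal_density \<mu> \<sigma> x) 1"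
    using normal_moment_even[OF assms, of \<mu> 0] by simp
  have c1: "has_bochner_integral lborel (\<lambda>x. normal_density \<mu> \<sigma> x * (x - \<mu>)) 0"
    using normal_moment_odd[OF assms, of \<mu> 0] by simp
  have c2: "has_bochner_integral lborel (\<lambda>x. normal_density \<mu> \<sigma> x * (x - \<mu>)\<^sup>2) (\<sigma>\<^sup>2)"
    using normal_moment_even[OF assms, of \<mu> 1] assms by (simp add: fact_numeral)
  have c3: "has_bochner_integral lborel (\<lambda>x. normal_density \<mu> \<sigma> x * (x - \<mu>)^3) 0"
    using normal_moment_odd[OF assms, of \<mu> 1] by (simp add: numeral_3_eq_3)
  have c4: "has_bochner_integral lborel (\<lambda>x. normal_density \<mu> \<sigma> x * (x - \<mu>)^4) (3 * \<sigma>^4)"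
    using normal_moment_even[OF assms, of \<mu> 2] assms by (simp add: fact_numeral power_divide field_simps)
  note add = has_bochner_integral_add has_bochner_integral_mult_right
  show "has_bochner_integral lborel (\<lambda>x. normal_density \<mu> \<sigma> x * x\<^sup>2) (\<mu>\<^sup>2 + \<sigma>\<^sup>2)"
    using add(1)[OF add(1)[OF c2 add(2)[OF c1, of "2 * \<mu>"]] add(2)[OF c0, of "\<mu>\<^sup>2"]]
    by (rule back_subst[of "\<lambda>(f, r). has_bochner_integral lborel f r" "(_, _)" "(_, _)", unfolded split_conv])
       (auto simp: fun_eq_iff algebra_simps power2_eq_square)
  show "has_bochner_integral lborel (\<lambda>x. normal_density \<mu> \<sigma> x * x^3) (\<mu>^3 + 3 * \<mu> * \<sigma>\<^sup>2)"
    using add(1)[OF add(1)[OF add(1)[OF c3 add(2)[OF c2, of "3 * \<mu>"]] add(2)[OF c1, of "3 * \<mu>\<^sup>2"]] add(2)[OF c0, of "\<mu>^3"]]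
    by (rule back_subst[of "\<lambda>(f, r). has_bochner_integral lborel f r" "(_, _)" "(_, _)", unfolded split_conv])
       (auto simp: fun_eq_iff algebra_simps power2_eq_square power3_eq_cube)
  show "has_bochner_integral lborel (\<lambda>x. normal_density \<mu> \<sigma> x * x^4) (\<mu>^4 + 6 * \<mu>\<^sup>2 * \<sigma>\<^sup>2 + 3 * \<sigma>^4)"
    using add(1)[OF add(1)[OF add(1)[OF add(1)[OF c4 add(2)[OF c3, of "4 * \<mu>"]] add(2)[OF c2, of "6 * \<mu>\<^sup>2"]]
      add(2)[OF c1, of "4 * \<mu>^3"]] add(2)[OF c0, of "\<mu>^4"]]
    by (rule back_subst[of "\<lambda>(f, r). has_bochner_integral lborel f r" "(_, _)" "(_, _)", unfolded split_conv])
       (auto simp: fun_eq_iff algebra_simps power2_eq_square power3_eq_cube power4_eq_xxxx)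
qed

lemma mix_density_moments:
  fixes t v w :: real
  assumes "0 < v" "0 < w"
  defines "\<eta> \<equiv> (t, v, w)"
  shows "has_bochner_integral lborel (\<lambda>x. mix_density x \<eta>) 1"
    and "has_bochner_integral lborel (\<lambda>x. mix_density x \<eta> * x\<^sup>2) (mix_moment2 \<eta>)"
    and "has_bochner_integral lborel (\<lambda>x. mix_density x \<eta> * x^3) (mix_moment3 \<eta>)"
    and "has_bochner_integral lborel (\<lambda>x. mix_density x \<eta> * x^4) (mix_moment4 \<eta>)"
proof -
  have mix: "has_bochner_integral lborel (\<lambda>x. mix_density x \<eta> * x^k) r"
    if "has_bochner_integral lborel (\<lambda>x. normal_density (- t) (sqrt v) x * x^k) p"
       "has_bochner_integral lborel (\<lambda>x. normal_density t (sqrt w) x * x^k) q" "r = p / 2 + q / 2" for k p q r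
    using has_bochner_integral_add[OF has_bochner_integral_mult_right[OF that(1), of "1/2"] has_bochner_integral_mult_right[OF that(2), of "1/2"]]
    unfolding that(3) by (simp add: \<eta>_def mix_density_def distrib_right mult.assoc)
  have \<sigma>: "0 < sqrt v" "0 < sqrt w" using assms by auto
  have p4: "sqrt x ^ 4 = x\<^sup>2" if "0 < x" for x
  proof -
    have "sqrt x ^ 4 = ((sqrt x)\<^sup>2)\<^sup>2" by (simp only: power_mult[symmetric]) simp
    then show ?thesis using that by simp
  qed
  show "has_bochner_integral lborel (\<lambda>x. mix_density x \<eta>) 1"
    using mix[of 0 1 1 1] normal_moment_even[OF \<sigma>(1), of "-t" 0] normal_moment_even[OF \<sigma>(2), of t 0] by simp
  show "has_bochner_integral lborel (\<lambda>x. mix_density x \<eta> * x\<^sup>2) (mix_moment2 \<eta>)"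
    by (rule mix[OF normal_moment_2_3_4(1)[OF \<sigma>(1)] normal_moment_2_3_4(1)[OF \<sigma>(2)]])
       (use assms in \<open>simp add: mix_moment2_def field_simps\<close>)
  show "has_bochner_integral lborel (\<lambda>x. mix_density x \<eta> * x^3) (mix_moment3 \<eta>)"
    by (rule mix[OF normal_moment_2_3_4(2)[OF \<sigma>(1)] normal_moment_2_3_4(2)[OF \<sigma>(2)]])
       (use assms in \<open>simp add: mix_moment3_def field_simps\<close>)
  show "has_bochner_integral lborel (\<lambda>x. mix_density x \<eta> * x^4) (mix_moment4 \<eta>)"
    by (rule mix[OF normal_moment_2_3_4(3)[OF \<sigma>(1)] normal_moment_2_3_4(3)[OF \<sigma>(2)]])
       (use assms in \<open>simp add: mix_moment4_def p4 field_simps\<close>)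
qed

section \<open>The Hellinger affinity controls the loss\<close>

lemma mix_density_pos: "0 < v \<Longrightarrow> 0 < w \<Longrightarrow> 0 < mix_density x (t, v, w)"
  by (simp add: mix_density_def add_pos_pos normal_density_pos)

lemma mix_density_nonneg: "0 \<le> mix_density x \<eta>"
  by (auto simp: mix_density_def split: prod.splits)

lemma borel_measurable_mix_density [measurable]: "(\<lambda>x. mix_density x \<eta>) \<in> borel_measurable borel"
  by (cases \<eta>) (simp add: mix_density_def)

definition envelope :: "real \<Rightarrow> real \<Rightarrow> real \<Rightarrow> real \<Rightarrow> real" where
  "envelope R a b x = sqrt (2 * b / a) * exp (R\<^sup>2 / (2 * b)) * normal_density 0 (sqrt (2 * b)) x"

text \<open>
The inequality \<open>(x - t)\<^sup>2 \<ge> x\<^sup>2/2 - t\<^sup>2\<close> trades the location for a doubled variance, which gives one Gaussian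
majorant for all parameters in the box.
\<close>

lemma mix_density_le_envelope:
  assumes "0 < a" "\<eta> \<in> param_box R a b"
  shows "mix_density x \<eta> \<le> envelope R a b x"
proof -
  have nd: "normal_density t (sqrt v) x \<le> envelope R a b x" if "\<bar>t\<bar> \<le> R" "a \<le> v" "v \<le> b" for t v
  proof -
    have b: "0 < b" using that assms by simp
    have "x\<^sup>2 / 2 - t\<^sup>2 \<le> (x - t)\<^sup>2"
      using zero_le_power2[of "x - 2 * t"] by (simp add: power2_eq_square algebra_simps)
    moreover have "t\<^sup>2 \<le> R\<^sup>2" using that power_mono[of "\<bar>t\<bar>" R 2] by simp
    ultimately have "x\<^sup>2 / 2 - R\<^sup>2 \<le> (x - t)\<^sup>2" by linarith
    then have "(x\<^sup>2 / 2 - R\<^sup>2) / (2 * b) \<le> (x - t)\<^sup>2 / (2 * b)" using b by (intro divide_right_mono) auto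
    also have "\<dots> \<le> (x - t)\<^sup>2 / (2 * v)" using that assms by (intro divide_left_mono) auto
    finally have ex: "- (x - t)\<^sup>2 / (2 * v) \<le> R\<^sup>2 / (2 * b) + - x\<^sup>2 / (2 * (2 * b))"
      by (simp add: diff_divide_distrib)
    have "normal_density t (sqrt v) x = 1 / sqrt (2 * pi * v) * exp (- (x - t)\<^sup>2 / (2 * v))"
      using that assms by (simp add: normal_density_def)
    also have "\<dots> \<le> 1 / sqrt (2 * pi * a) * exp (R\<^sup>2 / (2 * b) + - x\<^sup>2 / (2 * (2 * b)))"
      using that assms ex by (intro mult_mono divide_left_mono) auto
    also have "\<dots> = envelope R a b x"
    proof -
      have nd0: "normal_density 0 (sqrt (2 * b)) x = 1 / sqrt (2 * pi * (2 * b)) * exp (- x\<^sup>2 / (2 * (2 * b)))"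
        using b by (simp add: normal_density_def)
      have c: "1 / sqrt (2 * pi * a) = sqrt (2 * b / a) * (1 / sqrt (2 * pi * (2 * b)))"
      proof -
        have "sqrt (2 * pi * (2 * b)) = sqrt (2 * pi * a) * sqrt (2 * b / a)"
          unfolding real_sqrt_mult[symmetric] using assms by simp
        then show ?thesis using b assms by simp
      qed
      show ?thesis unfolding envelope_def nd0 c exp_add by (simp only: ac_simps)
    qed
    finally show ?thesis .
  qed
  obtain t v w where e: "\<eta> = (t, v, w)" by (cases \<eta>) auto
  show ?thesis
    using nd[of "- t" v] nd[of t w] assms by (auto simp: e mix_density_def param_box_def abs_le_iff)
qed

lemma envelope_nonneg: "0 < a \<Longrightarrow> a \<le> b \<Longrightarrow> 0 \<le> envelope R a b x"
  by (auto simp: envelope_def intro!: mult_nonneg_nonneg)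

lemma borel_measurable_envelope [measurable]: "envelope R a b \<in> borel_measurable borel"
  by (simp add: envelope_def[abs_def])

lemma integrable_envelope_moment:
  assumes "0 < a" "a \<le> b"
  shows "integrable lborel (\<lambda>x. envelope R a b x * x^k)"
  using integrable_mult_right[OF integrable_normal_moment[of "sqrt (2 * b)" 0 k], of "sqrt (2 * b / a) * exp (R\<^sup>2 / (2 * b))"] assms
  by (simp add: envelope_def mult.assoc)

lemma integrable_mix_moment:
  assumes "0 < a" "a \<le> b" "\<eta> \<in> param_box R a b"
  shows "integrable lborel (\<lambda>x. mix_density x \<eta> * x^k)"
proof (rule Bochner_Integration.integrable_bound[OF integrable_envelope_moment[OF assms(1,2), of R k]])
  show "AE x in lborel. norm (mix_density x \<eta> * x^k) \<le> norm (envelope R a b x * x^k)"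
    using mix_density_le_envelope[OF assms(1,3)] mix_density_nonneg envelope_nonneg[OF assms(1,2)]
    by (intro AE_I2) (auto simp: abs_mult intro!: mult_mono)
qed simp

text \<open>
This is the Cauchy-Schwarz inequality for \<open>f - g = (sqrt f - sqrt g) * (sqrt f + sqrt g)\<close>, proved by integrating a nonnegative
quadratic in a multiplier \<open>k\<close>. It allows unbounded test functions with bounded second moments, in
particular monomials.
\<close>

lemma hellinger_test_function:
  fixes f g \<psi> :: "'a \<Rightarrow> real"
  assumes f: "integrable M f" "\<And>x. 0 \<le> f x" "(\<integral>x. f x \<partial>M) = 1"
    and g: "integrable M g" "\<And>x. 0 \<le> g x" "(\<integral>x. g x \<partial>M) = 1"
    and \<psi>f: "integrable M (\<lambda>x. f x * \<psi> x)" "integrable M (\<lambda>x. f x * (\<psi> x)\<^sup>2)" 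
    and \<psi>g: "integrable M (\<lambda>x. g x * \<psi> x)" "integrable M (\<lambda>x. g x * (\<psi> x)\<^sup>2)" 
    and B: "(\<integral>x. f x * (\<psi> x)\<^sup>2 \<partial>M) \<le> B" "(\<integral>x. g x * (\<psi> x)\<^sup>2 \<partial>M) \<le> B" "0 < B"
  shows "((\<integral>x. f x * \<psi> x \<partial>M) - (\<integral>x. g x * \<psi> x \<partial>M))\<^sup>2 \<le> 8 * B * (1 - (\<integral>x. sqrt (f x * g x) \<partial>M))"
proof -
  define D where "D = (\<integral>x. f x * \<psi> x \<partial>M) - (\<integral>x. g x * \<psi> x \<partial>M)"
  define h where "h = (\<integral>x. sqrt (f x * g x) \<partial>M)"
  \<comment> \<open>The minimiser of the quadratic \<open>4*B*k\<^sup>2 - 2*D*k\<close>.\<close>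
  define k where "k = D / (4 * B)"
  have sqrt_int: "integrable M (\<lambda>x. sqrt (f x * g x))"
  proof (rule Bochner_Integration.integrable_bound[of _ "\<lambda>x. f x + g x"])
    show "(\<lambda>x. sqrt (f x * g x)) \<in> borel_measurable M" using f g by measurable
    show "AE x in M. norm (sqrt (f x * g x)) \<le> norm (f x + g x)"
    proof (rule AE_I2)
      fix x
      have "sqrt (f x * g x) \<le> sqrt ((f x + g x)\<^sup>2)"
        using f(2)[of x] g(2)[of x] by (intro real_sqrt_le_mono) (simp add: power2_eq_square algebra_simps add_nonneg_nonneg)
      then show "norm (sqrt (f x * g x)) \<le> norm (f x + g x)"
        using f(2)[of x] g(2)[of x] by simp
    qed
  qed (use f g in auto)
  have pw: "0 \<le> (f x + g x - 2 * sqrt (f x * g x)) - 2 * k * (f x * \<psi> x - g x * \<psi> x)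
      + k\<^sup>2 * (2 * (f x * (\<psi> x)\<^sup>2 + g x * (\<psi> x)\<^sup>2))" for x
  proof -
    define u where "u = sqrt (f x)" define w where "w = sqrt (g x)"
    have u: "f x = u\<^sup>2" "g x = w\<^sup>2" "sqrt (f x * g x) = u * w"
      unfolding u_def w_def using f(2)[of x] g(2)[of x] by (simp_all only: real_sqrt_mult real_sqrt_pow2)
    have "0 \<le> ((u - w) - k * \<psi> x * (u + w))\<^sup>2 + k\<^sup>2 * (\<psi> x)\<^sup>2 * (u - w)\<^sup>2" by simp
    also have "\<dots> = (f x + g x - 2 * sqrt (f x * g x)) - 2 * k * (f x * \<psi> x - g x * \<psi> x)
      + k\<^sup>2 * (2 * (f x * (\<psi> x)\<^sup>2 + g x * (\<psi> x)\<^sup>2))"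
      unfolding u(3) unfolding u(1,2) by (simp add: power2_eq_square algebra_simps)
    finally show ?thesis .
  qed
  have "0 \<le> (\<integral>x. (f x + g x - 2 * sqrt (f x * g x)) - 2 * k * (f x * \<psi> x - g x * \<psi> x)
      + k\<^sup>2 * (2 * (f x * (\<psi> x)\<^sup>2 + g x * (\<psi> x)\<^sup>2)) \<partial>M)"
    using pw by (intro integral_nonneg_AE) auto
  also have "\<dots> = (2 - 2 * h) - 2 * k * D + k\<^sup>2 * (2 * ((\<integral>x. f x * (\<psi> x)\<^sup>2 \<partial>M) + (\<integral>x. g x * (\<psi> x)\<^sup>2 \<partial>M)))"
    using f g \<psi>f \<psi>g sqrt_int by (simp add: h_def D_def)
  also have "\<dots> \<le> (2 - 2 * h) - 2 * k * D + k\<^sup>2 * (2 * (B + B))"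
    using B by (intro add_mono mult_left_mono) auto
  also have "\<dots> = 2 - 2 * h - D\<^sup>2 / (4 * B)"
    using B(3) by (simp add: k_def power2_eq_square field_simps)
  finally have "D\<^sup>2 / (4 * B) \<le> 2 - 2 * h" by simp
  then show ?thesis using B(3) by (simp add: D_def h_def field_simps)
qed

definition affinity :: "param \<Rightarrow> param \<Rightarrow> real" where
  "affinity \<eta> \<zeta> = (\<integral>x. sqrt (mix_density x \<eta> * mix_density x \<zeta>) \<partial>lborel)"

lemma moment_difference_le_hellinger:
  assumes "0 < a" "a \<le> b" "0 \<le> R"
  shows "\<exists>B>0. \<forall>\<eta>\<in>param_box R a b. \<forall>\<zeta>\<in>param_box R a b.
    (mix_moment2 \<eta> - mix_moment2 \<zeta>)\<^sup>2 \<le> B * (1 - affinity \<eta> \<zeta>) \<and>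
    (mix_moment3 \<eta> - mix_moment3 \<zeta>)\<^sup>2 \<le> B * (1 - affinity \<eta> \<zeta>) \<and>
    (mix_moment4 \<eta> - mix_moment4 \<zeta>)\<^sup>2 \<le> B * (1 - affinity \<eta> \<zeta>)"
proof -
  define J where "J k = (\<integral>x. envelope R a b x * x^(2 * k) \<partial>lborel)" for k :: nat
  have J0: "0 \<le> J k" for k
    unfolding J_def using envelope_nonneg[OF assms(1,2)] by (intro integral_nonneg_AE) auto
  define B where "B = 1 + J 2 + J 3 + J 4"
  have BJ: "J 2 \<le> B" "J 3 \<le> B" "J 4 \<le> B" "0 < B" using J0[of 2] J0[of 3] J0[of 4] by (auto simp: B_def)
  have sq: "(x^k)\<^sup>2 = x^(2 * k)" for x :: real and k by (simp add: power_mult[symmetric] mult.commute)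
  have bd: "(\<integral>x. mix_density x \<eta> * (x^k)\<^sup>2 \<partial>lborel) \<le> J k" if "\<eta> \<in> param_box R a b" for \<eta> k
    unfolding J_def sq
    using mix_density_le_envelope[OF assms(1) that]
    by (intro integral_mono integrable_mix_moment[OF assms(1,2) that] integrable_envelope_moment[OF assms(1,2)]
        mult_right_mono) auto
  have main: "(r - s)\<^sup>2 \<le> 8 * B * (1 - affinity \<eta> \<zeta>)"
    if "\<eta> \<in> param_box R a b" "\<zeta> \<in> param_box R a b" "J k \<le> B"
      "has_bochner_integral lborel (\<lambda>x. mix_density x \<eta> * x^k) r"
      "has_bochner_integral lborel (\<lambda>x. mix_density x \<zeta> * x^k) s" for \<eta> \<zeta> k r s
  proof -
    have pos: "0 < fst (snd \<xi>)" "0 < snd (snd \<xi>)" if "\<xi> \<in> param_box R a b" for \<xi>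
      using that assms(1) by (auto simp: param_box_def)
    have one: "(\<integral>x. mix_density x \<xi> \<partial>lborel) = 1" if "\<xi> \<in> param_box R a b" for \<xi>
      using mix_density_moments(1)[OF pos[OF that], of "fst \<xi>"] by (simp add: has_bochner_integral_integral_eq)
    have int: "integrable lborel (\<lambda>x. mix_density x \<xi>)" if "\<xi> \<in> param_box R a b" for \<xi>
      using integrable_mix_moment[OF assms(1,2) that, of 0] by simp
    have "((\<integral>x. mix_density x \<eta> * x^k \<partial>lborel) - (\<integral>x. mix_density x \<zeta> * x^k \<partial>lborel))\<^sup>2
       \<le> 8 * B * (1 - (\<integral>x. sqrt (mix_density x \<eta> * mix_density x \<zeta>) \<partial>lborel))"
      by (rule hellinger_test_function)
         (use that bd[OF that(1), of k] bd[OF that(2), of k] BJ in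
           \<open>auto simp: sq mix_density_nonneg one int intro!: integrable_mix_moment[OF assms(1,2)]\<close>)
    then show ?thesis using that(4,5) by (simp add: affinity_def has_bochner_integral_integral_eq)
  qed
  show ?thesis
  proof (intro exI[of _ "8 * B"] conjI ballI)
    show "0 < 8 * B" using BJ by simp
    fix \<eta> \<zeta> assume box: "\<eta> \<in> param_box R a b" "\<zeta> \<in> param_box R a b"
    obtain t v w where e: "\<eta> = (t, v, w)" by (cases \<eta>) auto
    obtain t' v' w' where z: "\<zeta> = (t', v', w')" by (cases \<zeta>) auto
    have pos: "0 < v" "0 < w" "0 < v'" "0 < w'" using box assms(1) by (auto simp: e z param_box_def)
    note m1 = mix_density_moments[OF pos(1,2), of t, folded e]
    note m2 = mix_density_moments[OF pos(3,4), of t', folded z]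
    show "(mix_moment2 \<eta> - mix_moment2 \<zeta>)\<^sup>2 \<le> 8 * B * (1 - affinity \<eta> \<zeta>)"
      by (rule main[OF box BJ(1) m1(2) m2(2)])
    show "(mix_moment3 \<eta> - mix_moment3 \<zeta>)\<^sup>2 \<le> 8 * B * (1 - affinity \<eta> \<zeta>)"
      by (rule main[OF box BJ(2) m1(3) m2(3)])
    show "(mix_moment4 \<eta> - mix_moment4 \<zeta>)\<^sup>2 \<le> 8 * B * (1 - affinity \<eta> \<zeta>)"
      by (rule main[OF box BJ(3) m1(4) m2(4)])
  qed
qed

text \<open>
Here \<open>1 - affinity\<close> is half the squared Hellinger distance. This is the inequality that fixes the exponent of the rate:
the Hellinger distance is at least a multiple of the fourth power of the loss.
\<close>

lemma affinity_le_quartic_loss: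
  assumes "0 < a" "a \<le> b" "0 \<le> R"
  shows "\<exists>c>0. \<forall>\<eta>\<in>param_box R a b. \<forall>\<zeta>\<in>param_box R a b.
    affinity \<eta> \<zeta> \<le> 1 - c * (quartic_loss \<eta> \<zeta>)\<^sup>2"
proof -
  obtain C where C: "C > 0" "\<And>\<eta> \<zeta>. \<eta> \<in> param_box R a b \<Longrightarrow> \<zeta> \<in> param_box R a b \<Longrightarrow>
    quartic_loss \<eta> \<zeta> \<le> C * (\<bar>mix_moment2 \<eta> - mix_moment2 \<zeta>\<bar> + \<bar>mix_moment3 \<eta> - mix_moment3 \<zeta>\<bar>
       + \<bar>mix_moment4 \<eta> - mix_moment4 \<zeta>\<bar>)"
    using quartic_loss_le_moments[OF assms(1,3)] by blast
  obtain B where B: "B > 0" "\<And>\<eta> \<zeta>. \<eta> \<in> param_box R a b \<Longrightarrow> \<zeta> \<in> param_box R a b \<Longrightarrow>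
    (mix_moment2 \<eta> - mix_moment2 \<zeta>)\<^sup>2 \<le> B * (1 - affinity \<eta> \<zeta>) \<and>
    (mix_moment3 \<eta> - mix_moment3 \<zeta>)\<^sup>2 \<le> B * (1 - affinity \<eta> \<zeta>) \<and>
    (mix_moment4 \<eta> - mix_moment4 \<zeta>)\<^sup>2 \<le> B * (1 - affinity \<eta> \<zeta>)"
    using moment_difference_le_hellinger[OF assms] by blast
  show ?thesis
  proof (intro exI[of _ "1 / (9 * C\<^sup>2 * B)"] conjI ballI)
    show "0 < 1 / (9 * C\<^sup>2 * B)" using C(1) B(1) by simp
    fix \<eta> \<zeta> assume box: "\<eta> \<in> param_box R a b" "\<zeta> \<in> param_box R a b"
    define h where "h = sqrt (B * (1 - affinity \<eta> \<zeta>))"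
    have "0 \<le> B * (1 - affinity \<eta> \<zeta>)"
      using B(2)[OF box] zero_le_power2 order.trans by blast
    then have h2: "h\<^sup>2 = B * (1 - affinity \<eta> \<zeta>)" by (simp add: h_def)
    have m: "\<bar>mix_moment2 \<eta> - mix_moment2 \<zeta>\<bar> \<le> h" "\<bar>mix_moment3 \<eta> - mix_moment3 \<zeta>\<bar> \<le> h" "\<bar>mix_moment4 \<eta> - mix_moment4 \<zeta>\<bar> \<le> h"
      unfolding h_def using B(2)[OF box] by (auto intro!: real_le_rsqrt)
    have "quartic_loss \<eta> \<zeta> \<le> C * (h + h + h)"
      using C(1) m by (intro order.trans[OF C(2)[OF box]] mult_left_mono add_mono) auto
    then have "(quartic_loss \<eta> \<zeta>)\<^sup>2 \<le> (C * (h + h + h))\<^sup>2"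
      using quartic_loss_nonneg by (intro power_mono) auto
    also have "\<dots> = 9 * C\<^sup>2 * h\<^sup>2" by (simp add: power2_eq_square algebra_simps)
    also have "\<dots> = 9 * C\<^sup>2 * B * (1 - affinity \<eta> \<zeta>)" by (simp add: h2)
    finally show "affinity \<eta> \<zeta> \<le> 1 - 1 / (9 * C\<^sup>2 * B) * (quartic_loss \<eta> \<zeta>)\<^sup>2"
      using C(1) B(1) by (simp add: field_simps)
  qed
qed

section \<open>Product samples\<close>

lemma prob_space_mix_density:
  assumes "0 < v" "0 < w"
  shows "prob_space (density lborel (\<lambda>x. ennreal (mix_density x (t, v, w))))"
proof
  have "(\<integral>\<^sup>+ x. ennreal (mix_density x (t, v, w)) \<partial>lborel) = ennreal 1"
    using mix_density_moments(1)[OF assms, of t] mix_density_nonneg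
    by (subst nn_integral_eq_integral) (auto simp: has_bochner_integral_iff)
  then show "emeasure (density lborel (\<lambda>x. ennreal (mix_density x (t, v, w))))
      (space (density lborel (\<lambda>x. ennreal (mix_density x (t, v, w))))) = 1"
    by (simp add: emeasure_density)
qed

lemma sets_sample_dist [measurable_cong]: "sets (sample_dist n \<eta>) = sets (sample_space n)"
  unfolding sample_dist_def sample_space_def by (intro sets_PiM_cong) auto

lemma space_sample_dist: "space (sample_dist n \<eta>) = space (sample_space n)"
  by (rule sets_eq_imp_space_eq[OF sets_sample_dist])

lemma measurable_sample_component [measurable]:
  assumes "i < n" shows "(\<lambda>y. y i) \<in> borel_measurable (sample_space n)"
  unfolding sample_space_def using assms by (intro measurable_component_singleton) auto

lemma nn_integral_sample_prod:
  assumes "0 < v" "0 < w" and [measurable]: "f \<in> borel_measurable borel" 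
  shows "(\<integral>\<^sup>+ y. (\<Prod>i<n. f (y i)) \<partial>sample_dist n (t, v, w)) =
    (\<integral>\<^sup>+ x. ennreal (mix_density x (t, v, w)) * f x \<partial>lborel) ^ n"
proof -
  let ?D = "density lborel (\<lambda>x. ennreal (mix_density x (t, v, w)))"
  interpret prob_space ?D by (rule prob_space_mix_density[OF assms(1,2)])
  interpret product_sigma_finite "\<lambda>_::nat. ?D" ..
  have "(\<integral>\<^sup>+ y. (\<Prod>i<n. f (y i)) \<partial>sample_dist n (t, v, w)) = (\<Prod>i<n. integral\<^sup>N ?D f)"
    unfolding sample_dist_def by (intro product_nn_integral_prod) auto
  also have "\<dots> = integral\<^sup>N ?D f ^ n" by simp
  also have "integral\<^sup>N ?D f = (\<integral>\<^sup>+ x. ennreal (mix_density x (t, v, w)) * f x \<partial>lborel)"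
    by (intro nn_integral_density) auto
  finally show ?thesis .
qed

text \<open>
Both sides agree on measurable rectangles, where the density factorises over the coordinates.
\<close>

lemma sample_dist_density:
  fixes t v w t' v' w' :: real
  assumes "0 < v" "0 < w" "0 < v'" "0 < w'"
  defines "\<eta> \<equiv> (t, v, w)" and "\<zeta> \<equiv> (t', v', w')"
  shows "sample_dist n \<zeta> =
    density (sample_dist n \<eta>) (\<lambda>y. \<Prod>i<n. ennreal (mix_density (y i) \<zeta> / mix_density (y i) \<eta>))"
proof -
  let ?D = "density lborel (\<lambda>x. ennreal (mix_density x \<zeta>))"
  interpret D: prob_space ?D unfolding \<zeta>_def by (rule prob_space_mix_density[OF assms(3,4)])
  interpret P: product_sigma_finite "\<lambda>_::nat. ?D" ..
  let ?r = "\<lambda>x. ennreal (mix_density x \<zeta> / mix_density x \<eta>)"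
  have "density (sample_dist n \<eta>) (\<lambda>y. \<Prod>i<n. ?r (y i)) = PiM {..<n} (\<lambda>_. ?D)"
  proof (rule P.PiM_eqI)
    show "sets (density (sample_dist n \<eta>) (\<lambda>y. \<Prod>i<n. ?r (y i))) = sets (PiM {..<n} (\<lambda>_. ?D))"
      using sets_sample_dist[of n \<eta>] sets_sample_dist[of n \<zeta>] by (simp add: sample_dist_def)
    fix A :: "nat \<Rightarrow> real set" assume A: "\<And>i. i \<in> {..<n} \<Longrightarrow> A i \<in> sets ?D"
    define B where "B i = (if i < n then A i else UNIV)" for i
    have B [measurable]: "B i \<in> sets borel" for i using A[of i] by (auto simp: B_def)
    have AB: "Pi\<^sub>E {..<n} A = Pi\<^sub>E {..<n} B" by (rule PiE_cong) (simp add: B_def)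
    have PiB: "Pi\<^sub>E {..<n} B \<in> sets (sample_dist n \<eta>)"
      unfolding sets_sample_dist sample_space_def by (intro sets_PiM_I_finite) auto
    let ?E = "density lborel (\<lambda>x. ennreal (mix_density x \<eta>))"
    interpret E: prob_space ?E unfolding \<eta>_def by (rule prob_space_mix_density[OF assms(1,2)])
    interpret Q: product_sigma_finite "\<lambda>_::nat. ?E" ..
    have "emeasure (density (sample_dist n \<eta>) (\<lambda>y. \<Prod>i<n. ?r (y i))) (Pi\<^sub>E {..<n} B) =
      (\<integral>\<^sup>+ y. (\<Prod>i<n. ?r (y i)) * indicator (Pi\<^sub>E {..<n} B) y \<partial>sample_dist n \<eta>)"
      by (rule emeasure_density[OF _ PiB]) measurable
    also have "\<dots> = (\<integral>\<^sup>+ y. (\<Prod>i<n. ?r (y i) * indicator (B i) (y i)) \<partial>sample_dist n \<eta>)"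
    proof (rule nn_integral_cong)
      fix y assume "y \<in> space (sample_dist n \<eta>)"
      then have ext: "y \<in> extensional {..<n}" by (simp add: space_sample_dist sample_space_def space_PiM PiE_def)
      have "indicator (Pi\<^sub>E {..<n} B) y = (\<Prod>i<n. indicator (B i) (y i) :: ennreal)"
      proof (cases "y \<in> Pi\<^sub>E {..<n} B")
        case True
        then have "\<And>i. i < n \<Longrightarrow> y i \<in> B i" by (auto simp: PiE_def Pi_def)
        then have "(\<Prod>i<n. indicator (B i) (y i) :: ennreal) = 1" by (intro prod.neutral) auto
        then show ?thesis using True by simp
      next
        case False
        then obtain i where "i < n" "y i \<notin> B i" using ext by (auto simp: PiE_def Pi_def)
        then have "(\<Prod>i<n. indicator (B i) (y i) :: ennreal) = 0" by (intro prod_zero bexI[of _ i]) auto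
        then show ?thesis using False by simp
      qed
      then show "(\<Prod>i<n. ?r (y i)) * indicator (Pi\<^sub>E {..<n} B) y = (\<Prod>i<n. ?r (y i) * indicator (B i) (y i))"
        by (simp add: prod.distrib)
    qed
    also have "\<dots> = (\<Prod>i<n. \<integral>\<^sup>+ x. ?r x * indicator (B i) x \<partial>?E)"
      unfolding sample_dist_def by (intro Q.product_nn_integral_prod) auto
    also have "\<dots> = (\<Prod>i<n. emeasure ?D (B i))"
    proof (intro prod.cong refl)
      fix i
      have "(\<integral>\<^sup>+ x. ?r x * indicator (B i) x \<partial>?E) = (\<integral>\<^sup>+ x. ennreal (mix_density x \<eta>) * (?r x * indicator (B i) x) \<partial>lborel)"
        by (intro nn_integral_density) auto
      also have "\<dots> = (\<integral>\<^sup>+ x. ennreal (mix_density x \<zeta>) * indicator (B i) x \<partial>lborel)"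
      proof (rule nn_integral_cong)
        fix x
        have "ennreal (mix_density x \<eta>) * ?r x = ennreal (mix_density x \<zeta>)"
          using mix_density_pos[OF assms(1,2), of x t] mix_density_nonneg[of x \<zeta>]
          by (simp add: ennreal_mult[symmetric] \<eta>_def)
        then show "ennreal (mix_density x \<eta>) * (?r x * indicator (B i) x) = ennreal (mix_density x \<zeta>) * indicator (B i) x"
          by (simp add: mult.assoc[symmetric])
      qed
      also have "\<dots> = emeasure ?D (B i)" by (intro emeasure_density[symmetric]) auto
      finally show "(\<integral>\<^sup>+ x. ?r x * indicator (B i) x \<partial>?E) = emeasure ?D (B i)" .
    qed
    finally show "emeasure (density (sample_dist n \<eta>) (\<lambda>y. \<Prod>i<n. ?r (y i))) (Pi\<^sub>E {..<n} A) = (\<Prod>i<n. emeasure ?D (A i))"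
      unfolding AB by (simp add: B_def)
  qed simp
  then show ?thesis by (simp add: sample_dist_def)
qed

section \<open>Finite nets and the regularity of the likelihood\<close>

text \<open>
A Lipschitz constant of the log-likelihood of one observation \<open>x\<close>, relative to the weight \<open>1 + x\<^sup>2\<close>; see \<open>normal_density_log_lipschitz\<close>.
\<close>

definition log_lipschitz :: "real \<Rightarrow> real \<Rightarrow> real" where
  "log_lipschitz R a = (1 + R) / a + (1 + R\<^sup>2) / a\<^sup>2"

text \<open>
The normalising factor contributes \<open>\<delta>/(2*a)\<close>, the change of location in the exponent a term linear in \<open>\<bar>x\<bar>\<close>, and the
change of variance a term quadratic in \<open>x\<close>. All three are absorbed by the weight \<open>1 + x\<^sup>2\<close>.
\<close>

lemma normal_density_log_lipschitz:
  fixes R a s t v w \<delta> x :: real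
  assumes "0 < a" "0 \<le> \<delta>" and "\<bar>s\<bar> \<le> R" "\<bar>t\<bar> \<le> R" "a \<le> v" "a \<le> w"
    and close: "\<bar>s - t\<bar> \<le> \<delta>" "\<bar>v - w\<bar> \<le> \<delta>"
  shows "normal_density s (sqrt v) x \<le> exp (log_lipschitz R a * (1 + x\<^sup>2) * \<delta>) * normal_density t (sqrt w) x"
proof -
  have pos: "0 < v" "0 < w" "0 \<le> R" using assms by auto
  have x1: "1 \<le> 1 + x\<^sup>2" by simp
  have const: "1 / sqrt (2 * pi * v) \<le> exp (\<delta> / (2 * a)) * (1 / sqrt (2 * pi * w))"
  proof -
    have "w \<le> v + \<delta>" using close by linarith
    also have "\<dots> \<le> v * (1 + \<delta> / a)" using pos assms mult_right_mono[of a v "\<delta> / a"] by (simp add: distrib_left)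
    also have "\<dots> \<le> v * exp (\<delta> / a)" using pos exp_ge_add_one_self[of "\<delta> / a"] by (intro mult_left_mono) auto
    finally have "sqrt w \<le> sqrt (v * exp (\<delta> / a))" by (rule real_sqrt_le_mono)
    also have "\<dots> = sqrt v * exp (\<delta> / (2 * a))"
      using exp_double[of "\<delta> / (2 * a)"] by (simp add: real_sqrt_mult)
    finally have "sqrt w / (sqrt v * sqrt w) \<le> sqrt v * exp (\<delta> / (2 * a)) / (sqrt v * sqrt w)"
      using pos by (intro divide_right_mono) auto
    then have "1 / sqrt v \<le> exp (\<delta> / (2 * a)) * (1 / sqrt w)" using pos by simp
    then have "1 / sqrt (2 * pi) * (1 / sqrt v) \<le> 1 / sqrt (2 * pi) * (exp (\<delta> / (2 * a)) * (1 / sqrt w))"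
      by (intro mult_left_mono) auto
    then show ?thesis by (simp add: real_sqrt_mult mult_ac)
  qed
  have A: "((x - t)\<^sup>2 - (x - s)\<^sup>2) / (2 * w) \<le> (1 + x\<^sup>2) * (1 + 2 * R) * \<delta> / (2 * a)"
  proof -
    have "(x - t)\<^sup>2 - (x - s)\<^sup>2 = (s - t) * (2 * x - s - t)" by (simp add: power2_eq_square algebra_simps)
    also have "\<dots> \<le> \<bar>s - t\<bar> * \<bar>2 * x - s - t\<bar>" unfolding abs_mult[symmetric] by (rule abs_ge_self)
    also have "\<dots> \<le> \<delta> * (2 * \<bar>x\<bar> + 2 * R)"
      using assms by (intro mult_mono) auto
    also have "\<dots> \<le> \<delta> * ((1 + x\<^sup>2) * (1 + 2 * R))"
    proof (intro mult_left_mono)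
      have "2 * \<bar>x\<bar> \<le> 1 + x\<^sup>2" using zero_le_power2[of "\<bar>x\<bar> - 1"] by (simp add: power2_eq_square algebra_simps)
      moreover have "2 * R \<le> (1 + x\<^sup>2) * (2 * R)" using mult_right_mono[OF x1, of "2 * R"] pos by simp
      ultimately show "2 * \<bar>x\<bar> + 2 * R \<le> (1 + x\<^sup>2) * (1 + 2 * R)" by (simp add: distrib_left)
    qed (use assms in auto)
    finally have le: "(x - t)\<^sup>2 - (x - s)\<^sup>2 \<le> \<delta> * ((1 + x\<^sup>2) * (1 + 2 * R))" .
    have "((x - t)\<^sup>2 - (x - s)\<^sup>2) / (2 * w) \<le> \<delta> * ((1 + x\<^sup>2) * (1 + 2 * R)) / (2 * w)"
      using le pos by (intro divide_right_mono) auto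
    also have "\<dots> \<le> \<delta> * ((1 + x\<^sup>2) * (1 + 2 * R)) / (2 * a)"
      using assms pos by (intro divide_left_mono mult_nonneg_nonneg) auto
    finally show ?thesis by (simp add: mult_ac)
  qed
  have B: "(x - s)\<^sup>2 / (2 * w) - (x - s)\<^sup>2 / (2 * v) \<le> (1 + x\<^sup>2) * (1 + R\<^sup>2) / a\<^sup>2 * \<delta>"
  proof -
    have "(x - s)\<^sup>2 / (2 * w) - (x - s)\<^sup>2 / (2 * v) = (x - s)\<^sup>2 * (v - w) / (2 * (v * w))"
      using pos by (simp add: field_simps)
    also have "\<dots> \<le> (x - s)\<^sup>2 * \<bar>v - w\<bar> / (2 * (v * w))"
      using pos by (intro divide_right_mono mult_left_mono) auto
    also have "\<dots> \<le> (2 * ((1 + x\<^sup>2) * (1 + R\<^sup>2))) * \<delta> / (2 * (a * a))"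
    proof (intro frac_le mult_nonneg_nonneg mult_mono)
      have "(x - s)\<^sup>2 \<le> 2 * (x\<^sup>2 + s\<^sup>2)" using power2_sum_le[of x "- s"] by simp
      also have "s\<^sup>2 \<le> R\<^sup>2" using assms(3) power_mono[of "\<bar>s\<bar>" R 2] by simp
      also have "x\<^sup>2 + R\<^sup>2 \<le> (1 + x\<^sup>2) * (1 + R\<^sup>2)" by (simp add: algebra_simps)
      finally show "(x - s)\<^sup>2 \<le> 2 * ((1 + x\<^sup>2) * (1 + R\<^sup>2))" by simp
    qed (use assms pos in auto)
    finally show ?thesis by (simp add: power2_eq_square mult_ac)
  qed
  have sum: "\<delta> / (2 * a) + (- (x - s)\<^sup>2 / (2 * v)) \<le> log_lipschitz R a * (1 + x\<^sup>2) * \<delta> + (- (x - t)\<^sup>2 / (2 * w))"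
  proof -
    have "\<delta> / (2 * a) \<le> (1 + x\<^sup>2) * \<delta> / (2 * a)"
      using assms mult_right_mono[OF x1, of \<delta>] by (intro divide_right_mono) auto
    moreover have "log_lipschitz R a * (1 + x\<^sup>2) * \<delta> =
       (1 + x\<^sup>2) * \<delta> / (2 * a) + (1 + x\<^sup>2) * (1 + 2 * R) * \<delta> / (2 * a) + (1 + x\<^sup>2) * (1 + R\<^sup>2) / a\<^sup>2 * \<delta>"
    proof -
      have "((1 + R) / a + Q) * X = X / (2 * a) + X * (1 + 2 * R) / (2 * a) + X * Q" for X Q
        using assms(1) by (simp add: field_simps)
      from this[of "(1 + R\<^sup>2) / a\<^sup>2" "(1 + x\<^sup>2) * \<delta>"] show ?thesis
        by (simp add: log_lipschitz_def mult_ac)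
    qed
    ultimately show ?thesis using A B by (simp add: diff_divide_distrib)
  qed
  have "normal_density s (sqrt v) x = 1 / sqrt (2 * pi * v) * exp (- (x - s)\<^sup>2 / (2 * v))"
    using pos by (simp add: normal_density_def)
  also have "\<dots> \<le> exp (\<delta> / (2 * a)) * (1 / sqrt (2 * pi * w)) * exp (- (x - s)\<^sup>2 / (2 * v))"
    using const by (intro mult_right_mono) auto
  also have "\<dots> = 1 / sqrt (2 * pi * w) * exp (\<delta> / (2 * a) + (- (x - s)\<^sup>2 / (2 * v)))"
    by (simp only: exp_add mult_ac)
  also have "\<dots> \<le> 1 / sqrt (2 * pi * w) * exp (log_lipschitz R a * (1 + x\<^sup>2) * \<delta> + (- (x - t)\<^sup>2 / (2 * w)))"
    using sum pos by (intro mult_left_mono) auto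
  also have "\<dots> = exp (log_lipschitz R a * (1 + x\<^sup>2) * \<delta>) * normal_density t (sqrt w) x"
    unfolding exp_add using pos by (simp add: normal_density_def)
  finally show ?thesis .
qed

lemma mix_density_log_lipschitz:
  assumes "0 < a" "0 \<le> \<delta>" "\<eta> \<in> param_box R a b" "\<zeta> \<in> param_box R a b" "param_near \<delta> \<eta> \<zeta>"
  shows "mix_density x \<eta> \<le> exp (log_lipschitz R a * (1 + x\<^sup>2) * \<delta>) * mix_density x \<zeta>"
proof -
  obtain s v1 v2 where e: "\<eta> = (s, v1, v2)" by (cases \<eta>) auto
  obtain t w1 w2 where z: "\<zeta> = (t, w1, w2)" by (cases \<zeta>) auto
  let ?E = "exp (log_lipschitz R a * (1 + x\<^sup>2) * \<delta>)"
  have "normal_density (- s) (sqrt v1) x \<le> ?E * normal_density (- t) (sqrt w1) x"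
    by (rule normal_density_log_lipschitz) (use assms in \<open>auto simp: e z param_box_def param_near_def\<close>)
  moreover have "normal_density s (sqrt v2) x \<le> ?E * normal_density t (sqrt w2) x"
    by (rule normal_density_log_lipschitz) (use assms in \<open>auto simp: e z param_box_def param_near_def\<close>)
  ultimately show ?thesis by (simp add: e z mix_density_def distrib_left)
qed

lemma interval_net:
  fixes l u :: real
  assumes "l \<le> u" "1 \<le> K"
  shows "\<exists>F. finite F \<and> card F \<le> Suc K \<and> F \<subseteq> {l..u} \<and> (\<forall>x\<in>{l..u}. \<exists>y\<in>F. \<bar>x - y\<bar> \<le> (u - l) / real K)"
proof -
  define h where "h = (u - l) / real K"
  define F where "F = (\<lambda>i. l + real i * h) ` {..K}"
  have h: "0 \<le> h" "real K * h = u - l" using assms by (auto simp: h_def)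
  have "F \<subseteq> {l..u}"
  proof (clarsimp simp: F_def h(1))
    fix i assume "i \<le> K"
    then have "real i * h \<le> real K * h" using h by (intro mult_right_mono) auto
    then show "l + real i * h \<le> u" using h by simp
  qed
  moreover have "card F \<le> Suc K" unfolding F_def using card_image_le[of "{..K}"] by simp
  moreover have "\<exists>y\<in>F. \<bar>x - y\<bar> \<le> h" if x: "x \<in> {l..u}" for x
  proof (cases "h = 0")
    case True
    then show ?thesis using x h by (intro bexI[of _ l]) (auto simp: F_def)
  next
    case False
    then have h0: "0 < h" using h by simp
    define i where "i = nat \<lfloor>(x - l) / h\<rfloor>"
    have q: "0 \<le> (x - l) / h" using x h0 by simp
    then have i: "real i \<le> (x - l) / h" "(x - l) / h < real i + 1" by (auto simp: i_def)
    have "(x - l) / h \<le> real K" using x h0 h by (simp add: field_simps)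
    then have "i \<le> K" using i by linarith
    then have "l + real i * h \<in> F" by (auto simp: F_def)
    moreover have "\<bar>x - (l + real i * h)\<bar> \<le> h"
      using i h0 by (simp add: field_simps abs_le_iff)
    ultimately show ?thesis by blast
  qed
  ultimately show ?thesis unfolding h_def[symmetric] by (intro exI[of _ F]) (auto simp: F_def)
qed

lemma param_box_net:
  assumes "0 \<le> R" "a \<le> b" "1 \<le> K" "2 * R \<le> W" "b - a \<le> W"
  shows "\<exists>N. finite N \<and> card N \<le> Suc K ^ 3 \<and> N \<subseteq> param_box R a b \<and>
    (\<forall>\<eta>\<in>param_box R a b. \<exists>\<zeta>\<in>N. param_near (W / real K) \<eta> \<zeta>)"
proof -
  obtain F where F: "finite F" "card F \<le> Suc K" "F \<subseteq> {-R..R}" "\<And>x. x \<in> {-R..R} \<Longrightarrow> \<exists>y\<in>F. \<bar>x - y\<bar> \<le> (R - (-R)) / real K"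
    using interval_net[of "-R" R K] assms by auto
  obtain G where G: "finite G" "card G \<le> Suc K" "G \<subseteq> {a..b}" "\<And>x. x \<in> {a..b} \<Longrightarrow> \<exists>y\<in>G. \<bar>x - y\<bar> \<le> (b - a) / real K"
    using interval_net[of a b K] assms by auto
  have W: "(R - (-R)) / real K \<le> W / real K" "(b - a) / real K \<le> W / real K"
    using assms by (auto intro: divide_right_mono)
  show ?thesis
  proof (intro exI[of _ "F \<times> G \<times> G"] conjI ballI)
    show "finite (F \<times> G \<times> G)" using F G by auto
    have "card (F \<times> G \<times> G) = card F * (card G * card G)" using F G by (simp add: card_cartesian_product)
    also have "\<dots> \<le> Suc K * (Suc K * Suc K)" using F G by (intro mult_mono) auto
    finally show "card (F \<times> G \<times> G) \<le> Suc K ^ 3" by (simp only: power3_eq_cube mult.assoc)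
    show "F \<times> G \<times> G \<subseteq> param_box R a b" using F G by (auto simp: param_box_def)
    fix \<eta> assume "\<eta> \<in> param_box R a b"
    then obtain s v w where e: "\<eta> = (s, v, w)" "s \<in> {-R..R}" "v \<in> {a..b}" "w \<in> {a..b}" by (cases \<eta>) (auto simp: param_box_def)
    obtain s' where "s' \<in> F" "\<bar>s - s'\<bar> \<le> (R - (-R)) / real K" using F(4)[OF e(2)] by blast
    moreover obtain v' where "v' \<in> G" "\<bar>v - v'\<bar> \<le> (b - a) / real K" using G(4)[OF e(3)] by blast
    moreover obtain w' where "w' \<in> G" "\<bar>w - w'\<bar> \<le> (b - a) / real K" using G(4)[OF e(4)] by blast
    ultimately show "\<exists>\<zeta>\<in>F \<times> G \<times> G. param_near (W / real K) \<eta> \<zeta>"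
      using W by (intro bexI[of _ "(s', v', w')"]) (auto simp: param_near_def e intro: order.trans)
  qed
qed

section \<open>Risk of the maximum likelihood estimator\<close>

text \<open>
Bernoulli's inequality; equivalently, convexity of the exponential function between \<open>0\<close> and \<open>z\<close>.
\<close>

lemma exp_fraction_le:
  assumes "0 \<le> z" "1 \<le> n"
  shows "exp (z / real n) \<le> 1 + exp z / real n"
proof -
  have "0 \<le> (exp z - 1) / real n" using assms by (intro divide_nonneg_nonneg) auto
  then have ge: "-1 \<le> (exp z - 1) / real n" "0 \<le> 1 + (exp z - 1) / real n" by linarith+
  have "exp (z / real n) ^ n = exp z" using assms by (simp add: exp_of_nat_mult[symmetric])
  also have "\<dots> = 1 + real n * ((exp z - 1) / real n)" using assms by simp
  also have "\<dots> \<le> (1 + (exp z - 1) / real n) ^ n"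
    by (rule Bernoulli_inequality[OF ge(1)])
  finally have "exp (z / real n) \<le> 1 + (exp z - 1) / real n"
    using assms ge(2) by (subst (asm) power_mono_iff) auto
  also have "\<dots> \<le> 1 + exp z / real n" by (simp add: divide_right_mono)
  finally show ?thesis .
qed

text \<open>
The tilt \<open>exp ((1 + x\<^sup>2)/(8*b))\<close> is still integrable against the envelope, whose exponent is \<open>- x\<^sup>2/(4*b)\<close>. Its
\<open>n\<close>-th root therefore changes the affinity by \<open>O(1/n)\<close> only, which the \<open>n\<close>-th power of the affinity turns into a constant
factor.
\<close>

lemma tilted_affinity:
  assumes "0 < a" "a \<le> b"
  shows "\<exists>D\<ge>0. \<forall>n\<ge>1. \<forall>\<eta>\<in>param_box R a b. \<forall>\<zeta>\<in>param_box R a b.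
    (\<integral>\<^sup>+ x. ennreal (sqrt (mix_density x \<eta> * mix_density x \<zeta>) * exp ((1 + x\<^sup>2) / (8 * b) / real n)) \<partial>lborel)
      \<le> ennreal (affinity \<eta> \<zeta> + D / real n)"
proof -
  have b: "0 < b" using assms by simp
  define G where "G x = envelope R a b x * exp ((1 + x\<^sup>2) / (8 * b))" for x
  have G0: "0 \<le> G x" for x using envelope_nonneg[OF assms] by (simp add: G_def)
  have "integrable lborel G"
  proof -
    define c where "c = sqrt (2 * b / a) * exp (R\<^sup>2 / (2 * b)) * exp (1 / (8 * b)) * sqrt 2"
    have "G x = c * normal_density 0 (sqrt (4 * b)) x" for x
    proof -
      have n4: "normal_density 0 (sqrt (4 * b)) x = 1 / sqrt (2 * (4 * pi * b)) * exp (- (x\<^sup>2 / (8 * b)))"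
        using b by (simp add: normal_density_def mult_ac)
      have ex: "exp ((1 + x\<^sup>2) / (8 * b)) * exp (- (x\<^sup>2 / (4 * b))) = exp (1 / (8 * b)) * exp (- (x\<^sup>2 / (8 * b)))"
        unfolding exp_add[symmetric] using b by (simp add: field_simps)
      have "normal_density 0 (sqrt (2 * b)) x = 1 / sqrt (4 * pi * b) * exp (- (x\<^sup>2 / (4 * b)))"
        using b by (simp add: normal_density_def mult_ac)
      moreover have "1 / sqrt k = sqrt 2 * (1 / sqrt (2 * k))" for k by (simp add: real_sqrt_mult)
      from this[of "4 * pi * b"] have "1 / sqrt (4 * pi * b) = sqrt 2 * (1 / sqrt (2 * (4 * pi * b)))" .
      ultimately have "G x = sqrt (2 * b / a) * exp (R\<^sup>2 / (2 * b)) * sqrt 2 * (1 / sqrt (2 * (4 * pi * b))) *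
          (exp ((1 + x\<^sup>2) / (8 * b)) * exp (- (x\<^sup>2 / (4 * b))))"
        unfolding G_def envelope_def by simp
      then show ?thesis unfolding ex c_def n4 by (simp only: mult_ac)
    qed
    then have "G = (\<lambda>x. c * normal_density 0 (sqrt (4 * b)) x)" by (rule ext)
    moreover have "integrable lborel (\<lambda>x. c * normal_density 0 (sqrt (4 * b)) x)"
      using b by (intro integrable_mult_right integrable_normal_density) auto
    ultimately show ?thesis by (simp only:)
  qed
  note G_int = this
  define D where "D = integral\<^sup>L lborel G"
  have D0: "0 \<le> D" unfolding D_def using G0 by (intro integral_nonneg_AE) auto
  show ?thesis
  proof (intro exI[of _ D] conjI allI impI ballI D0)
    fix n :: nat and \<eta> \<zeta> assume n: "1 \<le> n" and box: "\<eta> \<in> param_box R a b" "\<zeta> \<in> param_box R a b"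
    define r where "r x = sqrt (mix_density x \<eta> * mix_density x \<zeta>)" for x
    have r0: "0 \<le> r x" for x by (simp add: r_def mix_density_nonneg)
    have r_le: "r x \<le> envelope R a b x" for x
    proof -
      have "r x \<le> sqrt (envelope R a b x * envelope R a b x)"
        unfolding r_def using mix_density_le_envelope[OF assms(1) box(1)] mix_density_le_envelope[OF assms(1) box(2)]
          mix_density_nonneg envelope_nonneg[OF assms]
        by (intro real_sqrt_le_mono mult_mono) auto
      then show ?thesis using envelope_nonneg[OF assms, of R x] by simp
    qed
    have r_meas [measurable]: "r \<in> borel_measurable borel" unfolding r_def by measurable
    have r_int: "integrable lborel r"
      using integrable_envelope_moment[OF assms, of R 0]
      by (rule Bochner_Integration.integrable_bound) (use r0 r_le envelope_nonneg[OF assms] in auto)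
    have pw: "r x * exp ((1 + x\<^sup>2) / (8 * b) / real n) \<le> r x + G x / real n" for x
    proof -
      have "r x * exp ((1 + x\<^sup>2) / (8 * b) / real n) \<le> r x * (1 + exp ((1 + x\<^sup>2) / (8 * b)) / real n)"
        using b n r0 by (intro mult_left_mono exp_fraction_le) auto
      also have "\<dots> = r x + r x * exp ((1 + x\<^sup>2) / (8 * b)) / real n" by (simp add: distrib_left)
      also have "\<dots> \<le> r x + G x / real n"
        unfolding G_def using r_le by (intro add_left_mono divide_right_mono mult_right_mono) auto
      finally show ?thesis .
    qed
    have "(\<integral>\<^sup>+ x. ennreal (r x * exp ((1 + x\<^sup>2) / (8 * b) / real n)) \<partial>lborel) \<le> (\<integral>\<^sup>+ x. ennreal (r x + G x / real n) \<partial>lborel)"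
      by (intro nn_integral_mono ennreal_leI pw)
    also have "\<dots> = ennreal (\<integral>x. r x + G x / real n \<partial>lborel)"
      using r_int G_int r0 G0 by (intro nn_integral_eq_integral) auto
    also have "(\<integral>x. r x + G x / real n \<partial>lborel) = affinity \<eta> \<zeta> + D / real n"
    proof -
      have "affinity \<eta> \<zeta> = integral\<^sup>L lborel r" by (simp add: affinity_def r_def[abs_def])
      then show ?thesis using r_int G_int by (simp add: D_def)
    qed
    finally show "(\<integral>\<^sup>+ x. ennreal (sqrt (mix_density x \<eta> * mix_density x \<zeta>) * exp ((1 + x\<^sup>2) / (8 * b) / real n)) \<partial>lborel)
      \<le> ennreal (affinity \<eta> \<zeta> + D / real n)" by (simp add: r_def)
  qed
qed

text \<open>
The square root of the likelihood ratio of \<open>\<zeta>\<close> against \<open>\<eta>\<close>, multiplied by the price for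
replacing the maximum likelihood estimator by the nearby net point \<open>\<zeta>\<close>.
\<close>

definition tilted_ratio :: "real \<Rightarrow> nat \<Rightarrow> param \<Rightarrow> param \<Rightarrow> (nat \<Rightarrow> real) \<Rightarrow> real" where
  "tilted_ratio b n \<eta> \<zeta> y =
    (\<Prod>i<n. sqrt (mix_density (y i) \<zeta> / mix_density (y i) \<eta>) * exp ((1 + (y i)\<^sup>2) / (8 * b) / real n))"

lemma tilted_ratio_nonneg: "0 \<le> tilted_ratio b n \<eta> \<zeta> y"
  unfolding tilted_ratio_def by (intro prod_nonneg) (auto simp: mix_density_nonneg)

lemma measurable_tilted_ratio [measurable]: "tilted_ratio b n \<eta> \<zeta> \<in> borel_measurable (sample_space n)"
  unfolding tilted_ratio_def[abs_def] by measurable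

lemma tilted_ratio_expectation:
  assumes "0 < a" "a \<le> b" "0 \<le> R"
  shows "\<exists>c>0. \<exists>D\<ge>0. \<forall>n\<ge>1. \<forall>\<eta>\<in>param_box R a b. \<forall>\<zeta>\<in>param_box R a b.
    (\<integral>\<^sup>+ y. ennreal (tilted_ratio b n \<eta> \<zeta> y) \<partial>sample_dist n \<eta>)
      \<le> ennreal (exp (D - real n * c * (quartic_loss \<eta> \<zeta>)\<^sup>2))"
proof -
  obtain c where c: "0 < c" "\<And>\<eta> \<zeta>. \<eta> \<in> param_box R a b \<Longrightarrow> \<zeta> \<in> param_box R a b \<Longrightarrow>
      affinity \<eta> \<zeta> \<le> 1 - c * (quartic_loss \<eta> \<zeta>)\<^sup>2"
    using affinity_le_quartic_loss[OF assms] by blast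
  obtain D where D: "0 \<le> D" "\<And>n \<eta> \<zeta>. 1 \<le> n \<Longrightarrow> \<eta> \<in> param_box R a b \<Longrightarrow> \<zeta> \<in> param_box R a b \<Longrightarrow>
    (\<integral>\<^sup>+ x. ennreal (sqrt (mix_density x \<eta> * mix_density x \<zeta>) * exp ((1 + x\<^sup>2) / (8 * b) / real n)) \<partial>lborel)
      \<le> ennreal (affinity \<eta> \<zeta> + D / real n)"
    using tilted_affinity[OF assms(1,2), of R] by blast
  show ?thesis
  proof (rule exI[of _ c], intro conjI c(1), rule exI[of _ D], intro conjI D(1) allI impI ballI)
    fix n :: nat and \<eta> \<zeta> assume n: "1 \<le> n" and box: "\<eta> \<in> param_box R a b" "\<zeta> \<in> param_box R a b"
    obtain s v1 v2 where e: "\<eta> = (s, v1, v2)" by (cases \<eta>) auto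
    have pos: "0 < v1" "0 < v2" using box assms(1) by (auto simp: e param_box_def)
    have mpos: "0 < mix_density x \<eta>" for x unfolding e by (rule mix_density_pos[OF pos])
    let ?t = "\<lambda>x. sqrt (mix_density x \<zeta> / mix_density x \<eta>) * exp ((1 + x\<^sup>2) / (8 * b) / real n)"
    have t0: "0 \<le> ?t x" for x by (simp add: mix_density_nonneg)
    have "(\<integral>\<^sup>+ y. ennreal (tilted_ratio b n \<eta> \<zeta> y) \<partial>sample_dist n \<eta>) =
        (\<integral>\<^sup>+ y. (\<Prod>i<n. ennreal (?t (y i))) \<partial>sample_dist n \<eta>)"
      unfolding tilted_ratio_def by (intro nn_integral_cong prod_ennreal[symmetric] t0)
    also have "\<dots> = (\<integral>\<^sup>+ x. ennreal (mix_density x \<eta>) * ennreal (?t x) \<partial>lborel) ^ n"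
      unfolding e by (rule nn_integral_sample_prod[OF pos]) measurable
    also have "(\<integral>\<^sup>+ x. ennreal (mix_density x \<eta>) * ennreal (?t x) \<partial>lborel) =
        (\<integral>\<^sup>+ x. ennreal (sqrt (mix_density x \<eta> * mix_density x \<zeta>) * exp ((1 + x\<^sup>2) / (8 * b) / real n)) \<partial>lborel)"
    proof (rule nn_integral_cong)
      fix x
      have "m * sqrt (k / m) = sqrt (m * k)" if "0 < m" for m k :: real
        using that real_sqrt_mult_self[of m] by (simp add: real_sqrt_mult real_sqrt_divide field_simps)
      then have "mix_density x \<eta> * ?t x = sqrt (mix_density x \<eta> * mix_density x \<zeta>) * exp ((1 + x\<^sup>2) / (8 * b) / real n)"
        using mpos[of x] by (simp only: mult.assoc[symmetric])
      then show "ennreal (mix_density x \<eta>) * ennreal (?t x) =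
          ennreal (sqrt (mix_density x \<eta> * mix_density x \<zeta>) * exp ((1 + x\<^sup>2) / (8 * b) / real n))"
        using t0[of x] mpos[of x] by (simp only: ennreal_mult[symmetric] less_imp_le)
    qed
    also have "\<dots> ^ n \<le> ennreal (exp (D / real n - c * (quartic_loss \<eta> \<zeta>)\<^sup>2)) ^ n"
    proof (intro power_mono order.trans[OF D(2)[OF n box]] ennreal_leI)
      have "affinity \<eta> \<zeta> + D / real n \<le> 1 + (D / real n - c * (quartic_loss \<eta> \<zeta>)\<^sup>2)"
        using c(2)[OF box] by simp
      also have "\<dots> \<le> exp (D / real n - c * (quartic_loss \<eta> \<zeta>)\<^sup>2)" by (rule exp_ge_add_one_self)
      finally show "affinity \<eta> \<zeta> + D / real n \<le> \<dots>" .
    qed simp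
    also have "\<dots> = ennreal (exp (real n * (D / real n - c * (quartic_loss \<eta> \<zeta>)\<^sup>2)))"
      by (simp only: ennreal_power[OF exp_ge_zero] exp_of_nat_mult)
    also have "real n * (D / real n - c * (quartic_loss \<eta> \<zeta>)\<^sup>2) = D - real n * c * (quartic_loss \<eta> \<zeta>)\<^sup>2"
      using n by (simp add: right_diff_distrib)
    finally show "(\<integral>\<^sup>+ y. ennreal (tilted_ratio b n \<eta> \<zeta> y) \<partial>sample_dist n \<eta>)
      \<le> ennreal (exp (D - real n * c * (quartic_loss \<eta> \<zeta>)\<^sup>2))" .
  qed
qed

text \<open>
The likelihood at the estimator \<open>\<xi>\<close> is at least the likelihood at the true parameter \<open>\<eta>\<close>, and moving
from \<open>\<xi>\<close> to \<open>\<zeta>\<close> costs at most the square of the tilt.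
\<close>

lemma tilted_ratio_ge_1_near_mle:
  assumes "0 < a" "a \<le> b" "1 \<le> n" and box: "\<eta> \<in> param_box R a b" "\<zeta> \<in> param_box R a b" "\<xi> \<in> param_box R a b"
    and near: "param_near (\<delta> / real n) \<xi> \<zeta>" "0 \<le> \<delta>" "\<delta> * (4 * b * log_lipschitz R a) \<le> 1"
    and mle: "log_lik n y \<eta> \<le> log_lik n y \<xi>"
  shows "1 \<le> tilted_ratio b n \<eta> \<zeta> y"
proof -
  have b: "0 < b" using assms by simp
  have pos: "0 < mix_density x \<xi>'" if "\<xi>' \<in> param_box R a b" for x \<xi>'
    using that assms(1) mix_density_pos by (cases \<xi>') (auto simp: param_box_def)
  have lik: "(\<Prod>i<n. mix_density (y i) \<xi>') = exp (log_lik n y \<xi>')" if "\<xi>' \<in> param_box R a b" for \<xi>'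
    unfolding log_lik_def exp_sum[OF finite_lessThan] using pos[OF that] by simp
  have step: "mix_density x \<xi> \<le> exp ((1 + x\<^sup>2) / (4 * b) / real n) * mix_density x \<zeta>" for x
  proof -
    have "mix_density x \<xi> \<le> exp (log_lipschitz R a * (1 + x\<^sup>2) * (\<delta> / real n)) * mix_density x \<zeta>"
      using near(2) by (intro mix_density_log_lipschitz[OF assms(1) _ box(3,2) near(1)]) auto
    also have "log_lipschitz R a * (1 + x\<^sup>2) * (\<delta> / real n) \<le> (1 + x\<^sup>2) / (4 * b) / real n"
    proof -
      have "\<delta> * log_lipschitz R a \<le> 1 / (4 * b)" using near(3) b by (simp add: field_simps)
      then have "(1 + x\<^sup>2) * (\<delta> * log_lipschitz R a) / real n \<le> (1 + x\<^sup>2) * (1 / (4 * b)) / real n"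
        by (intro divide_right_mono mult_left_mono) auto
      then show ?thesis by (simp add: mult_ac)
    qed
    finally show ?thesis using pos[OF box(2), of x] by (simp add: mult_right_mono)
  qed
  have "(\<Prod>i<n. mix_density (y i) \<eta>) \<le> (\<Prod>i<n. mix_density (y i) \<xi>)"
    unfolding lik[OF box(1)] lik[OF box(3)] using mle by simp
  also have "\<dots> \<le> (\<Prod>i<n. exp ((1 + (y i)\<^sup>2) / (4 * b) / real n) * mix_density (y i) \<zeta>)"
    using step mix_density_nonneg by (intro prod_mono) auto
  also have "\<dots> = (tilted_ratio b n \<eta> \<zeta> y)\<^sup>2 * (\<Prod>i<n. mix_density (y i) \<eta>)"
  proof -
    have "(sqrt (mix_density x \<zeta> / mix_density x \<eta>) * exp ((1 + x\<^sup>2) / (8 * b) / real n))\<^sup>2 * mix_density x \<eta>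
      = exp ((1 + x\<^sup>2) / (4 * b) / real n) * mix_density x \<zeta>" for x
    proof -
      have "(exp ((1 + x\<^sup>2) / (8 * b) / real n))\<^sup>2 = exp ((1 + x\<^sup>2) / (4 * b) / real n)"
      proof -
        have "X / (4 * b) / real n = 2 * (X / (8 * b) / real n)" for X by simp
        from this[of "1 + x\<^sup>2"] show ?thesis by (simp only: exp_double)
      qed
      moreover have "(sqrt (mix_density x \<zeta> / mix_density x \<eta>))\<^sup>2 = mix_density x \<zeta> / mix_density x \<eta>"
        by (simp add: mix_density_nonneg)
      ultimately show ?thesis using pos[OF box(1), of x] by (simp add: power_mult_distrib)
    qed
    then show ?thesis
      unfolding tilted_ratio_def prod_power_distrib prod.distrib[symmetric] by simp
  qed
  finally have "1 \<le> (tilted_ratio b n \<eta> \<zeta> y)\<^sup>2"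
    using prod_pos[of "{..<n}" "\<lambda>i. mix_density (y i) \<eta>"] pos[OF box(1)] by simp
  then show ?thesis
    using tilted_ratio_nonneg[of b n \<eta> \<zeta> y] by (metis power2_le_imp_le one_power2)
qed

text \<open>
Let \<open>\<zeta>\<close> be a net point near the estimator. Either the loss at \<open>\<zeta>\<close> is at most the threshold \<open>\<tau>\<close>, and then the loss of
the estimator is small as well; or \<open>\<zeta>\<close> belongs to the set \<open>J\<close> of bad net points, and then the bounded loss is
dominated by the sum of the tilted ratios over \<open>J\<close>. Each of these has an exponentially small expectation.
\<close>

lemma mle_risk_deviation:
  assumes "0 < a" "a \<le> b" "0 \<le> R"
  shows "\<exists>c>0. \<exists>M\<ge>0. \<exists>E\<ge>0. \<forall>n\<ge>1. \<forall>H\<subseteq>param_box R a b. \<forall>T\<in>mles n H. \<forall>\<eta>\<in>H. \<forall>\<tau>\<ge>0.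
    risk 4 n T \<eta> \<le> ennreal ((8 * (\<tau> + E / real n)) powr (1/4) + M * real n ^ 3 * exp (- real n * c * \<tau>\<^sup>2))"
proof -
  obtain c D where c: "0 < c" and D: "0 \<le> D" "\<And>n \<eta> \<zeta>. 1 \<le> n \<Longrightarrow> \<eta> \<in> param_box R a b \<Longrightarrow> \<zeta> \<in> param_box R a b \<Longrightarrow>
    (\<integral>\<^sup>+ y. ennreal (tilted_ratio b n \<eta> \<zeta> y) \<partial>sample_dist n \<eta>)
      \<le> ennreal (exp (D - real n * c * (quartic_loss \<eta> \<zeta>)\<^sup>2))"
    using tilted_ratio_expectation[OF assms] by blast
  have b: "0 < b" using assms by simp
  define L where "L = log_lipschitz R a"
  have L: "0 < L" unfolding L_def log_lipschitz_def using assms by (intro add_pos_nonneg divide_pos_pos divide_nonneg_nonneg) auto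
  \<comment> \<open>At spacing \<open>\<delta>/n\<close> the log-likelihood of one observation varies by at most \<open>(1 + x\<^sup>2)/(4*b*n)\<close>.\<close>
  define \<delta> where "\<delta> = 1 / (4 * b * L)"
  have \<delta>: "0 < \<delta>" "\<delta> * (4 * b * log_lipschitz R a) \<le> 1" using L b by (auto simp: \<delta>_def L_def[symmetric])
  define W where "W = 2 * R + (b - a)"
  define k where "k = nat \<lceil>W / \<delta>\<rceil> + 1"
  have W0: "0 \<le> W" using assms by (simp add: W_def)
  have k: "1 \<le> k" "W / real k \<le> \<delta>"
  proof -
    have "W / \<delta> \<le> real k" unfolding k_def using real_nat_ceiling_ge[of "W / \<delta>"] by linarith
    then show "W / real k \<le> \<delta>" using \<delta> by (simp add: k_def field_simps)
  qed (simp add: k_def)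
  define Q where "Q = ((2 * R)^4 + 2 * (b - a)\<^sup>2) powr (1/4)"
  have Q0: "0 \<le> Q" by (simp add: Q_def)
  define E where "E = \<delta>^4 + 2 * \<delta>\<^sup>2"
  have E0: "0 \<le> E" by (simp add: E_def)
  define M where "M = Q * (2 * real k)^3 * exp D"
  have M0: "0 \<le> M" using Q0 by (simp add: M_def)
  show ?thesis
  proof (rule exI[of _ c], intro conjI c, rule exI[of _ M], intro conjI M0, rule exI[of _ E],
      intro conjI E0 allI impI ballI)
    fix n :: nat and H T \<eta> and \<tau> :: real
    assume n: "1 \<le> n" and H: "H \<subseteq> param_box R a b" and T: "T \<in> mles n H" and \<eta>: "\<eta> \<in> H" and \<tau>: "0 \<le> \<tau>"
    have \<eta>b: "\<eta> \<in> param_box R a b" using H \<eta> by auto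
    have kn: "1 \<le> k * n" using k n by simp
    obtain N where N: "finite N" "card N \<le> Suc (k * n) ^ 3" "N \<subseteq> param_box R a b"
      "\<And>\<xi>. \<xi> \<in> param_box R a b \<Longrightarrow> \<exists>\<zeta>\<in>N. param_near (W / real (k * n)) \<xi> \<zeta>"
      using param_box_net[OF assms(3,2) kn, of W] assms by (auto simp: W_def)
    have spacing: "W / real (k * n) \<le> \<delta> / real n"
      using divide_right_mono[OF k(2), of "real n"] by simp
    define J where "J = {\<zeta> \<in> N. \<tau> < quartic_loss \<eta> \<zeta>}"
    have J: "finite J" "J \<subseteq> param_box R a b" using N by (auto simp: J_def)
    have card_J: "real (card J) \<le> (2 * real k)^3 * real n ^ 3"
    proof -
      have "card J \<le> Suc (k * n) ^ 3" using card_mono[OF N(1), of J] N(2) by (auto simp: J_def)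
      also have "\<dots> \<le> (2 * k * n) ^ 3" using kn by (intro power_mono) auto
      finally have "real (card J) \<le> real ((2 * k * n) ^ 3)" by (simp only: of_nat_le_iff)
      then show ?thesis by (simp add: power_mult_distrib)
    qed
    define A where "A = (8 * (\<tau> + E / real n)) powr (1/4)"
    have A0: "0 \<le> A" by (simp add: A_def)
    have pw: "loss 4 (T y) \<eta> \<le> A + (\<Sum>\<zeta>\<in>J. Q * tilted_ratio b n \<eta> \<zeta> y)" if y: "y \<in> space (sample_dist n \<eta>)" for y
    proof -
      have am: "is_arg_max (log_lik n y) (\<lambda>\<eta>. \<eta> \<in> H) (T y)" using T y by (simp add: mles_def space_sample_dist)
      then have lik: "log_lik n y \<eta> \<le> log_lik n y (T y)" using \<eta> unfolding is_arg_max_linorder by blast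
      have Ty: "T y \<in> H" "T y \<in> param_box R a b" using am H by (auto simp: is_arg_max_def)
      obtain \<zeta> where \<zeta>: "\<zeta> \<in> N" "param_near (W / real (k * n)) (T y) \<zeta>" using N(4)[OF Ty(2)] by blast
      have near: "param_near (\<delta> / real n) (T y) \<zeta>"
        using \<zeta>(2) spacing by (auto simp: param_near_def split: prod.splits intro: order.trans)
      show ?thesis
      proof (cases "\<zeta> \<in> J")
        case True
        have "1 \<le> tilted_ratio b n \<eta> \<zeta> y"
          using \<zeta>(1) N(3) \<delta> by (intro tilted_ratio_ge_1_near_mle[OF assms(1,2) n \<eta>b _ Ty(2) near _ _ lik]) auto
        then have "Q * 1 \<le> Q * tilted_ratio b n \<eta> \<zeta> y" using Q0 by (intro mult_left_mono) auto
        also have "\<dots> \<le> (\<Sum>\<zeta>\<in>J. Q * tilted_ratio b n \<eta> \<zeta> y)"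
          using Q0 tilted_ratio_nonneg by (intro member_le_sum[OF True] J(1) mult_nonneg_nonneg) auto
        finally have "Q \<le> (\<Sum>\<zeta>\<in>J. Q * tilted_ratio b n \<eta> \<zeta> y)" by simp
        moreover have "loss 4 (T y) \<eta> \<le> Q"
          unfolding loss_4_eq Q_def using quartic_loss_bounded[OF Ty(2) \<eta>b] quartic_loss_nonneg
          by (intro powr_mono2) auto
        ultimately show ?thesis using A0 by linarith
      next
        case False
        then have small: "quartic_loss \<zeta> \<eta> \<le> \<tau>" using \<zeta>(1) by (auto simp: J_def quartic_loss_symmetric)
        have "(\<delta> / real n)^4 + 2 * (\<delta> / real n)\<^sup>2 \<le> E / real n"
        proof -
          have *: "\<delta>^j / real n ^ j \<le> \<delta>^j / real n" if "1 \<le> j" for j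
            using n \<delta> that self_le_power[of "real n" j] by (intro divide_left_mono) auto
          show ?thesis using *[of 4] *[of 2] by (simp add: E_def power_divide add_divide_distrib)
        qed
        moreover have "quartic_loss (T y) \<eta> \<le> 8 * (quartic_loss \<zeta> \<eta> + ((\<delta> / real n)^4 + 2 * (\<delta> / real n)\<^sup>2))"
          using \<delta> by (intro quartic_loss_le_near[OF near]) auto
        moreover have "q \<le> 8 * (\<tau> + x)" if "d \<le> x" "q \<le> 8 * (z + d)" "z \<le> \<tau>" for q x z d :: real
          using that(1,3) by (intro order.trans[OF that(2)] mult_left_mono add_mono) auto
        ultimately have "quartic_loss (T y) \<eta> \<le> 8 * (\<tau> + E / real n)" using small by blast
        then have "loss 4 (T y) \<eta> \<le> A"
          unfolding loss_4_eq A_def using quartic_loss_nonneg by (intro powr_mono2) auto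
        moreover have "0 \<le> (\<Sum>\<zeta>\<in>J. Q * tilted_ratio b n \<eta> \<zeta> y)"
          using Q0 tilted_ratio_nonneg by (intro sum_nonneg mult_nonneg_nonneg) auto
        ultimately show ?thesis by linarith
      qed
    qed
    have mass: "emeasure (sample_dist n \<eta>) (space (sample_dist n \<eta>)) = 1"
    proof -
      obtain s v w where e: "\<eta> = (s, v, w)" by (cases \<eta>) auto
      have "0 < v" "0 < w" using \<eta>b assms(1) by (auto simp: e param_box_def)
      then interpret prob_space "sample_dist n \<eta>"
        unfolding sample_dist_def e by (intro prob_space_PiM prob_space_mix_density)
      show ?thesis by (rule emeasure_space_1)
    qed
    have "risk 4 n T \<eta> \<le> (\<integral>\<^sup>+ y. ennreal A + (\<Sum>\<zeta>\<in>J. ennreal Q * ennreal (tilted_ratio b n \<eta> \<zeta> y)) \<partial>sample_dist n \<eta>)"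
      unfolding risk_def
    proof (rule nn_integral_mono)
      fix y assume y: "y \<in> space (sample_dist n \<eta>)"
      have "ennreal (loss 4 (T y) \<eta>) \<le> ennreal (A + (\<Sum>\<zeta>\<in>J. Q * tilted_ratio b n \<eta> \<zeta> y))"
        by (intro ennreal_leI pw y)
      also have "\<dots> = ennreal A + (\<Sum>\<zeta>\<in>J. ennreal Q * ennreal (tilted_ratio b n \<eta> \<zeta> y))"
      proof -
        have Qt: "0 \<le> Q * tilted_ratio b n \<eta> \<zeta> y" for \<zeta> using Q0 tilted_ratio_nonneg by (rule mult_nonneg_nonneg)
        have "ennreal (A + (\<Sum>\<zeta>\<in>J. Q * tilted_ratio b n \<eta> \<zeta> y)) = ennreal A + ennreal (\<Sum>\<zeta>\<in>J. Q * tilted_ratio b n \<eta> \<zeta> y)"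
          by (intro ennreal_plus A0 sum_nonneg Qt)
        also have "ennreal (\<Sum>\<zeta>\<in>J. Q * tilted_ratio b n \<eta> \<zeta> y) = (\<Sum>\<zeta>\<in>J. ennreal (Q * tilted_ratio b n \<eta> \<zeta> y))"
          by (intro sum_ennreal[symmetric] Qt)
        finally show ?thesis by (simp only: ennreal_mult[OF Q0 tilted_ratio_nonneg])
      qed
      finally show "ennreal (loss 4 (T y) \<eta>) \<le> \<dots>" .
    qed
    also have "\<dots> = ennreal A + (\<Sum>\<zeta>\<in>J. ennreal Q * (\<integral>\<^sup>+ y. ennreal (tilted_ratio b n \<eta> \<zeta> y) \<partial>sample_dist n \<eta>))"
      by (simp add: nn_integral_add nn_integral_sum nn_integral_cmult mass)
    also have "\<dots> \<le> ennreal A + (\<Sum>\<zeta>\<in>J. ennreal Q * ennreal (exp (D - real n * c * \<tau>\<^sup>2)))"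
    proof (intro add_left_mono sum_mono mult_left_mono order.trans[OF D(2)[OF n \<eta>b]] ennreal_leI)
      fix \<zeta> assume "\<zeta> \<in> J"
      then have "\<tau>\<^sup>2 \<le> (quartic_loss \<eta> \<zeta>)\<^sup>2" using \<tau> by (intro power_mono) (auto simp: J_def)
      then have "real n * c * \<tau>\<^sup>2 \<le> real n * c * (quartic_loss \<eta> \<zeta>)\<^sup>2" using c by (intro mult_left_mono) auto
      then show "exp (D - real n * c * (quartic_loss \<eta> \<zeta>)\<^sup>2) \<le> exp (D - real n * c * \<tau>\<^sup>2)" by simp
    qed (use J in auto)
    also have "\<dots> = ennreal (A + real (card J) * (Q * exp (D - real n * c * \<tau>\<^sup>2)))"
      using A0 Q0 by (simp add: ennreal_plus ennreal_mult ennreal_of_nat_eq_real_of_nat)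
    also have "\<dots> \<le> ennreal (A + M * real n ^ 3 * exp (- real n * c * \<tau>\<^sup>2))"
    proof (intro ennreal_leI add_left_mono)
      have "real (card J) * (Q * exp (D - real n * c * \<tau>\<^sup>2)) \<le> ((2 * real k)^3 * real n ^ 3) * (Q * exp (D - real n * c * \<tau>\<^sup>2))"
        using card_J Q0 by (intro mult_right_mono) auto
      moreover have "exp (D - real n * c * \<tau>\<^sup>2) = exp D * exp (- real n * c * \<tau>\<^sup>2)" by (simp add: exp_add[symmetric])
      ultimately show "real (card J) * (Q * exp (D - real n * c * \<tau>\<^sup>2)) \<le> M * real n ^ 3 * exp (- real n * c * \<tau>\<^sup>2)"
        by (simp add: M_def mult_ac)
    qed
    finally show "risk 4 n T \<eta> \<le> ennreal ((8 * (\<tau> + E / real n)) powr (1/4) + M * real n ^ 3 * exp (- real n * c * \<tau>\<^sup>2))"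
      by (simp add: A_def)
  qed
qed

text \<open>
With \<open>\<tau> = 2 * sqrt (ln n / (c*n))\<close> the exponential factor is \<open>n^(-4)\<close>, which beats the number \<open>O(n^3)\<close> of net points.
\<close>

lemma mle_upper_bound:
  assumes "0 < a" "a \<le> b" "0 \<le> R"
  shows "\<exists>C>0. \<forall>n\<ge>2. \<forall>H\<subseteq>param_box R a b. \<forall>T\<in>mles n H. \<forall>\<eta>\<in>H.
    risk 4 n T \<eta> \<le> ennreal (C * (ln (real n) / real n) powr (1/8))"
proof -
  obtain c M E where c: "0 < c" and M: "0 \<le> M" and E: "0 \<le> E" and bound:
    "\<And>n H T \<eta> \<tau>. 1 \<le> n \<Longrightarrow> H \<subseteq> param_box R a b \<Longrightarrow> T \<in> mles n H \<Longrightarrow> \<eta> \<in> H \<Longrightarrow> 0 \<le> \<tau> \<Longrightarrow>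
    risk 4 n T \<eta> \<le> ennreal ((8 * (\<tau> + E / real n)) powr (1/4) + M * real n ^ 3 * exp (- real n * c * \<tau>\<^sup>2))"
    using mle_risk_deviation[OF assms] by meson
  define S where "S = 8 * (2 / sqrt c + 2 * E)"
  have S0: "0 < S" unfolding S_def using c E by (intro mult_pos_pos add_pos_nonneg) auto
  show ?thesis
  proof (intro exI[of _ "S powr (1/4) + 2 * M"] conjI allI impI ballI)
    show "0 < S powr (1/4) + 2 * M" using S0 M by (intro add_pos_nonneg) auto
    fix n :: nat and H T \<eta> assume n: "2 \<le> n" and H: "H \<subseteq> param_box R a b" "T \<in> mles n H" "\<eta> \<in> H"
    define l where "l = ln (real n) / real n"
    have ln: "1 / 2 \<le> ln (real n)" 
    proof -
      have "1 / 2 \<le> ln (2::real)" using ln2_ge_two_thirds by simp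
      also have "\<dots> \<le> ln (real n)" using n by simp
      finally show ?thesis .
    qed
    have l: "0 < l" "l \<le> 1" using n ln ln_le_minus_one[of "real n"] by (auto simp: l_def field_simps)
    have inv: "1 / real n \<le> 2 * l" using ln n by (simp add: l_def field_simps)
    have mono: "l \<le> l powr p" if "0 < p" "p \<le> 1" for p
      using that l powr_mono'[of p 1 l] by simp
    have sqrt_l: "sqrt l = l powr (1/2)" using l by (simp add: powr_half_sqrt)
    define \<tau> where "\<tau> = 2 * sqrt l / sqrt c"
    have \<tau>: "0 \<le> \<tau>" using l c by (simp add: \<tau>_def)
    have "real n * c * \<tau>\<^sup>2 = 4 * ln (real n)" using n l c by (simp add: \<tau>_def power_divide power_mult_distrib l_def)
    then have "exp (- real n * c * \<tau>\<^sup>2) = exp (- (4 * ln (real n)))" by simp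
    also have "\<dots> = 1 / real n ^ 4"
      using n exp_of_nat_mult[of 4 "ln (real n)"] by (simp add: exp_minus divide_inverse)
    finally have "M * real n ^ 3 * exp (- real n * c * \<tau>\<^sup>2) = M * (1 / real n)"
      using n by (simp add: power3_eq_cube power4_eq_xxxx)
    also have "\<dots> \<le> M * (2 * l powr (1/8))" using M inv mono[of "1/8"] by (intro mult_left_mono) auto
    finally have second: "M * real n ^ 3 * exp (- real n * c * \<tau>\<^sup>2) \<le> 2 * M * l powr (1/8)" by simp
    have "8 * (\<tau> + E / real n) \<le> S * sqrt l"
    proof -
      have "E / real n = E * (1 / real n)" by simp
      also have "\<dots> \<le> E * (2 * sqrt l)" using E inv mono[of "1/2"] sqrt_l by (intro mult_left_mono) auto
      finally have "8 * (\<tau> + E / real n) \<le> 8 * (\<tau> + E * (2 * sqrt l))"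
        by (intro mult_left_mono add_left_mono) auto
      also have "\<dots> = S * sqrt l" by (simp add: S_def \<tau>_def algebra_simps)
      finally show ?thesis .
    qed
    then have "(8 * (\<tau> + E / real n)) powr (1/4) \<le> (S * sqrt l) powr (1/4)"
      using \<tau> E by (intro powr_mono2) auto
    also have "\<dots> = S powr (1/4) * l powr (1/8)"
      using S0 l by (simp add: powr_mult sqrt_l powr_powr)
    finally have first: "(8 * (\<tau> + E / real n)) powr (1/4) \<le> S powr (1/4) * l powr (1/8)" .
    have "risk 4 n T \<eta> \<le> ennreal ((8 * (\<tau> + E / real n)) powr (1/4) + M * real n ^ 3 * exp (- real n * c * \<tau>\<^sup>2))"
      using n by (intro bound[OF _ H \<tau>]) auto
    also have "\<dots> \<le> ennreal ((S powr (1/4) + 2 * M) * l powr (1/8))"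
      using first second by (intro ennreal_leI) (simp add: distrib_right)
    finally show "risk 4 n T \<eta> \<le> ennreal ((S powr (1/4) + 2 * M) * (ln (real n) / real n) powr (1/8))"
      by (simp add: l_def)
  qed
qed

section \<open>A mixture that imitates a single normal law\<close>

text \<open>
Comparison of the power series, since \<open>2^n * n!\<close> is at most \<open>(2*n)!\<close>.
\<close>

lemma cosh_le_exp_half_square: "cosh u \<le> exp (u\<^sup>2 / 2)" for u :: real
proof -
  have fact_le: "2 ^ n * fact n \<le> (fact (2 * n) :: real)" for n
  proof (induction n)
    case (Suc n)
    have "2 ^ Suc n * fact (Suc n) = (2 * real n + 2) * (2 ^ n * fact n)" by (simp add: algebra_simps)
    also have "\<dots> \<le> (2 * real n + 2) * fact (2 * n)" using Suc by (intro mult_left_mono) auto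
    also have "\<dots> \<le> (2 * real n + 2) * ((2 * real n + 1) * fact (2 * n))"
      by (intro mult_left_mono) (auto simp: algebra_simps)
    also have "\<dots> = fact (2 * Suc n)" by (simp add: algebra_simps)
    finally show ?case .
  qed simp
  have "(\<lambda>n. if even n then u ^ n /\<^sub>R fact n else 0) sums cosh u" by (rule cosh_converges)
  then have "(\<lambda>n. (if even (2 * n) then u ^ (2 * n) /\<^sub>R fact (2 * n) else 0)) sums cosh u"
    by (subst sums_mono_reindex[of "\<lambda>n. 2 * n"]) (auto simp: strict_mono_def elim: evenE)
  then have cosh_sums: "(\<lambda>n. u ^ (2 * n) /\<^sub>R fact (2 * n)) sums cosh u" by simp
  have exp_sums: "(\<lambda>n. (u\<^sup>2 / 2) ^ n /\<^sub>R fact n) sums exp (u\<^sup>2 / 2)" by (rule exp_converges)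
  have "u ^ (2 * n) /\<^sub>R fact (2 * n) \<le> (u\<^sup>2 / 2) ^ n /\<^sub>R fact n" for n
  proof -
    have "u ^ (2 * n) /\<^sub>R fact (2 * n) = (u\<^sup>2) ^ n / fact (2 * n)" by (simp add: power_mult divide_inverse)
    also have "\<dots> \<le> (u\<^sup>2) ^ n / (2 ^ n * fact n)"
      using fact_le[of n] by (intro divide_left_mono) auto
    also have "\<dots> = (u\<^sup>2 / 2) ^ n /\<^sub>R fact n" by (simp add: power_divide divide_simps)
    finally show ?thesis .
  qed
  then show ?thesis using cosh_sums exp_sums by (rule sums_le)
qed

text \<open>
The left-hand side is 1 plus the chi-square divergence of two mixtures with the same first three moments. With \<open>q = s\<^sup>2\<close>
and \<open>u = s/(1 - q)\<close> it equals \<open>(1 - q) powr (-1/2) * exp (- q/(1 - q)) * cosh u\<close>, and the three factors cancel up to terms of order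
\<open>q\<^sup>2 = s^4\<close>.
\<close>

lemma hermite_cancellation:
  fixes s :: real
  assumes "0 \<le> s" "s \<le> 1/2"
  shows "1 / sqrt (1 - s\<^sup>2) * ((exp (s / (1 + s)) + exp (- s / (1 - s))) / 2) \<le> exp (s^4)"
proof -
  define q where "q = s\<^sup>2"
  have q: "0 \<le> q" "q \<le> 1/4" "q = s * s" using assms power_mono[of s "1/2" 2] by (auto simp: q_def power2_eq_square)
  define u where "u = s / (1 - q)"
  have q_fact: "1 - q = (1 - s) * (1 + s)" unfolding q(3) by (simp add: algebra_simps)
  have e1: "s / (1 + s) = - (q / (1 - q)) + u" "- s / (1 - s) = - (q / (1 - q)) + - u"
  proof -
    have "- (q / (1 - q)) + u = (s - q) / (1 - q)" "- (q / (1 - q)) + - u = (- s - q) / (1 - q)"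
      by (simp_all add: u_def diff_divide_distrib)
    moreover have "s - q = (1 - s) * s" "- s - q = - s * (1 + s)" by (simp_all add: q(3) algebra_simps)
    ultimately show "s / (1 + s) = - (q / (1 - q)) + u" "- s / (1 - s) = - (q / (1 - q)) + - u"
      unfolding q_fact using assms by simp_all
  qed
  have "1 / sqrt (1 - q) = sqrt (1 / (1 - q))" by (simp add: real_sqrt_divide)
  also have "1 / (1 - q) = 1 + q / (1 - q)" using q by (simp add: field_simps)
  also have "sqrt (1 + q / (1 - q)) \<le> sqrt (exp (q / (1 - q)))" by (intro real_sqrt_le_mono exp_ge_add_one_self)
  also have "\<dots> = exp (q / (1 - q) / 2)"
  proof -
    have "sqrt (exp y) = exp (y / 2)" for y :: real using exp_double[of "y / 2"] by simp
    then show ?thesis .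
  qed
  finally have A: "1 / sqrt (1 - q) \<le> exp (q / (1 - q) / 2)" .
  have "(exp (s / (1 + s)) + exp (- s / (1 - s))) / 2 = exp (- (q / (1 - q))) * cosh u"
    unfolding e1 exp_add by (simp add: cosh_field_def algebra_simps)
  also have "\<dots> \<le> exp (- (q / (1 - q))) * exp (u\<^sup>2 / 2)"
    by (intro mult_left_mono cosh_le_exp_half_square) auto
  finally have B: "(exp (s / (1 + s)) + exp (- s / (1 - s))) / 2 \<le> exp (- (q / (1 - q))) * exp (u\<^sup>2 / 2)" .
  have "1 / sqrt (1 - q) * ((exp (s / (1 + s)) + exp (- s / (1 - s))) / 2) \<le>
      exp (q / (1 - q) / 2) * (exp (- (q / (1 - q))) * exp (u\<^sup>2 / 2))"
    using A B q by (intro mult_mono) auto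
  also have "\<dots> = exp (q / (1 - q) / 2 - q / (1 - q) + u\<^sup>2 / 2)" 
    by (simp add: exp_add[symmetric])
  also have "q / (1 - q) / 2 - q / (1 - q) + u\<^sup>2 / 2 = q\<^sup>2 / (2 * (1 - q)\<^sup>2)"
  proof -
    have "u\<^sup>2 = q / (1 - q)\<^sup>2" by (simp add: u_def q_def power_divide)
    moreover have "(1 - k) / k / 2 - (1 - k) / k + (1 - k) / k\<^sup>2 / 2 = (1 - k)\<^sup>2 / (2 * k\<^sup>2)" if "k \<noteq> 0" for k :: real
      using that by (simp add: field_simps power2_eq_square)
    from this[of "1 - q"] have "q / (1 - q) / 2 - q / (1 - q) + q / (1 - q)\<^sup>2 / 2 = q\<^sup>2 / (2 * (1 - q)\<^sup>2)"
      using q(2) by simp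
    ultimately show ?thesis by (simp only:)
  qed
  also have "exp (q\<^sup>2 / (2 * (1 - q)\<^sup>2)) \<le> exp (s^4)"
  proof -
    have "(3/4)\<^sup>2 \<le> (1 - q)\<^sup>2" using q by (intro power_mono) auto
    then have "1 \<le> 2 * (1 - q)\<^sup>2" by (simp add: power2_eq_square)
    then have "q\<^sup>2 / (2 * (1 - q)\<^sup>2) \<le> q\<^sup>2 / 1" by (intro divide_left_mono) auto
    then show ?thesis by (simp add: q_def)
  qed
  finally show ?thesis by (simp add: q_def)
qed

text \<open>
Completing the square turns the integrand into a multiple of a normal density. The hypothesis \<open>w < 2*v\<close> makes the resulting
precision \<open>2/w - 1/v\<close> positive.
\<close>

lemma normal_product_quotient_integral:
  fixes m n v w :: real
  assumes "0 < w" "w < 2 * v"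
  shows "has_bochner_integral lborel
    (\<lambda>x. normal_density m (sqrt w) x * normal_density n (sqrt w) x / normal_density 0 (sqrt v) x)
    (v / sqrt (w * (2 * v - w)) * exp (- (m\<^sup>2 + n\<^sup>2) / (2 * w) + (m + n)\<^sup>2 * v / (2 * w * (2 * v - w))))"
proof -
  have v: "0 < v" "0 < 2 * v - w" using assms by auto
  define p where "p = w * v / (2 * v - w)"
  define \<mu> where "\<mu> = (m + n) * v / (2 * v - w)"
  have p: "0 < p" using v assms by (simp add: p_def)
  define c where "c = v / sqrt (w * (2 * v - w)) * exp (- (m\<^sup>2 + n\<^sup>2) / (2 * w) + (m + n)\<^sup>2 * v / (2 * w * (2 * v - w)))"
  have eq: "normal_density m (sqrt w) x * normal_density n (sqrt w) x / normal_density 0 (sqrt v) x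
     = c * normal_density \<mu> (sqrt p) x" for x
  proof -
    have const: "1 / sqrt (2 * pi * w) * (1 / sqrt (2 * pi * w)) / (1 / sqrt (2 * pi * v))
      = v / sqrt (w * (2 * v - w)) * (1 / sqrt (2 * pi * p))"
    proof -
      have "1 / sqrt (2 * pi * w) * (1 / sqrt (2 * pi * w)) = 1 / (2 * pi * w)" using assms by simp
      then have f1: "1 / sqrt (2 * pi * w) * (1 / sqrt (2 * pi * w)) / (1 / sqrt (2 * pi * v)) = sqrt (2 * pi * v) / (2 * pi * w)"
        by simp
      have f2: "sqrt (w * (2 * v - w)) * sqrt (2 * pi * p) * sqrt (2 * pi * v) = 2 * pi * w * v"
      proof -
        have "w * (2 * v - w) * (2 * pi * p) * (2 * pi * v) = (2 * pi * w * v)\<^sup>2"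
          using v by (simp add: p_def power2_eq_square)
        then show ?thesis unfolding real_sqrt_mult[symmetric] using v assms by simp
      qed
      have f3: "0 < sqrt (w * (2 * v - w))" "0 < sqrt (2 * pi * p)" using v assms p by auto
      have f4: "C / (2 * pi * w) = v / A * (1 / B)"
        if "A * B * C = 2 * pi * w * v" "0 < A" "0 < B" for A B C :: real
        using that assms by (simp add: field_simps)
      show ?thesis unfolding f1 by (rule f4[OF f2 f3])
    qed
    have ex: "- (x - m)\<^sup>2 / (2 * w) + - (x - n)\<^sup>2 / (2 * w) - - (x - 0)\<^sup>2 / (2 * v)
      = (- (m\<^sup>2 + n\<^sup>2) / (2 * w) + (m + n)\<^sup>2 * v / (2 * w * (2 * v - w))) + - (x - \<mu>)\<^sup>2 / (2 * p)"
    proof -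
      have "(x - \<mu>)\<^sup>2 / (2 * p) = ((2 * v - w) * x - (m + n) * v)\<^sup>2 / (2 * w * v * (2 * v - w))"
      proof -
        have "x - \<mu> = ((2 * v - w) * x - (m + n) * v) / (2 * v - w)" using v by (simp add: \<mu>_def field_simps)
        then show ?thesis using v assms by (simp add: p_def power_divide power2_eq_square)
      qed
      moreover have "((2 * v - w) * x - (m + n) * v)\<^sup>2 / (2 * w * v * (2 * v - w)) =
          (x - m)\<^sup>2 / (2 * w) + (x - n)\<^sup>2 / (2 * w) - x\<^sup>2 / (2 * v) - (m\<^sup>2 + n\<^sup>2) / (2 * w) + (m + n)\<^sup>2 * v / (2 * w * (2 * v - w))"
      proof -
        define k where "k = 2 * v - w"
        have k: "k \<noteq> 0" "w = 2 * v - k" using v by (auto simp: k_def)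
        have "(k * x - (m + n) * v)\<^sup>2 = ((x - m)\<^sup>2 + (x - n)\<^sup>2) * v * k - x\<^sup>2 * w * k - (m\<^sup>2 + n\<^sup>2) * v * k + (m + n)\<^sup>2 * v * v"
          unfolding k(2) by (simp add: power2_eq_square algebra_simps)
        moreover have "((P + Q) * v * k - X * w * k - M * v * k + S * v * v) / (2 * w * v * k) =
            P / (2 * w) + Q / (2 * w) - X / (2 * v) - M / (2 * w) + S * v / (2 * w * k)" for P Q X M S
          using k(1) assms v by (simp add: field_simps)
        ultimately show ?thesis unfolding k_def[symmetric] by (simp add: minus_divide_left[symmetric] del: minus_add_distrib)
      qed
      ultimately show ?thesis unfolding minus_divide_left[symmetric] by simp
    qed
    have "normal_density m (sqrt w) x * normal_density n (sqrt w) x / normal_density 0 (sqrt v) x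
      = (1 / sqrt (2 * pi * w) * (1 / sqrt (2 * pi * w)) / (1 / sqrt (2 * pi * v))) *
        exp (- (x - m)\<^sup>2 / (2 * w) + - (x - n)\<^sup>2 / (2 * w) - - (x - 0)\<^sup>2 / (2 * v))"
      unfolding exp_add exp_diff normal_density_def using assms v by simp
    also have "\<dots> = c * normal_density \<mu> (sqrt p) x"
      unfolding const ex exp_add c_def normal_density_def using p by simp
    finally show ?thesis .
  qed
  have "has_bochner_integral lborel (\<lambda>x. c * normal_density \<mu> (sqrt p) x) (c * 1)"
    using normal_moment_even[of "sqrt p" \<mu> 0] p by (intro has_bochner_integral_mult_right) simp
  then show ?thesis unfolding eq c_def[symmetric] by simp
qed

lemma chi_square_near_gaussian:
  fixes e v :: real
  assumes "0 < v" "e\<^sup>2 \<le> v / 2"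
  shows "integrable lborel (\<lambda>x. (mix_density x (e, v - e\<^sup>2, v - e\<^sup>2))\<^sup>2 / mix_density x (0, v, v))"
    and "(\<integral>x. (mix_density x (e, v - e\<^sup>2, v - e\<^sup>2))\<^sup>2 / mix_density x (0, v, v) \<partial>lborel) \<le> exp (e^8 / v^4)"
proof -
  define w where "w = v - e\<^sup>2"
  define s where "s = e\<^sup>2 / v"
  have s: "0 \<le> s" "s \<le> 1/2" "e\<^sup>2 = s * v" using assms by (auto simp: s_def field_simps)
  have w: "w = v * (1 - s)" "2 * v - w = v * (1 + s)" using assms by (auto simp: w_def s(3) algebra_simps)
  have w0: "0 < w" "w < 2 * v" using assms s by (auto simp: w intro: mult_strict_left_mono)
  let ?f = "\<lambda>m n x. normal_density m (sqrt w) x * normal_density n (sqrt w) x / normal_density 0 (sqrt v) x"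
  have root: "v / sqrt (w * (2 * v - w)) = 1 / sqrt (1 - s\<^sup>2)"
  proof -
    have "w * (2 * v - w) = v\<^sup>2 * (1 - s\<^sup>2)" unfolding w by (simp add: power2_eq_square algebra_simps)
    then show ?thesis using assms by (simp add: real_sqrt_mult)
  qed
  have same: "- (e\<^sup>2 + e\<^sup>2) / (2 * w) + (e + e)\<^sup>2 * v / (2 * w * (2 * v - w)) = s / (1 + s)"
    "- ((-e)\<^sup>2 + (-e)\<^sup>2) / (2 * w) + (-e + -e)\<^sup>2 * v / (2 * w * (2 * v - w)) = s / (1 + s)"
  proof -
    have "(e + e)\<^sup>2 = 4 * (s * v)" "(-e + -e)\<^sup>2 = 4 * (s * v)" by (simp_all add: s(3)[symmetric] power2_eq_square)
    moreover have "- (s * v + s * v) / (2 * (v * (1 - s))) + 4 * (s * v) * v / (2 * (v * (1 - s)) * (v * (1 + s))) = s / (1 + s)"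
    proof -
      have "- (s * v + s * v) / (2 * (v * (1 - s))) = - s / (1 - s)" using assms s(2) by (simp add: divide_simps)
      moreover have "4 * (s * v) * v / (2 * (v * (1 - s)) * (v * (1 + s))) = 2 * s / ((1 - s) * (1 + s))"
        using assms s(2) by (simp add: divide_simps)
      moreover have "- s / (1 - s) + 2 * s / ((1 - s) * (1 + s)) = s / (1 + s)"
      proof -
        have "- s / (1 - s) = (- s * (1 + s)) / ((1 - s) * (1 + s))" using s by simp
        moreover have "- s * (1 + s) + 2 * s = (1 - s) * s" by (simp add: algebra_simps)
        ultimately show ?thesis using s by (simp only: add_divide_distrib[symmetric]) simp
      qed
      ultimately show ?thesis by simp
    qed
    ultimately show "- (e\<^sup>2 + e\<^sup>2) / (2 * w) + (e + e)\<^sup>2 * v / (2 * w * (2 * v - w)) = s / (1 + s)"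
      "- ((-e)\<^sup>2 + (-e)\<^sup>2) / (2 * w) + (-e + -e)\<^sup>2 * v / (2 * w * (2 * v - w)) = s / (1 + s)"
      unfolding w(2) unfolding w(1) power2_minus s(3) by (simp_all only:)
  qed
  have opp: "- ((-e)\<^sup>2 + e\<^sup>2) / (2 * w) + (-e + e)\<^sup>2 * v / (2 * w * (2 * v - w)) = - s / (1 - s)"
    unfolding w(2) unfolding w(1) power2_minus s(3) using assms s(1,2) by (simp add: field_simps)
  define r where "r = 1 / sqrt (1 - s\<^sup>2)"
  note I = normal_product_quotient_integral[OF w0, unfolded root, folded r_def]
  have i1: "has_bochner_integral lborel (?f (-e) (-e)) (r * exp (s / (1 + s)))"
    using I[of "-e" "-e"] unfolding same .
  have i2: "has_bochner_integral lborel (?f e e) (r * exp (s / (1 + s)))"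
    using I[of e e] unfolding same .
  have i3: "has_bochner_integral lborel (?f (-e) e) (r * exp (- s / (1 - s)))"
    using I[of "-e" e] unfolding opp .
  have "(mix_density x (e, w, w))\<^sup>2 / mix_density x (0, v, v) = 1/4 * (?f (-e) (-e) x + ?f e e x) + 1/2 * ?f (-e) e x" for x
    by (simp add: mix_density_def power2_eq_square add_divide_distrib algebra_simps)
  moreover have "has_bochner_integral lborel (\<lambda>x. 1/4 * (?f (-e) (-e) x + ?f e e x) + 1/2 * ?f (-e) e x)
      (1/4 * (r * exp (s / (1 + s)) + r * exp (s / (1 + s))) + 1/2 * (r * exp (- s / (1 - s))))"
    by (intro has_bochner_integral_add has_bochner_integral_mult_right i1 i2 i3)
  ultimately have "has_bochner_integral lborel (\<lambda>x. (mix_density x (e, w, w))\<^sup>2 / mix_density x (0, v, v))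
      (1/4 * (r * exp (s / (1 + s)) + r * exp (s / (1 + s))) + 1/2 * (r * exp (- s / (1 - s))))"
    by (simp only:)
  also have "1/4 * (r * exp (s / (1 + s)) + r * exp (s / (1 + s))) + 1/2 * (r * exp (- s / (1 - s))) =
      r * ((exp (s / (1 + s)) + exp (- s / (1 - s))) / 2)"
    by (simp add: field_simps)
  finally have main: "has_bochner_integral lborel (\<lambda>x. (mix_density x (e, w, w))\<^sup>2 / mix_density x (0, v, v))
      (r * ((exp (s / (1 + s)) + exp (- s / (1 - s))) / 2))" .
  show "integrable lborel (\<lambda>x. (mix_density x (e, v - e\<^sup>2, v - e\<^sup>2))\<^sup>2 / mix_density x (0, v, v))"
    using main unfolding w_def by (rule integrable.intros)
  have "(\<integral>x. (mix_density x (e, v - e\<^sup>2, v - e\<^sup>2))\<^sup>2 / mix_density x (0, v, v) \<partial>lborel) = 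
      r * ((exp (s / (1 + s)) + exp (- s / (1 - s))) / 2)"
    using main unfolding w_def by (rule has_bochner_integral_integral_eq)
  also have "\<dots> \<le> exp (s^4)" unfolding r_def by (rule hermite_cancellation[OF s(1,2)])
  also have "s^4 = e^8 / v^4" by (simp add: s_def power_divide power_mult[symmetric])
  finally show "(\<integral>x. (mix_density x (e, v - e\<^sup>2, v - e\<^sup>2))\<^sup>2 / mix_density x (0, v, v) \<partial>lborel) \<le> exp (e^8 / v^4)" .
qed

section \<open>The minimax lower bound\<close>

text \<open>
Le Cam's method with a bound on the second moment of the likelihood ratio \<open>w\<close>. The estimate
\<open>w - w\<^sup>2/4 \<le> min 1 w\<close> shows that the overlap of the two laws, which is the expectation of \<open>min 1 w\<close>, is at least \<open>1/2\<close>.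
\<close>

lemma le_cam_two_point:
  fixes w L1 L2 :: "'a \<Rightarrow> real"
  assumes [measurable]: "w \<in> borel_measurable P" "L1 \<in> borel_measurable P" "L2 \<in> borel_measurable P"
    and nonneg: "\<And>y. 0 \<le> w y" "\<And>y. 0 \<le> L1 y" "\<And>y. 0 \<le> L2 y" "0 \<le> \<epsilon>"
    and sep: "\<And>y. \<epsilon> \<le> L1 y + L2 y"
    and int: "(\<integral>\<^sup>+ y. ennreal (w y) \<partial>P) = 1" "(\<integral>\<^sup>+ y. ennreal ((w y)\<^sup>2) \<partial>P) \<le> 2"
  shows "ennreal (\<epsilon> / 2) \<le> (\<integral>\<^sup>+ y. ennreal (L1 y) \<partial>P) + (\<integral>\<^sup>+ y. ennreal (w y) * ennreal (L2 y) \<partial>P)"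
proof -
  let ?A = "\<integral>\<^sup>+ y. ennreal (L1 y) \<partial>P" and ?B = "\<integral>\<^sup>+ y. ennreal (w y) * ennreal (L2 y) \<partial>P"
  \<comment> \<open>The summand \<open>\<epsilon>/4 * w\<^sup>2\<close> compensates the values \<open>w > 1\<close>, where \<open>w\<close> exceeds \<open>min 1 w\<close>.\<close>
  have pw: "\<epsilon> * w y \<le> L1 y + w y * L2 y + \<epsilon> / 4 * (w y)\<^sup>2" for y
  proof (cases "w y \<le> 1")
    case True
    have "\<epsilon> * w y \<le> (L1 y + L2 y) * w y" using sep nonneg by (intro mult_right_mono) auto
    moreover have "L1 y * w y \<le> L1 y * 1" using True nonneg by (intro mult_left_mono) auto
    moreover have "0 \<le> \<epsilon> / 4 * (w y)\<^sup>2" using nonneg by simp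
    ultimately show ?thesis by (simp add: algebra_simps)
  next
    case False
    have "w y \<le> 1 + 1 / 4 * (w y)\<^sup>2" using zero_le_power2[of "w y / 2 - 1"] by (simp add: power2_eq_square algebra_simps)
    then have "\<epsilon> * w y \<le> \<epsilon> * (1 + 1 / 4 * (w y)\<^sup>2)" using nonneg by (intro mult_left_mono) auto
    moreover have "L2 y \<le> w y * L2 y" using False nonneg mult_right_mono[of 1 "w y" "L2 y"] by simp
    ultimately show ?thesis using sep[of y] by (simp add: algebra_simps)
  qed
  have "ennreal \<epsilon> = ennreal \<epsilon> * (\<integral>\<^sup>+ y. ennreal (w y) \<partial>P)" by (simp add: int)
  also have "\<dots> = (\<integral>\<^sup>+ y. ennreal (\<epsilon> * w y) \<partial>P)"
    using nonneg by (subst nn_integral_cmult[symmetric]) (auto simp: ennreal_mult)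
  also have "\<dots> \<le> (\<integral>\<^sup>+ y. ennreal (L1 y) + ennreal (w y) * ennreal (L2 y) + ennreal (\<epsilon> / 4) * ennreal ((w y)\<^sup>2) \<partial>P)"
  proof (rule nn_integral_mono)
    fix y
    have "ennreal (\<epsilon> * w y) \<le> ennreal (L1 y + w y * L2 y + \<epsilon> / 4 * (w y)\<^sup>2)" by (intro ennreal_leI pw)
    also have "\<dots> = ennreal (L1 y) + ennreal (w y) * ennreal (L2 y) + ennreal (\<epsilon> / 4) * ennreal ((w y)\<^sup>2)"
    proof -
      have "ennreal (\<epsilon> / 4 * (w y)\<^sup>2) = ennreal (\<epsilon> / 4) * ennreal ((w y)\<^sup>2)"
        "ennreal (w y * L2 y) = ennreal (w y) * ennreal (L2 y)"
        using nonneg by (intro ennreal_mult; simp)+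
      moreover have "0 \<le> \<epsilon> / 4 * (w y)\<^sup>2" "0 \<le> w y * L2 y" using nonneg by auto
      ultimately show ?thesis using nonneg(2)[of y] by (simp only: ennreal_plus add_nonneg_nonneg)
    qed
    finally show "ennreal (\<epsilon> * w y) \<le> \<dots>" .
  qed
  also have "\<dots> = ?A + ?B + ennreal (\<epsilon> / 4) * (\<integral>\<^sup>+ y. ennreal ((w y)\<^sup>2) \<partial>P)"
    by (simp add: nn_integral_add nn_integral_cmult)
  also have "\<dots> \<le> ?A + ?B + ennreal (\<epsilon> / 4) * 2" using int by (intro add_left_mono mult_left_mono) auto
  also have "ennreal (\<epsilon> / 4) * 2 = ennreal (\<epsilon> / 2)"
    using nonneg(4) ennreal_mult[of "\<epsilon> / 4" 2] by simp
  finally have "ennreal (\<epsilon> / 2) + ennreal (\<epsilon> / 2) \<le> ?A + ?B + ennreal (\<epsilon> / 2)"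
    using nonneg(4) by (simp add: ennreal_plus[symmetric])
  then have "ennreal (\<epsilon> / 2) + ennreal (\<epsilon> / 2) \<le> ennreal (\<epsilon> / 2) + (?A + ?B)"
    by (simp only: add.commute)
  then show ?thesis by (simp add: ennreal_add_left_cancel_le)
qed

lemma estimator_component_measurable:
  assumes "T \<in> estimators n H"
  shows "(\<lambda>y. fst (T y)) \<in> borel_measurable (sample_space n)"
proof -
  have "T \<in> sample_space n \<rightarrow>\<^sub>M borel"
    using assms by (simp add: estimators_def measurable_restrict_space2_iff)
  moreover have "(fst :: param \<Rightarrow> real) \<in> borel_measurable borel"
    by (intro borel_measurable_continuous_onI continuous_intros)
  ultimately show ?thesis by measurable
qed

text \<open>
The location of an estimate cannot be close, up to sign, to both \<open>0\<close> and \<open>e\<close>, so the two losses add up to at least \<open>e\<close>. The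
hypothesis on \<open>n\<close> keeps the chi-square divergence of the product laws bounded.
\<close>

lemma two_point_risk_bound:
  fixes v e :: real
  assumes T: "T \<in> estimators n H" and "0 < v" "0 \<le> e" "e\<^sup>2 \<le> v / 2" and small: "real n * e^8 \<le> v^4 / 2"
  shows "ennreal (e / 2) \<le> risk 4 n T (0, v, v) + risk 4 n T (e, v - e\<^sup>2, v - e\<^sup>2)"
proof -
  define \<eta> :: param where "\<eta> = (0, v, v)"
  define \<zeta> :: param where "\<zeta> = (e, v - e\<^sup>2, v - e\<^sup>2)"
  have pos: "0 < v" "0 < v - e\<^sup>2" using assms by auto
  define P where "P = sample_dist n \<eta>"
  define w where "w y = (\<Prod>i<n. mix_density (y i) \<zeta> / mix_density (y i) \<eta>)" for y :: "nat \<Rightarrow> real"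
  define L1 where "L1 y = \<bar>fst (T y)\<bar>" for y
  define L2 where "L2 y = \<bar>\<bar>fst (T y)\<bar> - e\<bar>" for y
  note [measurable] = estimator_component_measurable[OF T]
  have sets_P [measurable_cong]: "sets P = sets (sample_space n)" by (simp add: P_def sets_sample_dist)
  have meas [measurable]: "w \<in> borel_measurable P" "L1 \<in> borel_measurable P" "L2 \<in> borel_measurable P"
    unfolding w_def L1_def L2_def by measurable
  have ratio: "0 \<le> mix_density x \<zeta> / mix_density x \<eta>" for x by (simp add: mix_density_nonneg)
  have w0: "0 \<le> w y" for y unfolding w_def by (intro prod_nonneg ballI ratio)
  have mpos: "0 < mix_density x \<eta>" for x unfolding \<eta>_def by (rule mix_density_pos[OF pos(1) pos(1)])
  have w_prod: "ennreal (w y) = (\<Prod>i<n. ennreal (mix_density (y i) \<zeta> / mix_density (y i) \<eta>))" for y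
    unfolding w_def by (rule prod_ennreal[symmetric]) (rule ratio)
  have change: "sample_dist n \<zeta> = density P (\<lambda>y. ennreal (w y))"
    unfolding P_def w_prod \<eta>_def \<zeta>_def by (rule sample_dist_density) (use pos in auto)
  have one: "(\<integral>\<^sup>+ y. ennreal (w y) \<partial>P) = 1"
  proof -
    interpret prob_space "sample_dist n \<zeta>"
      unfolding sample_dist_def \<zeta>_def by (intro prob_space_PiM prob_space_mix_density pos)
    have "emeasure (density P (\<lambda>y. ennreal (w y))) (space P) = 1"
      using emeasure_space_1 unfolding change by simp
    then show ?thesis by (simp add: emeasure_density)
  qed
  have two: "(\<integral>\<^sup>+ y. ennreal ((w y)\<^sup>2) \<partial>P) \<le> 2"
  proof -
    have "(\<integral>\<^sup>+ y. ennreal ((w y)\<^sup>2) \<partial>P) = (\<integral>\<^sup>+ y. (\<Prod>i<n. ennreal ((mix_density (y i) \<zeta> / mix_density (y i) \<eta>)\<^sup>2)) \<partial>P)"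
      unfolding w_def by (intro nn_integral_cong) (simp add: prod_ennreal prod_power_distrib)
    also have "\<dots> = (\<integral>\<^sup>+ x. ennreal (mix_density x \<eta>) * ennreal ((mix_density x \<zeta> / mix_density x \<eta>)\<^sup>2) \<partial>lborel) ^ n"
      unfolding P_def \<eta>_def by (rule nn_integral_sample_prod) (use pos in auto)
    also have "(\<lambda>x. ennreal (mix_density x \<eta>) * ennreal ((mix_density x \<zeta> / mix_density x \<eta>)\<^sup>2)) =
        (\<lambda>x. ennreal ((mix_density x \<zeta>)\<^sup>2 / mix_density x \<eta>))"
      using mpos by (auto simp: fun_eq_iff ennreal_mult[symmetric] power_divide power2_eq_square less_imp_le)
    also have "(\<integral>\<^sup>+ x. ennreal ((mix_density x \<zeta>)\<^sup>2 / mix_density x \<eta>) \<partial>lborel) =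
        ennreal (\<integral>x. (mix_density x \<zeta>)\<^sup>2 / mix_density x \<eta> \<partial>lborel)"
      using chi_square_near_gaussian(1)[of v e] assms mpos unfolding \<eta>_def \<zeta>_def
      by (intro nn_integral_eq_integral) (auto simp: less_imp_le)
    also have "\<dots> ^ n \<le> ennreal (exp (e^8 / v^4)) ^ n"
      using chi_square_near_gaussian(2)[of v e] assms unfolding \<eta>_def \<zeta>_def
      by (intro power_mono ennreal_leI) auto
    also have "\<dots> = ennreal (exp (real n * (e^8 / v^4)))"
      by (simp only: ennreal_power[OF exp_ge_zero] exp_of_nat_mult)
    also have "\<dots> \<le> ennreal 2"
    proof (intro ennreal_leI)
      have "real n * (e^8 / v^4) \<le> 1/2" using small pos by (simp add: field_simps)
      then have "exp (real n * (e^8 / v^4)) \<le> exp (1/2)" by simp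
      also have "\<dots> \<le> 2" using exp_half_le2 by simp
      finally show "exp (real n * (e^8 / v^4)) \<le> 2" .
    qed
    finally show ?thesis by simp
  qed
  have quart: "\<bar>x\<bar> \<le> loss 4 (T y) (z, u, u')" if "\<bar>x\<bar> \<le> \<bar>fst (T y) - z\<bar>" "\<bar>x\<bar> \<le> \<bar>fst (T y) + z\<bar>" for x y z u u'
  proof -
    obtain s v1 v2 where Ty: "T y = (s, v1, v2)" by (cases "T y") auto
    have "\<bar>x\<bar>^4 \<le> \<bar>s - z\<bar>^4" "\<bar>x\<bar>^4 \<le> \<bar>s + z\<bar>^4" 
      by (rule power_mono[OF that(1)[unfolded Ty fst_conv] abs_ge_zero], rule power_mono[OF that(2)[unfolded Ty fst_conv] abs_ge_zero])
    then have "x^4 \<le> quartic_loss (T y) (z, u, u')"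
      by (auto simp: quartic_loss_def Ty power_even_abs intro!: add_increasing2)
    then have "(x^4) powr (1/4) \<le> loss 4 (T y) (z, u, u')"
      unfolding loss_4_eq by (intro powr_mono2) auto
    then show ?thesis by (simp only: power4_powr_quarter)
  qed
  have "ennreal (e / 2) \<le> (\<integral>\<^sup>+ y. ennreal (L1 y) \<partial>P) + (\<integral>\<^sup>+ y. ennreal (w y) * ennreal (L2 y) \<partial>P)"
    by (rule le_cam_two_point) (use one two w0 assms in \<open>auto simp: L1_def L2_def\<close>)
  also have "(\<integral>\<^sup>+ y. ennreal (w y) * ennreal (L2 y) \<partial>P) = (\<integral>\<^sup>+ y. ennreal (L2 y) \<partial>sample_dist n \<zeta>)"
    unfolding change by (intro nn_integral_density[symmetric]) auto
  also have "(\<integral>\<^sup>+ y. ennreal (L1 y) \<partial>P) \<le> risk 4 n T \<eta>"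
    unfolding risk_def P_def L1_def \<eta>_def by (intro nn_integral_mono ennreal_leI quart) auto
  also have "(\<integral>\<^sup>+ y. ennreal (L2 y) \<partial>sample_dist n \<zeta>) \<le> risk 4 n T \<zeta>"
    unfolding risk_def L2_def \<zeta>_def by (intro nn_integral_mono ennreal_leI quart) (use assms in auto)
  finally show ?thesis by (simp add: \<eta>_def \<zeta>_def add_mono)
qed

text \<open>
The alternative has location \<open>e = \<delta> * n powr (-1/8)\<close>. Its loss to the fourth power is \<open>3*e^4\<close>, which is why it lies in the neighbourhood
of radius \<open>3*\<delta>^4 * n powr (-1/2)\<close>, while \<open>n * e^8\<close> stays bounded.
\<close>

lemma minimax_lower_bound:
  assumes "0 \<in> interior \<Theta>" "v0 \<in> interior \<Omega>" "0 < v0"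
  shows "\<exists>c2 C' :: real. c2 > 0 \<and> C' > 0 \<and>
      (\<forall>n::nat. n \<ge> 1 \<longrightarrow>
        (INF T \<in> estimators n (param_space \<Theta> \<Omega>).
           SUP \<eta> \<in> local_params \<Theta> \<Omega> 4 (0, v0, v0) (c2 * real n powr (- 1/2)). risk 4 n T \<eta>)
          \<ge> ennreal (C' * (1 / real n) powr (1 / 8)))"
proof -
  obtain r1 where r1: "0 < r1" "ball 0 r1 \<subseteq> \<Theta>" using assms(1) by (meson mem_interior)
  obtain r2 where r2: "0 < r2" "ball v0 r2 \<subseteq> \<Omega>" using assms(2) by (meson mem_interior)
  \<comment> \<open>Small enough for both locations and both variances to be admissible, and for the chi-square bound.\<close>
  define m where "m = min (min r1 1) (min r2 (v0 / 2))"
  define \<delta> where "\<delta> = m / 2"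
  have m: "0 < m" "m \<le> r1" "m \<le> 1" "m \<le> r2" "m \<le> v0 / 2" using r1 r2 assms by (auto simp: m_def)
  have \<delta>: "0 < \<delta>" "\<delta> < r1" "\<delta> \<le> 1" "\<delta>\<^sup>2 < r2" "\<delta>\<^sup>2 \<le> v0 / 2"
  proof -
    have "\<delta>\<^sup>2 \<le> \<delta>" using m by (simp add: power2_eq_square \<delta>_def mult_left_le)
    then show "0 < \<delta>" "\<delta> < r1" "\<delta> \<le> 1" "\<delta>\<^sup>2 < r2" "\<delta>\<^sup>2 \<le> v0 / 2" using m by (auto simp: \<delta>_def)
  qed
  show ?thesis
  proof (rule exI[of _ "3 * \<delta>^4"], rule exI[of _ "\<delta> / 4"], intro conjI allI impI)
    show "0 < 3 * \<delta>^4" "0 < \<delta> / 4" using \<delta> by auto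
    fix n :: nat assume n: "1 \<le> n"
    define e where "e = \<delta> * (1 / real n) powr (1 / 8)"
    have e0: "0 < e" using n \<delta> by (simp add: e_def)
    have "(1 / real n) powr (1 / 8) \<le> 1" using n by (intro powr_le1) auto
    then have e1: "e \<le> \<delta>" using \<delta> mult_left_le[of "(1 / real n) powr (1 / 8)" \<delta>] by (simp add: e_def)
    then have e2: "e\<^sup>2 \<le> \<delta>\<^sup>2" using e0 by (intro power_mono) auto
    have root: "((1 / real n) powr (1 / 8)) ^ k = (1 / real n) powr (real k / 8)" for k
      using n by (simp add: powr_power)
    have e4: "e^4 = \<delta>^4 * real n powr (- 1/2)"
    proof -
      have "(1 / real n) powr (real 4 / 8) = real n powr (- 1/2)" using n by (simp add: powr_minus_divide powr_divide)
      then show ?thesis unfolding e_def power_mult_distrib root by simp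
    qed
    have e8: "real n * e^8 = \<delta>^8"
      unfolding e_def power_mult_distrib root using n by simp
    have "\<delta>^8 = (\<delta>\<^sup>2)^4" by (simp add: power_mult[symmetric])
    also have "\<dots> \<le> (v0 / 2)^4" using \<delta> by (intro power_mono) auto
    also have "\<dots> \<le> v0^4 / 2" using assms(3) by (simp add: power_divide)
    finally have small: "real n * e^8 \<le> v0^4 / 2" using e8 by simp
    define \<eta> :: param where "\<eta> = (0, v0, v0)"
    define \<zeta> :: param where "\<zeta> = (e, v0 - e\<^sup>2, v0 - e\<^sup>2)"
    let ?L = "local_params \<Theta> \<Omega> 4 (0, v0, v0) (3 * \<delta>^4 * real n powr (- 1/2))"
    have loss4: "loss 4 x y ^ 4 = quartic_loss x y" for x y
      using quartic_loss_nonneg[of x y] by (simp only: loss_4_eq powr_quarter_power4)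
    have "0 \<in> \<Theta>" "e \<in> \<Theta>" using r1 e0 e1 \<delta> by (auto simp: subset_iff dist_real_def)
    moreover have "v0 \<in> \<Omega>" "v0 - e\<^sup>2 \<in> \<Omega>" using r2 e2 \<delta> by (auto simp: subset_iff dist_real_def)
    ultimately have \<eta>L: "\<eta> \<in> ?L" and \<zeta>L: "\<zeta> \<in> ?L"
      using \<delta>(1) e4 unfolding local_params_def param_space_def \<eta>_def \<zeta>_def
      by (auto simp: loss4 quartic_loss_def power_mult[symmetric])
    show "ennreal (\<delta> / 4 * (1 / real n) powr (1 / 8)) \<le> (INF T \<in> estimators n (param_space \<Theta> \<Omega>). SUP \<eta> \<in> ?L. risk 4 n T \<eta>)"
    proof (rule INF_greatest)
      fix T assume T: "T \<in> estimators n (param_space \<Theta> \<Omega>)"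
      let ?S = "SUP \<eta> \<in> ?L. risk 4 n T \<eta>"
      have "ennreal (e / 2) \<le> risk 4 n T \<eta> + risk 4 n T \<zeta>"
        unfolding \<eta>_def \<zeta>_def using T assms(3) e0 order.trans[OF e2 \<delta>(5)] small by (intro two_point_risk_bound) auto
      also have "\<dots> \<le> ?S + ?S" by (intro add_mono SUP_upper \<eta>L \<zeta>L)
      finally have "ennreal (e / 4) + ennreal (e / 4) \<le> ?S + ?S" using e0 by (simp add: ennreal_plus[symmetric])
      then have "ennreal (e / 4) \<le> ?S"
        by (metis add_strict_mono leD leI)
      then show "ennreal (\<delta> / 4 * (1 / real n) powr (1 / 8)) \<le> ?S" by (simp add: e_def)
    qed
  qed
qed

section \<open>Rates for known equal proportions\<close>

theorem theorem2p4:
  fixes \<Theta> \<Omega> :: "real set"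
  assumes "compact \<Theta>" and "compact \<Omega>" and "\<Omega> \<subseteq> {0<..}" and "0 \<in> interior \<Theta>"
  shows "(\<exists>C::real. C > 0 \<and>
      (\<forall>n::nat. n \<ge> 2 \<longrightarrow> (\<forall>T \<in> mles n (param_space \<Theta> \<Omega>).
        (SUP \<eta> \<in> param_space \<Theta> \<Omega>. risk (real sym_order) n T \<eta>)
          \<le> ennreal (C * (ln (real n) / real n) powr (1 / (2 * real sym_order))))))
    \<and> (\<forall>v0 \<in> interior \<Omega>. \<exists>c2 C' :: real. c2 > 0 \<and> C' > 0 \<and>
      (\<forall>n::nat. n \<ge> 1 \<longrightarrow>
        (INF T \<in> estimators n (param_space \<Theta> \<Omega>).
           SUP \<eta> \<in> local_params \<Theta> \<Omega> sym_order (0, v0, v0) (c2 * real n powr (- 1/2)).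
             risk (real sym_order) n T \<eta>)
          \<ge> ennreal (C' * (1 / real n) powr (1 / (2 * real sym_order)))))"
proof -
  obtain R where R: "0 \<le> R" "\<Theta> \<subseteq> {-R..R}"
  proof -
    obtain B where "0 < B" "\<And>x. x \<in> \<Theta> \<Longrightarrow> norm x \<le> B" using compact_imp_bounded[OF assms(1)] bounded_pos by blast
    moreover from this have "\<Theta> \<subseteq> {-B..B}" by (force simp: abs_le_iff)
    ultimately show ?thesis using that[of B] by simp
  qed
  obtain a b where ab: "0 < a" "a \<le> b" "\<Omega> \<subseteq> {a..b}"
  proof (cases "\<Omega> = {}")
    case True
    then show ?thesis using that[of 1 1] by auto
  next
    case False
    obtain a where a: "a \<in> \<Omega>" "\<And>x. x \<in> \<Omega> \<Longrightarrow> a \<le> x" using compact_attains_inf[OF assms(2) False] by blast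
    obtain b where b: "b \<in> \<Omega>" "\<And>x. x \<in> \<Omega> \<Longrightarrow> x \<le> b" using compact_attains_sup[OF assms(2) False] by blast
    have "0 < a" "a \<le> b" using a(1) assms(3) a(2)[OF b(1)] by auto
    moreover have "\<Omega> \<subseteq> {a..b}" using a(2) b(2) by auto
    ultimately show ?thesis using that by blast
  qed
  have box: "param_space \<Theta> \<Omega> \<subseteq> param_box R a b"
    using R ab by (auto simp: param_space_def param_box_def)
  have order: "real sym_order = 4" "1 / (2 * 4) = (1 / 8 :: real)" by (simp_all add: sym_order_eq_4)
  obtain C where C: "0 < C" "\<And>n T \<eta>. 2 \<le> n \<Longrightarrow> T \<in> mles n (param_space \<Theta> \<Omega>) \<Longrightarrow> \<eta> \<in> param_space \<Theta> \<Omega> \<Longrightarrow>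
      risk 4 n T \<eta> \<le> ennreal (C * (ln (real n) / real n) powr (1/8))"
    using mle_upper_bound[OF ab(1,2) R(1)] box by meson
  show ?thesis
    unfolding order(1) unfolding order(2) sym_order_eq_4
  proof (intro conjI ballI)
    show "\<exists>C>0. \<forall>n\<ge>2. \<forall>T\<in>mles n (param_space \<Theta> \<Omega>). (SUP \<eta>\<in>param_space \<Theta> \<Omega>. risk 4 n T \<eta>)
        \<le> ennreal (C * (ln (real n) / real n) powr (1 / 8))"
      using C by (intro exI[of _ C]) (auto intro!: SUP_least)
    fix v0 assume v0: "v0 \<in> interior \<Omega>"
    then have "0 < v0" using assms(3) interior_subset by auto
    then show "\<exists>c2 C' :: real. c2 > 0 \<and> C' > 0 \<and>
      (\<forall>n::nat. n \<ge> 1 \<longrightarrow>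
        (INF T \<in> estimators n (param_space \<Theta> \<Omega>).
           SUP \<eta> \<in> local_params \<Theta> \<Omega> 4 (0, v0, v0) (c2 * real n powr (- 1/2)). risk 4 n T \<eta>)
          \<ge> ennreal (C' * (1 / real n) powr (1 / 8)))"
      by (rule minimax_lower_bound[OF assms(4) v0])
  qed
qed

end
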